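(* Let $\lambda:[0,\infty)\to[0,\infty)$ be a locally integrable arrival intensity with $\lambda(t)=0$ for $t<0$, and let $\sigma_\lambda\ge 0$ be the abscissa of convergence of its Laplace transform $\widehat\lambda(z)=\int_0^\infty e^{-zt}\lambda(t)\,dt$. Assume: (1) for some real $\lambda_0>0$: if $\sigma_\lambda>0$, then $\lambda(t)\le\lambda_0e^{\sigma_\lambda t}$ for all $t\ge0$; if $\sigma_\lambda=0$, then there are real numbers $p\ge0$, $a_1\ge0$, $a_2>0$ with $\max\{a_1,a_2\}=1$ such that $\lambda(t)\le\lambda_0(a_1+a_2t^p)$ for all $t\ge0$; (2) $\widehat\lambda$ has no zeros in $\{z\in\mathbb{C}:\mathrm{Re}(z)>\sigma_\lambda\}$, and for some $\gamma\ge0$, $k_0>0$ (and the same $\lambda_0$), $$|\widehat\lambda(\sigma+i\omega)|\ge\frac{\lambda_0k_0}{[(\sigma-\sigma_\lambda)^2+\omega^2]^{\gamma/2}},\qquad\omega\in\mathbb{R},\ \sigma>\sigma_\lambda.$$ Let $x_0>0$, $\beta>0$, $A>0$, $d>0$, $M>0$. Let $K$ be a kernel supported on $[0,1]$ such that, for positive integers $m\ge\lfloor\beta\rfloor+1$ and $r>\gamma+1$: (K1) $\int_0^1K(t)\,dt=1$ and $\int_0^1t^kK(t)\,dt=0$ for $k=1,\ldots,m$; (K2) $K$ is $r$ times continuously differentiable on $\mathbb{R}$ and $\max_{x\in[0,1]}|K^{(j)}(x)|\le C_K<\infty$ for all $j=0,1,\ldots,r$. Let $\tilde G_*(x_0)$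 be the estimator $$\tilde G_h(x_0)=1-\frac1n\sum_{k=1}^n\int_0^TL_h(t-x_0)X_k(t)\,dt$$ associated with the kernel $K$ and the parameter $$h=h_*=\Big(\frac{M\varkappa}{A^2\lambda_0n}\Big)^{1/(2\beta+2\gamma+1)},\qquad \varkappa:=\begin{cases}\sigma_\lambda^{-1}e^{2\sigma_\lambda x_0},&\sigma_\lambda>0,\\ a_1+a_2x_0^p,&\sigma_\lambda=0.\end{cases}$$ If $T=T_n\to\infty$ so that $\frac1T\ln(\lambda_0n)\to0$ as $n\to\infty$, then $$\limsup_{n\to\infty}\Big\{\varphi_n^{-1}\,\mathcal{R}_{x_0}[\tilde G_*;\bar{\mathscr{H}}_{\beta,x_0}(A,M)]\Big\}\le C_1,\qquad \varphi_n:=A^{(2\gamma+1)/(2\beta+2\gamma+1)}\Big(\frac{M\varkappa}{\lambda_0n}\Big)^{\beta/(2\beta+2\gamma+1)},$$ where $C_1$ may depend only on $\beta$, $\gamma$, $p$, $k_0$ and the fixed kernel $K$.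
   Context: Model: in an $M_t/G/\infty$ queue customers arrive at the points $\tau_j$ of a non-homogeneous Poisson process on $[0,\infty)$ with intensity $\lambda(t)$, $t\ge0$; the service times $\sigma_j$ are positive, i.i.d. with distribution function $G$, independent of the arrivals; the queue length is $X(t)=\sum_j\mathbf{1}(\tau_j\le t,\ \sigma_j>t-\tau_j)$. Observed are $n$ independent realizations $X_1(t),\ldots,X_n(t)$ of $\{X(t)\}$ on $[0,T]$. $\mathbb{E}_G$ is expectation when the service time distribution is $G$. Kernel $L_h$: with the bilateral Laplace transform $\widehat K(z)=\int_{-\infty}^\infty e^{-zt}K(t)\,dt$ and $h>0$, $$L_h(t):=\frac{1}{2\pi i}\int_{s-i\infty}^{s+i\infty}\frac{\widehat K(zh)}{\widehat\lambda(-z)}e^{zt}\,dz=\frac{e^{st}}{2\pi}\int_{-\infty}^\infty\frac{\widehat K((s+i\omega)h)}{\widehat\lambda(-s-i\omega)}e^{i\omega t}\,d\omega,\quad t\in\mathbb{R},$$ where $s$ is any real number with $s<-\sigma_\lambda$ (under the stated assumptions $L_h$ does not depend on this choice). Function classes: $\lfloor\beta\rfloor:=\max\{k\in\{0,1,2,\ldots\}:k<\beta\}$. A function $f$ belongs to $\mathscr{H}_{\beta,x_0}(A)$ if it is $\lfloor\beta\rfloor$ times continuously differentiable on $(x_0-d,x_0+d)$ and $|f^{(\lfloor\beta\rfloor)}(x)-f^{(\lfloor\beta\rfloor)}(x')|\le A|x-x'|^{\beta-\lfloor\beta\rfloor}$ for all $x,x'\in(x_0-d,x_0+d)$. A distribution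 function $G$ supported on $[0,\infty)$ belongs to $\mathscr{G}(M)$ if $\max_{k=1,2}\int_0^\infty kt^{k-1}[1-G(t)]\,dt\le M$. Finally $\bar{\mathscr{H}}_{\beta,x_0}(A,M):=\mathscr{H}_{\beta,x_0}(A)\cap\mathscr{G}(M)$. Risk: for an estimator $\tilde G(x_0)$ and a class $\mathscr{G}$ of distributions, $\mathcal{R}_{x_0}[\tilde G;\mathscr{G}]:=\sup_{G\in\mathscr{G}}\big[\mathbb{E}_G|\tilde G(x_0)-G(x_0)|^2\big]^{1/2}$. All parameters ($x_0,\beta,A,d,M,\lambda$ and its constants, $K$) are fixed while $n\to\infty$. *)

theory Defs
  imports "HOL-Probability.Probability"
begin

definition bilateral_laplace :: "(real \<Rightarrow> real) \<Rightarrow> complex \<Rightarrow> complex" where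
  "bilateral_laplace f z = (LINT t|lborel. exp (- z * of_real t) * of_real (f t))"

text \<open>For the nonnegative functions considered here, which vanish on the negative half-line,
  convergence of the Laplace integral at a real point is the same as Lebesgue integrability.\<close>

definition laplace_abscissa :: "(real \<Rightarrow> real) \<Rightarrow> ereal" where
  "laplace_abscissa f = Inf {ereal c | c. set_integrable lborel {0..} (\<lambda>t. exp (- c * t) * f t)}"

text \<open>The function \<open>L_h\<close>, computed along the line \<open>Re z = s\<close>. It is kept complex-valued, so that
  no real part has to be inserted.\<close>

definition L_kernel ::
    "(real \<Rightarrow> real) \<Rightarrow> (real \<Rightarrow> real) \<Rightarrow> real \<Rightarrow> real \<Rightarrow> real \<Rightarrow> complex" where
  "L_kernel K lam s h t =
     of_real (exp (s * t) / (2 * pi)) *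
     (LINT \<omega>|lborel. bilateral_laplace K (Complex s \<omega> * of_real h)
        / bilateral_laplace lam (- Complex s \<omega>) * exp (\<i> * of_real \<omega> * of_real t))"

text \<open>Real powers of nonnegative numbers with the convention that the zeroth power is always 1;
  the library has \<open>0 powr 0 = 0\<close>.\<close>

definition rpow :: "real \<Rightarrow> real \<Rightarrow> real" where
  "rpow t p = (if p = 0 then 1 else t powr p)"

definition arrival_intensity :: "(real \<Rightarrow> real) \<Rightarrow> real \<Rightarrow> bool" where
  "arrival_intensity lam \<sigma>\<^sub>l \<longleftrightarrow>
     (\<forall>t. 0 \<le> lam t) \<and> (\<forall>t<0. lam t = 0) \<and>
     (\<forall>b. set_integrable lborel {0..b} lam) \<and>
     laplace_abscissa lam = ereal \<sigma>\<^sub>l \<and> 0 \<le> \<sigma>\<^sub>l"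

definition intensity_growth ::
    "(real \<Rightarrow> real) \<Rightarrow> real \<Rightarrow> real \<Rightarrow> real \<Rightarrow> real \<Rightarrow> real \<Rightarrow> bool" where
  "intensity_growth lam \<sigma>\<^sub>l lam\<^sub>0 p a\<^sub>1 a\<^sub>2 \<longleftrightarrow>
     (0 < \<sigma>\<^sub>l \<longrightarrow> (\<forall>t\<ge>0. lam t \<le> lam\<^sub>0 * exp (\<sigma>\<^sub>l * t))) \<and>
     (\<sigma>\<^sub>l = 0 \<longrightarrow> 0 \<le> p \<and> 0 \<le> a\<^sub>1 \<and> 0 < a\<^sub>2 \<and> max a\<^sub>1 a\<^sub>2 = 1 \<and>
        (\<forall>t\<ge>0. lam t \<le> lam\<^sub>0 * (a\<^sub>1 + a\<^sub>2 * rpow t p)))"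

definition laplace_lower_bound ::
    "(real \<Rightarrow> real) \<Rightarrow> real \<Rightarrow> real \<Rightarrow> real \<Rightarrow> real \<Rightarrow> bool" where
  "laplace_lower_bound lam \<sigma>\<^sub>l lam\<^sub>0 k\<^sub>0 \<gamma> \<longleftrightarrow>
     (\<forall>z. \<sigma>\<^sub>l < Re z \<longrightarrow> bilateral_laplace lam z \<noteq> 0) \<and>
     (\<forall>\<sigma> \<omega>. \<sigma>\<^sub>l < \<sigma> \<longrightarrow>
        lam\<^sub>0 * k\<^sub>0 / ((\<sigma> - \<sigma>\<^sub>l)\<^sup>2 + \<omega>\<^sup>2) powr (\<gamma> / 2) \<le> cmod (bilateral_laplace lam (Complex \<sigma> \<omega>)))"

definition varkappa :: "real \<Rightarrow> real \<Rightarrow> real \<Rightarrow> real \<Rightarrow> real \<Rightarrow> real" where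
  "varkappa \<sigma>\<^sub>l p a\<^sub>1 a\<^sub>2 x\<^sub>0 =
     (if 0 < \<sigma>\<^sub>l then exp (2 * \<sigma>\<^sub>l * x\<^sub>0) / \<sigma>\<^sub>l else a\<^sub>1 + a\<^sub>2 * rpow x\<^sub>0 p)"

text \<open>Meant for open sets \<open>S\<close> only, where the iterated derivatives are two-sided.\<close>

definition times_cont_diff_on :: "nat \<Rightarrow> (real \<Rightarrow> real) \<Rightarrow> real set \<Rightarrow> bool" where
  "times_cont_diff_on k f S \<longleftrightarrow>
     (\<forall>j<k. (deriv ^^ j) f differentiable_on S) \<and> continuous_on S ((deriv ^^ k) f)"

text \<open>The largest natural number strictly below \<open>\<beta>\<close>, which differs from the usual floor at
  integers.\<close>

definition strict_floor :: "real \<Rightarrow> nat" where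
  "strict_floor \<beta> = Max {k. real k < \<beta>}"

definition holder_class :: "real \<Rightarrow> real \<Rightarrow> real \<Rightarrow> real \<Rightarrow> (real \<Rightarrow> real) set" where
  "holder_class d \<beta> x\<^sub>0 A = {f.
     times_cont_diff_on (strict_floor \<beta>) f {x\<^sub>0 - d<..<x\<^sub>0 + d} \<and>
     (\<forall>x\<in>{x\<^sub>0 - d<..<x\<^sub>0 + d}. \<forall>x'\<in>{x\<^sub>0 - d<..<x\<^sub>0 + d}.
        \<bar>(deriv ^^ strict_floor \<beta>) f x - (deriv ^^ strict_floor \<beta>) f x'\<bar>
          \<le> A * \<bar>x - x'\<bar> powr (\<beta> - real (strict_floor \<beta>)))}"

definition moment_class :: "real \<Rightarrow> (real \<Rightarrow> real) set" where
  "moment_class M = {G.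
     (\<exists>\<mu>. real_distribution \<mu> \<and> G = cdf \<mu>) \<and> (\<forall>t<0. G t = 0) \<and>
     (\<forall>k\<in>{1, 2::nat}.
        (\<integral>\<^sup>+t\<in>{0..}. ennreal (real k * t ^ (k - 1) * (1 - G t)) \<partial>lborel) \<le> ennreal M)}"

definition smooth_moment_class ::
    "real \<Rightarrow> real \<Rightarrow> real \<Rightarrow> real \<Rightarrow> real \<Rightarrow> (real \<Rightarrow> real) set" where
  "smooth_moment_class d \<beta> x\<^sub>0 A M = holder_class d \<beta> x\<^sub>0 A \<inter> moment_class M"

definition admissible_kernel :: "(real \<Rightarrow> real) \<Rightarrow> nat \<Rightarrow> nat \<Rightarrow> real \<Rightarrow> bool" where
  "admissible_kernel K m r C\<^sub>K \<longleftrightarrow>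
     (\<forall>t. t \<notin> {0..1} \<longrightarrow> K t = 0) \<and>
     (LBINT t:{0..1}. K t) = 1 \<and>
     (\<forall>k\<in>{1..m}. (LBINT t:{0..1}. t ^ k * K t) = 0) \<and>
     times_cont_diff_on r K UNIV \<and>
     (\<forall>j\<le>r. \<forall>x\<in>{0..1}. \<bar>(deriv ^^ j) K x\<bar> \<le> C\<^sub>K)"

text \<open>The sequence \<open>\<tau>\<close> lists the points of a Poisson process on the nonnegative half-line with
  intensity \<open>lam\<close>, in any order. Indexing by all natural numbers presupposes an infinite total
  intensity. This holds whenever \<open>laplace_lower_bound\<close> does: otherwise the transform would be
  bounded near the abscissa, which leaves only \<open>\<gamma> = 0\<close> in that bound, and this contradicts the
  Riemann-Lebesgue lemma. The probabilities are written out because the library's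
  \<open>poisson_pmf\<close> is specified for positive rates only.\<close>

definition point_count :: "(nat \<Rightarrow> 'w \<Rightarrow> real) \<Rightarrow> real set \<Rightarrow> 'w \<Rightarrow> nat" where
  "point_count \<tau> B w = card {j. \<tau> j w \<in> B}"

definition poisson_process ::
    "'w measure \<Rightarrow> (real \<Rightarrow> real) \<Rightarrow> (nat \<Rightarrow> 'w \<Rightarrow> real) \<Rightarrow> bool" where
  "poisson_process P lam \<tau> \<longleftrightarrow>
     (\<forall>j. \<tau> j \<in> borel_measurable P) \<and>
     (AE w in P. \<forall>j. 0 \<le> \<tau> j w) \<and>
     (AE w in P. \<forall>b. finite {j. \<tau> j w \<le> b}) \<and>
     (\<forall>B k. B \<in> sets borel \<and> B \<subseteq> {0..} \<and> bounded B \<longrightarrow>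
        measure P {w \<in> space P. point_count \<tau> B w = k}
          = (LBINT t:B. lam t) ^ k / fact k * exp (- (LBINT t:B. lam t))) \<and>
     (\<forall>(B :: nat \<Rightarrow> real set) I. finite I \<and> disjoint_family_on B I \<and>
          (\<forall>i\<in>I. B i \<in> sets borel \<and> B i \<subseteq> {0..} \<and> bounded (B i)) \<longrightarrow>
        prob_space.indep_vars P (\<lambda>_. count_space UNIV) (\<lambda>i. point_count \<tau> (B i)) I)"

text \<open>Arrival times \<open>\<tau>\<close> and service times \<open>\<sigma>\<close>. The service times are almost surely positive
  exactly if \<open>G 0 = 0\<close>; an atom of \<open>G\<close> at zero is not excluded, in accordance with
  \<open>moment_class\<close>.\<close>

definition Mt_G_infinity ::
    "'w measure \<Rightarrow> (real \<Rightarrow> real) \<Rightarrow> (real \<Rightarrow> real) \<Rightarrow>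
     (nat \<Rightarrow> 'w \<Rightarrow> real) \<Rightarrow> (nat \<Rightarrow> 'w \<Rightarrow> real) \<Rightarrow> bool" where
  "Mt_G_infinity P lam G \<tau> \<sigma> \<longleftrightarrow>
     prob_space P \<and>
     poisson_process P lam \<tau> \<and>
     prob_space.indep_vars P (\<lambda>_. borel) \<sigma> UNIV \<and>
     (\<forall>j. cdf (distr P borel (\<sigma> j)) = G) \<and>
     prob_space.indep_var P
       (\<Pi>\<^sub>M j\<in>UNIV. borel) (\<lambda>w j. \<tau> j w) (\<Pi>\<^sub>M j\<in>UNIV. borel) (\<lambda>w j. \<sigma> j w)"

definition queue_length ::
    "(nat \<Rightarrow> 'w \<Rightarrow> real) \<Rightarrow> (nat \<Rightarrow> 'w \<Rightarrow> real) \<Rightarrow> real \<Rightarrow> 'w \<Rightarrow> real" where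
  "queue_length \<tau> \<sigma> t w = (\<Sum>j. of_bool (\<tau> j w \<le> t \<and> t - \<tau> j w < \<sigma> j w))"

text \<open>A sample of size \<open>n\<close>: the \<open>k\<close>-th realization is driven by \<open>\<tau> k\<close> and \<open>\<sigma> k\<close>, and the
  queue-length processes are independent as random elements of the product space.\<close>

definition Mt_G_infinity_sample ::
    "'w measure \<Rightarrow> (real \<Rightarrow> real) \<Rightarrow> (real \<Rightarrow> real) \<Rightarrow> nat \<Rightarrow>
     (nat \<Rightarrow> nat \<Rightarrow> 'w \<Rightarrow> real) \<Rightarrow> (nat \<Rightarrow> nat \<Rightarrow> 'w \<Rightarrow> real) \<Rightarrow> bool" where
  "Mt_G_infinity_sample P lam G n \<tau> \<sigma> \<longleftrightarrow>
     prob_space P \<and>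
     (\<forall>k\<in>{1..n}. Mt_G_infinity P lam G (\<tau> k) (\<sigma> k)) \<and>
     prob_space.indep_vars P (\<lambda>_. \<Pi>\<^sub>M t\<in>UNIV. borel)
       (\<lambda>k w t. queue_length (\<tau> k) (\<sigma> k) t w) {1..n}"

text \<open>\<open>X k t w\<close> is the value at time \<open>t\<close> of the \<open>k\<close>-th observed queue-length process.\<close>

definition G_estimator ::
    "(real \<Rightarrow> complex) \<Rightarrow> nat \<Rightarrow> real \<Rightarrow> real \<Rightarrow> (nat \<Rightarrow> real \<Rightarrow> 'w \<Rightarrow> real) \<Rightarrow> 'w \<Rightarrow> complex" where
  "G_estimator L n T x\<^sub>0 X w =
     1 - of_real (1 / real n) * (\<Sum>k=1..n. LBINT t:{0..T}. L (t - x\<^sub>0) * of_real (X k t w))"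

definition h_star :: "real \<Rightarrow> real \<Rightarrow> real \<Rightarrow> real \<Rightarrow> real \<Rightarrow> real \<Rightarrow> nat \<Rightarrow> real" where
  "h_star \<beta> \<gamma> A M \<kappa> lam\<^sub>0 n = (M * \<kappa> / (A\<^sup>2 * lam\<^sub>0 * real n)) powr (1 / (2 * \<beta> + 2 * \<gamma> + 1))"

definition rate :: "real \<Rightarrow> real \<Rightarrow> real \<Rightarrow> real \<Rightarrow> real \<Rightarrow> real \<Rightarrow> nat \<Rightarrow> real" where
  "rate \<beta> \<gamma> A M \<kappa> lam\<^sub>0 n =
     A powr ((2 * \<gamma> + 1) / (2 * \<beta> + 2 * \<gamma> + 1)) *
     (M * \<kappa> / (lam\<^sub>0 * real n)) powr (\<beta> / (2 * \<beta> + 2 * \<gamma> + 1))"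

definition ennreal_sqrt :: "ennreal \<Rightarrow> ennreal" where
  "ennreal_sqrt x = (if x = \<infinity> then \<infinity> else ennreal (sqrt (enn2real x)))"

text \<open>\<open>P G\<close> is the sample space under the service time distribution \<open>G\<close>, and \<open>est G\<close> is the
  estimator as a random variable on \<open>P G\<close>.\<close>

definition risk ::
    "((real \<Rightarrow> real) \<Rightarrow> 'w measure) \<Rightarrow> ((real \<Rightarrow> real) \<Rightarrow> 'w \<Rightarrow> complex) \<Rightarrow>
     real \<Rightarrow> (real \<Rightarrow> real) set \<Rightarrow> ennreal" where
  "risk P est x\<^sub>0 \<G> =
     (SUP G\<in>\<G>. ennreal_sqrt (\<integral>\<^sup>+w. ennreal ((cmod (est G w - of_real (G x\<^sub>0)))\<^sup>2) \<partial>P G))"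

end

theory Submission
  imports Defs "HOL-Complex_Analysis.Complex_Analysis" "HOL-Real_Asymp.Real_Asymp"
begin

text \<open>The queue length has mean \<open>H = \<lambda> * (1 - G)\<close>, a convolution, and the kernel \<open>L_h\<close> is the
deconvolution kernel that undoes the convolution with \<open>\<lambda>\<close> up to smoothing: integrated against a
translate of \<open>\<lambda>\<close> it reproduces \<open>K(\<cdot>/h)/h\<close> (\<open>L_kernel_reproduces\<close>). Hence
\<open>\<integral> L_h(t - x\<^sub>0) H(t) dt = \<integral> K(u) (1 - G(x\<^sub>0 + h u)) du\<close> (\<open>deconvolution_identity\<close>), which differs from
\<open>1 - G(x\<^sub>0)\<close> by \<open>O(A h\<^sup>\<beta>)\<close>: the vanishing moments of \<open>K\<close> remove the Taylor polynomial of \<open>G\<close>, and the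
Hoelder condition controls the rest (\<open>kernel_bias\<close>).

For the variance, the first and second order Campbell formulas for the arrival points
(\<open>campbell_mean\<close>, \<open>campbell_distinct_pairs\<close>) give
\<open>Cov(X(t), X(s)) = \<integral> \<lambda>(u) (1 - G(max t s - u)) du\<close>, the integral running over \<open>0 \<le> u \<le> min t s\<close>.
This is nonnegative and symmetric, so the Schur test bounds the variance of \<open>\<integral> L_h(t - x\<^sub>0) X(t) dt\<close> by
\<open>\<integral> |L_h(t - x\<^sub>0)|\<^sup>2 (\<integral> Cov(X(t), X(s)) ds) dt\<close>. The inner integral is at most
\<open>\<lambda>\<^sub>0 M exp (\<sigma> t) / \<sigma>\<close> or \<open>\<lambda>\<^sub>0 M (a\<^sub>1 + a\<^sub>2 t\<^sup>p)\<close>, depending on the growth of \<open>\<lambda>\<close>. On the other hand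
\<open>L_h(t) exp (- s t)\<close> is a Fourier integral, so that Plancherel's inequality and the lower bound on the
Laplace transform of \<open>\<lambda>\<close> give
\<open>\<integral> |L_h(t)|\<^sup>2 exp (- 2 s t) dt \<le> c h powr (- 2 \<gamma> - 1) / (\<lambda>\<^sub>0 k\<^sub>0)\<^sup>2\<close> (\<open>L_kernel_square\<close>).

The line of integration links the two bounds. By Cauchy's theorem \<open>L_h\<close> does not depend on it
(\<open>L_kernel_shift\<close>), and the proof uses \<open>s = - \<sigma> - 1/x\<^sub>0\<close>. With this choice the weight
\<open>exp (- 2 s (t - x\<^sub>0))\<close> dominates the covariance integral up to the factor \<open>\<lambda>\<^sub>0 M \<kappa>\<close> and a constant that
depends on \<open>p\<close> alone (\<open>cov_queue_row_bound\<close>), while \<open>|s| h \<le> 1\<close> for large \<open>n\<close>, so that all other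
constants depend only on \<open>\<gamma>\<close>, \<open>k\<^sub>0\<close> and the kernel. The same exponential decay bounds the part of the integral
beyond \<open>T\<close> by a power of \<open>n\<close> times \<open>exp (- T / (2 x\<^sub>0))\<close>, which is negligible because
\<open>ln (\<lambda>\<^sub>0 n) / T \<longlonglongrightarrow> 0\<close>.

Altogether (\<open>mse_bound\<close>) the mean squared error is at most twice
\<open>(C A h\<^sup>\<beta> + tail)\<^sup>2 + c M \<kappa> h powr (- 2 \<gamma> - 1) / (\<lambda>\<^sub>0 n)\<close>. The bandwidth \<open>h\<^sub>*\<close> is the one for which
\<open>A h\<^sup>\<beta> = \<phi>\<^sub>n\<close> and \<open>M \<kappa> h powr (- 2 \<gamma> - 1) / (\<lambda>\<^sub>0 n) = \<phi>\<^sub>n\<^sup>2\<close> hold simultaneously (\<open>h_star_rate\<close>).\<close>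

section \<open>Moments of Poisson counts\<close>

lemma nn_integral_nat_valued:
  assumes N: "N \<in> measurable P (count_space UNIV)"
    and P: "\<And>k. emeasure P {w \<in> space P. N w = k} = ennreal (q k)"
    and s: "(\<lambda>k. real (g k) * q k) sums c" and nn: "\<And>k. 0 \<le> q k"
  shows "(\<integral>\<^sup>+w. of_nat (g (N w)) \<partial>P) = ennreal c"
proof -
  have [measurable]: "{w \<in> space P. N w = k} \<in> sets P" for k
    using N by measurable
  have "(\<integral>\<^sup>+w. of_nat (g (N w)) \<partial>P)
      = (\<integral>\<^sup>+w. (\<Sum>k. of_nat (g k) * indicator {w \<in> space P. N w = k} w) \<partial>P)"
  proof (rule nn_integral_cong)
    fix w assume "w \<in> space P"
    then have "(\<lambda>k. of_nat (g k) * indicator {w \<in> space P. N w = k} w :: ennreal)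
        = (\<lambda>k. if k = N w then of_nat (g (N w)) else 0)"
      by (auto simp: fun_eq_iff)
    then show "of_nat (g (N w)) = (\<Sum>k. of_nat (g k) * indicator {w \<in> space P. N w = k} w :: ennreal)"
      by (simp add: sums_unique[symmetric, OF sums_single])
  qed
  also have "\<dots> = (\<Sum>k. \<integral>\<^sup>+w. of_nat (g k) * indicator {w \<in> space P. N w = k} w \<partial>P)"
    by (rule nn_integral_suminf) measurable
  also have "\<dots> = (\<Sum>k. ennreal (real (g k) * q k))"
    by (intro suminf_cong) (simp add: nn_integral_cmult P ennreal_mult nn ennreal_of_nat_eq_real_of_nat)
  also have "\<dots> = ennreal c"
    using s nn by (intro suminf_ennreal_eq) auto
  finally show ?thesis .
qed

lemma poisson_moments:
  assumes N: "N \<in> measurable P (count_space UNIV)" and l: "0 \<le> l"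
    and P: "\<And>k. emeasure P {w \<in> space P. N w = k} = ennreal (l ^ k / fact k * exp (- l))"
  shows "(\<integral>\<^sup>+w. of_nat (N w) \<partial>P) = ennreal l"
    and "(\<integral>\<^sup>+w. of_nat (N w) * of_nat (N w) \<partial>P) = ennreal (l * l + l)"
proof -
  let ?q = "\<lambda>k. l ^ k / fact k * exp (- l)"
  have e: "(\<lambda>k. l ^ k / fact k) sums exp l"
    using exp_converges[of l] by (simp add: divide_inverse scaleR_conv_of_real mult.commute)
  have "?q sums (exp l * exp (-l))"
    using e by (rule sums_mult2)
  then have s0: "?q sums 1" by (simp add: exp_minus)
  have q: "real (Suc k) * ?q (Suc k) = l * ?q k" for k
    by (simp del: of_nat_Suc)
  have "(\<lambda>k. real (Suc k) * ?q (Suc k)) sums (l * 1)"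
    unfolding q by (rule sums_mult[OF s0])
  then have s1: "(\<lambda>k. real k * ?q k) sums l"
    by (subst (asm) sums_Suc_iff) simp
  have "real (Suc k * Suc k) * ?q (Suc k) = l * (real k * ?q k + ?q k)" for k
  proof -
    have "real (Suc k * Suc k) * ?q (Suc k) = real (Suc k) * (real (Suc k) * ?q (Suc k))"
      by (simp only: of_nat_mult mult.assoc)
    also have "\<dots> = l * (real (Suc k) * ?q k)" unfolding q by (rule mult.left_commute)
    finally show ?thesis by (simp only: of_nat_Suc distrib_right mult_1 add.commute)
  qed
  then have "(\<lambda>k. real (Suc k * Suc k) * ?q (Suc k)) = (\<lambda>k. l * (real k * ?q k + ?q k))"
    by blast
  then have "(\<lambda>k. real (Suc k * Suc k) * ?q (Suc k)) sums (l * (l + 1))"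
    using sums_mult[OF sums_add[OF s1 s0], of l] by simp
  then have s2: "(\<lambda>k. real (k * k) * ?q k) sums (l * l + l)"
    by (subst (asm) sums_Suc_iff) (simp add: algebra_simps)
  show "(\<integral>\<^sup>+w. of_nat (N w) \<partial>P) = ennreal l"
    using nn_integral_nat_valued[OF N P s1] l by simp
  show "(\<integral>\<^sup>+w. of_nat (N w) * of_nat (N w) \<partial>P) = ennreal (l * l + l)"
    using nn_integral_nat_valued[OF N P s2] l by simp
qed

text \<open>The intensity is cut off at \<open>b\<close> to make the measure finite, which allows it to be identified from its
values on rectangles.\<close>

definition intensity_measure :: "(real \<Rightarrow> real) \<Rightarrow> real \<Rightarrow> real measure" where
  "intensity_measure lam b = density lborel (\<lambda>u. ennreal (lam u) * indicator {0..b} u)"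

locale poisson_points = prob_space P for P :: "'w measure" +
  fixes lam :: "real \<Rightarrow> real" and \<tau> :: "nat \<Rightarrow> 'w \<Rightarrow> real"
  assumes poisson: "poisson_process P lam \<tau>"
    and lam_nonneg: "0 \<le> lam t"
    and lam_integrable: "set_integrable lborel {0..b} lam"
    and lam_measurable [measurable]: "lam \<in> borel_measurable borel"
begin

lemma tau_measurable [measurable]: "\<tau> j \<in> borel_measurable P"
  using poisson by (auto simp: poisson_process_def)

definition mass :: "real set \<Rightarrow> real" where
  "mass B = (LBINT t:B. lam t)"

text \<open>The number of points in \<open>B\<close>, with value \<open>\<infinity>\<close> where \<open>point_count\<close> would be \<open>0\<close> for an infinite set. In this
form it is additive in \<open>B\<close> at every sample point, not only almost surely.\<close>

definition hits :: "real set \<Rightarrow> 'w \<Rightarrow> ennreal" where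
  "hits B w = (\<integral>\<^sup>+j. indicator B (\<tau> j w) \<partial>count_space UNIV)"

lemma hits_measurable [measurable]: "B \<in> sets borel \<Longrightarrow> hits B \<in> borel_measurable P"
  unfolding hits_def nn_integral_count_space_nat
  by (intro borel_measurable_suminf_order measurable_compose[OF tau_measurable] borel_measurable_indicator)

definition window :: "real set \<Rightarrow> bool" where
  "window B \<longleftrightarrow> B \<in> sets borel \<and> B \<subseteq> {0..} \<and> bounded B"

lemma window_subset: "window B \<Longrightarrow> A \<in> sets borel \<Longrightarrow> A \<subseteq> B \<Longrightarrow> window A"
  by (auto simp: window_def intro: bounded_subset)

lemma window_bound: "window B \<Longrightarrow> \<exists>b. B \<subseteq> {0..b}"
  unfolding window_def bounded_iff by force

lemma window_integrable: assumes "window B" shows "set_integrable lborel B lam"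
proof -
  obtain b where "B \<subseteq> {0..b}" using window_bound[OF assms] by blast
  then show ?thesis using assms
    by (intro set_integrable_subset[OF lam_integrable[of b]]) (auto simp: window_def)
qed

lemma mass_nonneg: "0 \<le> mass B"
  unfolding mass_def set_lebesgue_integral_def by (intro integral_nonneg_AE AE_I2) (auto simp: lam_nonneg)

lemma mass_union:
  assumes "window A" "window B" "A \<inter> B = {}"
  shows "mass (A \<union> B) = mass A + mass B"
  unfolding mass_def using assms window_integrable by (intro set_integral_Un) auto

lemma hits_count: assumes "window B"
  shows "AE w in P. hits B w = of_nat (point_count \<tau> B w)"
proof -
  obtain b where b: "B \<subseteq> {0..b}" using window_bound[OF assms] by blast
  have "AE w in P. \<forall>b. finite {j. \<tau> j w \<le> b}"
    using poisson by (auto simp: poisson_process_def)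
  then show ?thesis
  proof eventually_elim
    case (elim w)
    then have f: "finite {j. \<tau> j w \<in> B}"
      by (rule_tac finite_subset[of _ "{j. \<tau> j w \<le> b}"]) (use b in auto)
    have "hits B w = (\<integral>\<^sup>+j. indicator {j. \<tau> j w \<in> B} j \<partial>count_space UNIV)"
      unfolding hits_def by (intro nn_integral_cong) (auto simp: indicator_def)
    also have "\<dots> = emeasure (count_space UNIV) {j. \<tau> j w \<in> B}" by simp
    also have "\<dots> = of_nat (card {j. \<tau> j w \<in> B})" using f by (subst emeasure_count_space_finite) auto
    finally show ?case by (simp add: point_count_def)
  qed
qed

lemma counts_indep:
  fixes B :: "nat \<Rightarrow> real set"
  assumes "finite I" "disjoint_family_on B I" "\<And>i. i \<in> I \<Longrightarrow> window (B i)"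
  shows "indep_vars (\<lambda>_. count_space UNIV) (\<lambda>i. point_count \<tau> (B i)) I"
  using poisson assms unfolding poisson_process_def window_def by blast

lemma point_count_measurable: assumes "window B"
  shows "point_count \<tau> B \<in> measurable P (count_space UNIV)"
proof -
  have "indep_vars (\<lambda>_. count_space UNIV) (\<lambda>i. point_count \<tau> ((\<lambda>_. B) i)) {0::nat}"
    using assms by (intro counts_indep) (auto simp: disjoint_family_on_def)
  then show ?thesis by (auto simp: indep_vars_def)
qed

lemma count_prob: assumes "window B"
  shows "emeasure P {w \<in> space P. point_count \<tau> B w = k}
    = ennreal (mass B ^ k / fact k * exp (- mass B))"
  using poisson assms unfolding poisson_process_def window_def mass_def
  by (simp add: emeasure_eq_measure)

lemma hits_mean: assumes "window B" shows "(\<integral>\<^sup>+w. hits B w \<partial>P) = ennreal (mass B)"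
  using poisson_moments(1)[OF point_count_measurable mass_nonneg count_prob, OF assms assms]
    nn_integral_cong_AE[OF hits_count[OF assms]] by simp

lemma hits_square: assumes "window B"
  shows "(\<integral>\<^sup>+w. hits B w * hits B w \<partial>P) = ennreal (mass B * mass B + mass B)"
proof -
  have "AE w in P. hits B w * hits B w
      = of_nat (point_count \<tau> B w) * of_nat (point_count \<tau> B w)"
    using hits_count[OF assms] by eventually_elim simp
  from nn_integral_cong_AE[OF this] show ?thesis
    using poisson_moments(2)[OF point_count_measurable mass_nonneg count_prob, OF assms assms]
    by simp
qed

lemma hits_disjoint: assumes "window A" "window B" "A \<inter> B = {}"
  shows "(\<integral>\<^sup>+w. hits A w * hits B w \<partial>P) = ennreal (mass A * mass B)"
proof -
  let ?B = "\<lambda>i::nat. if i = 0 then A else B"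
  have "indep_vars (\<lambda>_. count_space UNIV) (\<lambda>i. point_count \<tau> (?B i)) {0,1}"
    by (rule counts_indep) (use assms in \<open>auto simp: disjoint_family_on_def split: if_splits\<close>)
  from indep_vars_compose2[OF this, of "\<lambda>_ n. of_nat n :: ennreal" "\<lambda>_. borel"]
  have i: "indep_vars (\<lambda>_. borel) (\<lambda>i w. of_nat (point_count \<tau> (?B i) w) :: ennreal) {0,1}" by simp
  have "AE w in P. hits A w * hits B w = of_nat (point_count \<tau> A w) * of_nat (point_count \<tau> B w)"
    using hits_count[OF assms(1)] hits_count[OF assms(2)] by eventually_elim simp
  then have "(\<integral>\<^sup>+w. hits A w * hits B w \<partial>P)
      = (\<integral>\<^sup>+w. of_nat (point_count \<tau> A w) * of_nat (point_count \<tau> B w) \<partial>P)"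
    by (rule nn_integral_cong_AE)
  also have "\<dots> = (\<integral>\<^sup>+w. of_nat (point_count \<tau> A w) \<partial>P) * (\<integral>\<^sup>+w. of_nat (point_count \<tau> B w) \<partial>P)"
    using indep_vars_nn_integral[OF _ i] by simp
  also have "\<dots> = ennreal (mass A) * ennreal (mass B)"
    using assms poisson_moments(1)[OF point_count_measurable mass_nonneg count_prob] by simp
  finally show ?thesis by (simp add: ennreal_mult mass_nonneg)
qed

lemma hits_union: assumes "A \<in> sets borel" "B \<in> sets borel" "A \<inter> B = {}"
  shows "hits (A \<union> B) w = hits A w + hits B w"
  unfolding hits_def
  by (subst nn_integral_add[symmetric]) (use assms in \<open>auto intro!: nn_integral_cong simp: indicator_def\<close>)

text \<open>Splitting \<open>A\<close> and \<open>B\<close> along \<open>A \<inter> B\<close> reduces the product to independent counts and to the square of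
one Poisson variable, whose second moment is \<open>l\<^sup>2 + l\<close>; the summand \<open>l\<close> is the contribution of the diagonal.\<close>

lemma hits_product: assumes "window A" "window B"
  shows "(\<integral>\<^sup>+w. hits A w * hits B w \<partial>P)
    = ennreal (mass A * mass B) + ennreal (mass (A \<inter> B))"
proof -
  let ?D = "A \<inter> B" and ?A = "A - B" and ?B = "B - A"
  have w: "window ?D" "window ?A" "window ?B"
    using assms by (auto intro: window_subset[of A] window_subset[of B] simp: window_def[of A] window_def[of B])
  then have [measurable]: "?D \<in> sets borel" "?A \<in> sets borel" "?B \<in> sets borel"
    by (auto simp: window_def)
  have un: "A = ?D \<union> ?A" "B = ?D \<union> ?B" by auto
  have hA: "hits A w = hits ?D w + hits ?A w" for w
    by (subst un(1), rule hits_union) auto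
  have hB: "hits B w = hits ?D w + hits ?B w" for w
    by (subst un(2), rule hits_union) auto
  have rA: "mass A = mass ?D + mass ?A"
    by (subst un(1), rule mass_union) (use w in auto)
  have rB: "mass B = mass ?D + mass ?B"
    by (subst un(2), rule mass_union) (use w in auto)
  have "(\<integral>\<^sup>+w. hits A w * hits B w \<partial>P)
     = (\<integral>\<^sup>+w. hits ?D w * hits ?D w + (hits ?D w * hits ?B w + (hits ?A w * hits ?D w + hits ?A w * hits ?B w)) \<partial>P)"
    by (intro nn_integral_cong) (simp only: hA hB, simp add: distrib_left distrib_right add.assoc)
  also have "\<dots> = (\<integral>\<^sup>+w. hits ?D w * hits ?D w \<partial>P) + ((\<integral>\<^sup>+w. hits ?D w * hits ?B w \<partial>P)
      + ((\<integral>\<^sup>+w. hits ?A w * hits ?D w \<partial>P) + (\<integral>\<^sup>+w. hits ?A w * hits ?B w \<partial>P)))"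
    by (simp add: nn_integral_add)
  also have "\<dots> = ennreal (mass ?D * mass ?D + mass ?D) + (ennreal (mass ?D * mass ?B)
      + (ennreal (mass ?A * mass ?D) + ennreal (mass ?A * mass ?B)))"
  proof -
    have "?D \<inter> ?B = {}" "?A \<inter> ?D = {}" "?A \<inter> ?B = {}" by auto
    then show ?thesis
      by (simp only: hits_square[OF w(1)] hits_disjoint[OF w(1) w(3)] hits_disjoint[OF w(2) w(1)]
        hits_disjoint[OF w(2) w(3)])
  qed
  also have "\<dots> = ennreal (mass A * mass B) + ennreal (mass ?D)"
  proof -
    define a b d where "a = mass ?A" and "b = mass ?B" and "d = mass ?D"
    have [simp]: "0 \<le> a" "0 \<le> b" "0 \<le> d" by (simp_all add: a_def b_def d_def mass_nonneg)
    have "ennreal (d * d + d) + (ennreal (d * b) + (ennreal (a * d) + ennreal (a * b)))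
        = ennreal ((d * d + d) + (d * b + (a * d + a * b)))" by simp
    also have "(d * d + d) + (d * b + (a * d + a * b)) = (d + a) * (d + b) + d"
      by (simp add: algebra_simps)
    finally show ?thesis
      unfolding rA rB a_def[symmetric] b_def[symmetric] d_def[symmetric] by simp
  qed
  finally show ?thesis .
qed

end

section \<open>Campbell's formulas\<close>

lemma nn_integral_count_diagonal:
  fixes f :: "nat \<Rightarrow> nat \<Rightarrow> ennreal"
  shows "(\<integral>\<^sup>+x. of_bool (fst x = snd x) * f (fst x) (snd x) \<partial>count_space UNIV)
    = (\<integral>\<^sup>+i. f i i \<partial>count_space UNIV)"
proof -
  have "(\<integral>\<^sup>+x. of_bool (fst x = snd x) * f (fst x) (snd x) \<partial>count_space UNIV)
      = (\<integral>\<^sup>+i. \<integral>\<^sup>+j. of_bool (i = j) * f i j \<partial>count_space UNIV \<partial>count_space UNIV)"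
    using nn_integral_fst_count_space[of "\<lambda>x. of_bool (fst x = snd x) * f (fst x) (snd x)"] by simp
  also have "\<dots> = (\<integral>\<^sup>+i. f i i \<partial>count_space UNIV)"
  proof (rule nn_integral_cong)
    fix i :: nat
    have "(\<integral>\<^sup>+j. of_bool (i = j) * f i j \<partial>count_space UNIV)
        = (\<integral>\<^sup>+j. f i i * indicator {i} j \<partial>count_space UNIV)"
      by (intro nn_integral_cong) (auto simp: indicator_def)
    then show "(\<integral>\<^sup>+j. of_bool (i = j) * f i j \<partial>count_space UNIV) = f i i"
      by (simp add: nn_integral_cmult)
  qed
  finally show ?thesis .
qed

text \<open>The diagonal is separated here because only pairs of distinct points have independent service
times.\<close>

lemma nn_integral_count_product:
  fixes f g :: "nat \<Rightarrow> ennreal"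
  shows "(\<integral>\<^sup>+i. f i \<partial>count_space UNIV) * (\<integral>\<^sup>+j. g j \<partial>count_space UNIV)
    = (\<integral>\<^sup>+i. f i * g i \<partial>count_space UNIV)
      + (\<integral>\<^sup>+x. of_bool (fst x \<noteq> snd x) * (f (fst x) * g (snd x)) \<partial>count_space UNIV)"
proof -
  have "(\<integral>\<^sup>+i. f i \<partial>count_space UNIV) * (\<integral>\<^sup>+j. g j \<partial>count_space UNIV)
      = (\<integral>\<^sup>+i. \<integral>\<^sup>+j. f i * g j \<partial>count_space UNIV \<partial>count_space UNIV)"
    by (simp add: nn_integral_cmult nn_integral_multc)
  also have "\<dots> = (\<integral>\<^sup>+x. f (fst x) * g (snd x) \<partial>count_space UNIV)"
    using nn_integral_fst_count_space[of "\<lambda>x. f (fst x) * g (snd x)"] by simp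
  also have "\<dots> = (\<integral>\<^sup>+x. of_bool (fst x = snd x) * (f (fst x) * g (snd x))
      + of_bool (fst x \<noteq> snd x) * (f (fst x) * g (snd x)) \<partial>count_space UNIV)"
    by (intro nn_integral_cong) auto
  also have "\<dots> = (\<integral>\<^sup>+x. of_bool (fst x = snd x) * (f (fst x) * g (snd x)) \<partial>count_space UNIV)
      + (\<integral>\<^sup>+x. of_bool (fst x \<noteq> snd x) * (f (fst x) * g (snd x)) \<partial>count_space UNIV)"
    by (rule nn_integral_add) auto
  finally show ?thesis by (simp add: nn_integral_count_diagonal[of "\<lambda>i j. f i * g j"])
qed

lemma nn_integral_count_swap:
  fixes f :: "'i::countable \<Rightarrow> 'w \<Rightarrow> ennreal"
  assumes [measurable]: "\<And>i. f i \<in> borel_measurable P"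
  shows "(\<integral>\<^sup>+w. \<integral>\<^sup>+i. f i w \<partial>count_space UNIV \<partial>P) = (\<integral>\<^sup>+i. \<integral>\<^sup>+w. f i w \<partial>P \<partial>count_space UNIV)"
  by (rule nn_integral_count_space_nn_integral) auto

context poisson_points begin

lemma window_Icc [simp]: "A \<in> sets borel \<Longrightarrow> window (A \<inter> {0..b})"
  using bounded_subset[OF bounded_closed_interval[of 0 b], of "A \<inter> {0..b}"] by (auto simp: window_def)

lemma emeasure_intensity: assumes [measurable]: "A \<in> sets borel"
  shows "emeasure (intensity_measure lam b) A = ennreal (mass (A \<inter> {0..b}))"
proof -
  have i: "set_integrable lborel (A \<inter> {0..b}) lam"
    using window_integrable[OF window_Icc[OF assms]] .
  have "emeasure (intensity_measure lam b) A
      = (\<integral>\<^sup>+u. ennreal (lam u) * indicator {0..b} u * indicator A u \<partial>lborel)"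
    unfolding intensity_measure_def by (rule emeasure_density) auto
  also have "\<dots> = (\<integral>\<^sup>+u. ennreal (indicator (A \<inter> {0..b}) u *\<^sub>R lam u) \<partial>lborel)"
    by (intro nn_integral_cong) (auto simp: indicator_def)
  also have "\<dots> = ennreal (mass (A \<inter> {0..b}))"
    unfolding mass_def set_lebesgue_integral_def
    by (rule nn_integral_eq_integral)
      (use i in \<open>auto simp: set_integrable_def lam_nonneg\<close>)
  finally show ?thesis .
qed

lemma sets_intensity [simp, measurable_cong]: "sets (intensity_measure lam b) = sets borel"
  by (simp add: intensity_measure_def)

lemma space_intensity [simp]: "space (intensity_measure lam b) = UNIV"
  by (simp add: intensity_measure_def)

lemma sigma_finite_intensity: "sigma_finite_measure (intensity_measure lam b)"
proof -
  interpret finite_measure "intensity_measure lam b"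
    by standard (simp add: emeasure_intensity)
  show ?thesis by unfold_locales
qed

lemma nn_integral_intensity: assumes [measurable]: "f \<in> borel_measurable borel"
  shows "(\<integral>\<^sup>+u. f u \<partial>intensity_measure lam b)
    = (\<integral>\<^sup>+u. ennreal (lam u) * indicator {0..b} u * f u \<partial>lborel)"
  unfolding intensity_measure_def by (rule nn_integral_density) auto

text \<open>The measure that counts the expected number of points in a set agrees with the intensity measure, by
the mean of the Poisson counts; the formula is the equality of the integrals.\<close>

lemma campbell_mean:
  assumes [measurable]: "f \<in> borel_measurable borel" and f: "\<And>u. u \<notin> {0..b} \<Longrightarrow> f u = 0"
  shows "(\<integral>\<^sup>+w. \<integral>\<^sup>+j. f (\<tau> j w) \<partial>count_space UNIV \<partial>P) = (\<integral>\<^sup>+u. f u \<partial>intensity_measure lam b)"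
proof -
  let ?S = "count_space (UNIV::nat set) \<Otimes>\<^sub>M P"
  have [measurable]: "(\<lambda>x. \<tau> (fst x) (snd x)) \<in> borel_measurable ?S"
    by (rule measurable_compose_countable[where f = "\<lambda>i x. \<tau> i (snd x)"]) measurable
  interpret C: sigma_finite_measure "count_space (UNIV::nat set)"
    by (rule sigma_finite_measure_count_space_countable) simp
  interpret S: pair_sigma_finite "count_space (UNIV::nat set)" P ..
  define N where "N = distr (density ?S (\<lambda>x. indicator {0..b} (\<tau> (fst x) (snd x)))) borel (\<lambda>x. \<tau> (fst x) (snd x))"
  have nn: "(\<integral>\<^sup>+u. g u \<partial>N)
      = (\<integral>\<^sup>+w. \<integral>\<^sup>+j. indicator {0..b} (\<tau> j w) * g (\<tau> j w) \<partial>count_space UNIV \<partial>P)"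
    if [measurable]: "g \<in> borel_measurable borel" for g :: "real \<Rightarrow> ennreal"
    unfolding N_def
    by (subst nn_integral_distr, measurable, subst nn_integral_density, measurable)
      (subst S.nn_integral_snd[symmetric], auto)
  have "N = intensity_measure lam b"
  proof (rule measure_eqI)
    fix A assume "A \<in> sets N"
    then have A [measurable]: "A \<in> sets borel" by (simp add: N_def)
    have "emeasure N A = (\<integral>\<^sup>+u. indicator A u \<partial>N)" by (simp add: N_def)
    also have "\<dots> = (\<integral>\<^sup>+w. hits (A \<inter> {0..b}) w \<partial>P)"
      unfolding hits_def
      by (subst nn) (auto intro!: nn_integral_cong simp: indicator_def)
    also have "\<dots> = emeasure (intensity_measure lam b) A"
      by (simp add: hits_mean emeasure_intensity)
    finally show "emeasure N A = emeasure (intensity_measure lam b) A" .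
  qed (simp add: N_def)
  then have "(\<integral>\<^sup>+u. f u \<partial>intensity_measure lam b) = (\<integral>\<^sup>+u. f u \<partial>N)" by simp
  also have "\<dots> = (\<integral>\<^sup>+w. \<integral>\<^sup>+j. indicator {0..b} (\<tau> j w) * f (\<tau> j w) \<partial>count_space UNIV \<partial>P)"
    by (rule nn) measurable
  also have "\<dots> = (\<integral>\<^sup>+w. \<integral>\<^sup>+j. f (\<tau> j w) \<partial>count_space UNIV \<partial>P)"
    by (intro nn_integral_cong) (auto simp: indicator_def f)
  finally show ?thesis ..
qed

text \<open>The Poisson second moment exceeds the product of the means by exactly the mass of the diagonal.\<close>

lemma distinct_pairs_rectangle:
  assumes "window A" "window B"
  shows "(\<integral>\<^sup>+w. \<integral>\<^sup>+x. of_bool (fst x \<noteq> snd x) * (indicator A (\<tau> (fst x) w) * indicator B (\<tau> (snd x) w))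
      \<partial>count_space UNIV \<partial>P) = ennreal (mass A) * ennreal (mass B)" (is "?off = _")
proof -
  have [measurable]: "A \<in> sets borel" "B \<in> sets borel" using assms unfolding window_def by blast+
  have w: "window (A \<inter> B)" by (rule window_subset[OF assms(1)]) auto
  have m1 [measurable]: "(\<lambda>w. \<integral>\<^sup>+i. indicator A (\<tau> i w) * indicator B (\<tau> i w) \<partial>count_space UNIV) \<in> borel_measurable P"
    by (subst nn_integral_count_space_nat) (intro borel_measurable_suminf_order, measurable)
  have m2 [measurable]: "(\<lambda>w. \<integral>\<^sup>+x. of_bool (fst x \<noteq> snd x) * (indicator A (\<tau> (fst x) w) * indicator B (\<tau> (snd x) w))
      \<partial>count_space UNIV) \<in> borel_measurable P"
    by (subst nn_integral_bij_count_space[OF bij_prod_decode, symmetric], subst nn_integral_count_space_nat)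
      (intro borel_measurable_suminf_order, measurable)
  have "ennreal (mass (A \<inter> B)) + ennreal (mass A) * ennreal (mass B)
      = (\<integral>\<^sup>+w. hits A w * hits B w \<partial>P)"
    by (simp add: hits_product[OF assms] ennreal_mult mass_nonneg add.commute)
  also have "\<dots> = (\<integral>\<^sup>+w. (\<integral>\<^sup>+i. indicator A (\<tau> i w) * indicator B (\<tau> i w) \<partial>count_space UNIV)
      + (\<integral>\<^sup>+x. of_bool (fst x \<noteq> snd x) * (indicator A (\<tau> (fst x) w) * indicator B (\<tau> (snd x) w)) \<partial>count_space UNIV) \<partial>P)"
    unfolding hits_def nn_integral_count_product ..
  also have "\<dots> = (\<integral>\<^sup>+w. (\<integral>\<^sup>+i. indicator A (\<tau> i w) * indicator B (\<tau> i w) \<partial>count_space UNIV) \<partial>P) + ?off"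
    by (rule nn_integral_add) measurable
  also have "(\<integral>\<^sup>+w. (\<integral>\<^sup>+i. indicator A (\<tau> i w) * indicator B (\<tau> i w) \<partial>count_space UNIV) \<partial>P)
      = (\<integral>\<^sup>+w. hits (A \<inter> B) w \<partial>P)"
    unfolding hits_def by (simp add: indicator_inter_arith)
  also have "\<dots> = ennreal (mass (A \<inter> B))" by (rule hits_mean[OF w])
  finally have "ennreal (mass A) * ennreal (mass B) = ?off"
    unfolding ennreal_add_left_cancel by simp
  then show ?thesis ..
qed

text \<open>By \<open>distinct_pairs_rectangle\<close> the measure that counts ordered pairs of distinct points agrees on
rectangles with the product of the intensity measure with itself, hence everywhere.\<close>

lemma campbell_distinct_pairs:
  assumes [measurable]: "f \<in> borel_measurable borel" "g \<in> borel_measurable borel"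
    and f: "\<And>u. u \<notin> {0..b} \<Longrightarrow> f u = 0" and g: "\<And>u. u \<notin> {0..b} \<Longrightarrow> g u = 0"
  shows "(\<integral>\<^sup>+w. \<integral>\<^sup>+x. of_bool (fst x \<noteq> snd x) * (f (\<tau> (fst x) w) * g (\<tau> (snd x) w))
      \<partial>count_space UNIV \<partial>P)
    = (\<integral>\<^sup>+u. f u \<partial>intensity_measure lam b) * (\<integral>\<^sup>+u. g u \<partial>intensity_measure lam b)"
proof -
  let ?S = "count_space (UNIV::(nat \<times> nat) set) \<Otimes>\<^sub>M P"
  let ?I = "intensity_measure lam b"
  have [measurable]: "(\<lambda>x. \<tau> (fst (fst x)) (snd x)) \<in> borel_measurable ?S"
    by (rule measurable_compose_countable[where f = "\<lambda>p x. \<tau> (fst p) (snd x)" and g = fst]) measurable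
  have [measurable]: "(\<lambda>x. \<tau> (snd (fst x)) (snd x)) \<in> borel_measurable ?S"
    by (rule measurable_compose_countable[where f = "\<lambda>p x. \<tau> (snd p) (snd x)" and g = fst]) measurable
  interpret C: sigma_finite_measure "count_space (UNIV::(nat \<times> nat) set)"
    by (rule sigma_finite_measure_count_space_countable) simp
  interpret S: pair_sigma_finite "count_space (UNIV::(nat \<times> nat) set)" P ..
  interpret I: sigma_finite_measure ?I by (rule sigma_finite_intensity)
  define h where "h = (\<lambda>x. of_bool (fst (fst x) \<noteq> snd (fst x)) * (indicator {0..b} (\<tau> (fst (fst x)) (snd x))
      * indicator {0..b} (\<tau> (snd (fst x)) (snd x))) :: ennreal)"
  have [measurable]: "h \<in> borel_measurable ?S" unfolding h_def by measurable
  define N where "N = distr (density ?S h) (borel \<Otimes>\<^sub>M borel)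
      (\<lambda>x. (\<tau> (fst (fst x)) (snd x), \<tau> (snd (fst x)) (snd x)))"
  have nn: "(\<integral>\<^sup>+u. q u \<partial>N) = (\<integral>\<^sup>+w. \<integral>\<^sup>+x. of_bool (fst x \<noteq> snd x) * (indicator {0..b} (\<tau> (fst x) w) *
        indicator {0..b} (\<tau> (snd x) w)) * q (\<tau> (fst x) w, \<tau> (snd x) w) \<partial>count_space UNIV \<partial>P)"
    if [measurable]: "q \<in> borel_measurable (borel \<Otimes>\<^sub>M borel)" for q :: "real \<times> real \<Rightarrow> ennreal"
    unfolding N_def
    by (subst nn_integral_distr, measurable, subst nn_integral_density, measurable)
      (subst S.nn_integral_snd[symmetric], auto simp: h_def)
  have "?I \<Otimes>\<^sub>M ?I = N"
  proof (rule pair_measure_eqI)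
    fix A B assume "A \<in> sets ?I" "B \<in> sets ?I"
    then have [measurable]: "A \<in> sets borel" "B \<in> sets borel" by auto
    have "emeasure N (A \<times> B) = (\<integral>\<^sup>+u. indicator (A \<times> B) u \<partial>N)" by (simp add: N_def)
    also have "\<dots> = (\<integral>\<^sup>+w. \<integral>\<^sup>+x. of_bool (fst x \<noteq> snd x) *
        (indicator (A \<inter> {0..b}) (\<tau> (fst x) w) * indicator (B \<inter> {0..b}) (\<tau> (snd x) w)) \<partial>count_space UNIV \<partial>P)"
      by (subst nn) (auto intro!: nn_integral_cong simp: indicator_def)
    also have "\<dots> = emeasure ?I A * emeasure ?I B"
      by (simp add: distinct_pairs_rectangle emeasure_intensity)
    finally show "emeasure ?I A * emeasure ?I B = emeasure N (A \<times> B)" ..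
  qed (simp_all add: N_def sigma_finite_intensity cong: sets_pair_measure_cong)
  then have N: "N = ?I \<Otimes>\<^sub>M ?I" ..
  have "(\<integral>\<^sup>+u. f u \<partial>?I) * (\<integral>\<^sup>+u. g u \<partial>?I) = (\<integral>\<^sup>+x. \<integral>\<^sup>+y. f x * g y \<partial>?I \<partial>?I)"
    by (simp add: nn_integral_cmult nn_integral_multc)
  also have "\<dots> = (\<integral>\<^sup>+u. f (fst u) * g (snd u) \<partial>N)"
    unfolding N using I.nn_integral_fst[of "\<lambda>u. f (fst u) * g (snd u)" ?I] by simp
  also have "\<dots> = (\<integral>\<^sup>+w. \<integral>\<^sup>+x. of_bool (fst x \<noteq> snd x) * (f (\<tau> (fst x) w) * g (\<tau> (snd x) w))
      \<partial>count_space UNIV \<partial>P)"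
    by (subst nn) (auto intro!: nn_integral_cong simp: indicator_def f g)
  finally show ?thesis ..
qed

end

section \<open>Moments of the queue length\<close>

text \<open>This integrates out the service times while the arrival times stay fixed.\<close>

lemma (in prob_space) nn_integral_indep_pair:
  assumes i: "indep_var S X T Y" and F [measurable]: "F \<in> borel_measurable (S \<Otimes>\<^sub>M T)"
  shows "(\<integral>\<^sup>+w. F (X w, Y w) \<partial>M) = (\<integral>\<^sup>+w. \<integral>\<^sup>+y. F (X w, y) \<partial>distr M T Y \<partial>M)"
proof -
  have [measurable]: "X \<in> measurable M S" "Y \<in> measurable M T"
    using i by (auto dest: indep_var_rv1 indep_var_rv2)
  interpret Y: prob_space "distr M T Y" by (rule prob_space_distr) measurable
  have "(\<integral>\<^sup>+w. F (X w, Y w) \<partial>M) = (\<integral>\<^sup>+x. F x \<partial>distr M (S \<Otimes>\<^sub>M T) (\<lambda>w. (X w, Y w)))"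
    by (subst nn_integral_distr) auto
  also have "\<dots> = (\<integral>\<^sup>+x. F x \<partial>(distr M S X \<Otimes>\<^sub>M distr M T Y))"
    using i by (simp add: indep_var_distribution_eq)
  also have "\<dots> = (\<integral>\<^sup>+x. \<integral>\<^sup>+y. F (x, y) \<partial>distr M T Y \<partial>distr M S X)"
    by (subst Y.nn_integral_fst[symmetric]) auto
  also have "\<dots> = (\<integral>\<^sup>+w. \<integral>\<^sup>+y. F (X w, y) \<partial>distr M T Y \<partial>M)"
    by (subst nn_integral_distr) auto
  finally show ?thesis .
qed

text \<open>The probability that a customer who arrives at time \<open>u\<close> is still present at time \<open>t\<close>.\<close>

definition survivors :: "(real \<Rightarrow> real) \<Rightarrow> real \<Rightarrow> real \<Rightarrow> ennreal" where
  "survivors G t u = of_bool (0 \<le> u \<and> u \<le> t) * ennreal (1 - G (t - u))"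

definition mean_queue :: "(real \<Rightarrow> real) \<Rightarrow> (real \<Rightarrow> real) \<Rightarrow> real \<Rightarrow> ennreal" where
  "mean_queue lam G t = (\<integral>\<^sup>+u. ennreal (lam u) * survivors G t u \<partial>lborel)"

definition cov_queue :: "(real \<Rightarrow> real) \<Rightarrow> (real \<Rightarrow> real) \<Rightarrow> real \<Rightarrow> real \<Rightarrow> ennreal" where
  "cov_queue lam G t s = (\<integral>\<^sup>+u. ennreal (lam u) * (of_bool (0 \<le> u \<and> u \<le> min t s) * ennreal (1 - G (max t s - u))) \<partial>lborel)"

locale infinite_server_queue = poisson_points P lam \<tau>
  for P :: "'w measure" and lam \<tau> +
  fixes G :: "real \<Rightarrow> real" and \<sigma> :: "nat \<Rightarrow> 'w \<Rightarrow> real"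
  assumes queue: "Mt_G_infinity P lam G \<tau> \<sigma>"
begin

lemma sigma_measurable [measurable]: "\<sigma> j \<in> borel_measurable P"
  using queue by (auto simp: Mt_G_infinity_def indep_vars_def)

definition service_law :: "real measure" where
  "service_law = distr P borel (\<sigma> 0)"

lemma real_distribution_service: "real_distribution (distr P borel (\<sigma> j))"
  by (intro real_distribution_distr) measurable

lemma distr_sigma: "distr P borel (\<sigma> j) = service_law"
  unfolding service_law_def
  by (rule cdf_unique) (use queue real_distribution_service in \<open>auto simp: Mt_G_infinity_def\<close>)

lemma G_eq_cdf: "G = cdf service_law"
  using queue unfolding Mt_G_infinity_def service_law_def by metis

sublocale service: real_distribution service_law
  unfolding service_law_def by (rule real_distribution_service)

lemma G_measurable [measurable]: "G \<in> borel_measurable borel"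
  unfolding G_eq_cdf by (rule borel_measurable_mono) (auto intro: monoI service.cdf_nondecreasing)

lemma service_tail: "emeasure service_law {v<..} = ennreal (1 - G v)"
proof -
  have "measure service_law {v<..} = 1 - measure service_law {..v}"
    using service.prob_compl[of "{..v}"] by (simp add: Compl_eq_Diff_UNIV[symmetric])
  then show ?thesis by (simp add: service.emeasure_eq_measure G_eq_cdf cdf_def)
qed

lemma indep_sequences:
  "indep_var (\<Pi>\<^sub>M j\<in>UNIV. borel) (\<lambda>w j. \<tau> j w) (\<Pi>\<^sub>M j\<in>UNIV. borel) (\<lambda>w j. \<sigma> j w)"
  using queue by (simp add: Mt_G_infinity_def)

lemma indep_arrival_service: "indep_var borel (\<tau> i) borel (\<sigma> i)"
  using indep_var_compose[OF indep_sequences, of "\<lambda>x. x i" borel "\<lambda>x. x i" borel]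
  by (simp add: comp_def)

lemma indep_arrivals_services:
  "indep_var (borel \<Otimes>\<^sub>M borel) (\<lambda>w. (\<tau> i w, \<tau> j w)) (borel \<Otimes>\<^sub>M borel) (\<lambda>w. (\<sigma> i w, \<sigma> j w))"
  using indep_var_compose[OF indep_sequences, of "\<lambda>x. (x i, x j)" "borel \<Otimes>\<^sub>M borel" "\<lambda>x. (x i, x j)" "borel \<Otimes>\<^sub>M borel"]
  by (simp add: comp_def)

lemma distr_service_pair: assumes "i \<noteq> j"
  shows "distr P (borel \<Otimes>\<^sub>M borel) (\<lambda>w. (\<sigma> i w, \<sigma> j w)) = service_law \<Otimes>\<^sub>M service_law"
proof -
  have "indep_vars (\<lambda>_. borel) \<sigma> UNIV"
    using queue by (simp add: Mt_G_infinity_def)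
  then have "indep_var borel (\<sigma> i) borel (\<sigma> j)"
    using indep_var_compose[OF indep_var_restrict[of "\<lambda>_. borel" \<sigma> UNIV "{i}" "{j}"],
      of "\<lambda>x. x i" borel "\<lambda>x. x j" borel] assms by (simp add: comp_def)
  then show ?thesis by (simp add: indep_var_distribution_eq distr_sigma)
qed

text \<open>The condition \<open>0 \<le> \<tau> j w\<close>, true almost surely, confines the points to a bounded window.\<close>

definition present :: "nat \<Rightarrow> real \<Rightarrow> 'w \<Rightarrow> ennreal" where
  "present j t w = of_bool (0 \<le> \<tau> j w \<and> \<tau> j w \<le> t \<and> t - \<tau> j w < \<sigma> j w)"

lemma present_measurable [measurable]: "present j t \<in> borel_measurable P"
  unfolding present_def by measurable

lemma survivors_measurable [measurable]: "survivors G t \<in> borel_measurable borel"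
  unfolding survivors_def by measurable

lemma present_average:
  "(\<integral>\<^sup>+s. of_bool (0 \<le> x \<and> x \<le> t \<and> t - x < s) \<partial>service_law) = survivors G t x"
proof -
  have "(\<integral>\<^sup>+s. of_bool (0 \<le> x \<and> x \<le> t \<and> t - x < s) \<partial>service_law)
      = (\<integral>\<^sup>+s. of_bool (0 \<le> x \<and> x \<le> t) * indicator {t - x<..} s \<partial>service_law)"
    by (intro nn_integral_cong) (auto simp: indicator_def)
  also have "\<dots> = of_bool (0 \<le> x \<and> x \<le> t) * emeasure service_law {t - x<..}"
    by (subst nn_integral_cmult) auto
  finally show ?thesis by (simp add: service_tail survivors_def)
qed

lemma present_mean: "(\<integral>\<^sup>+w. present j t w \<partial>P) = (\<integral>\<^sup>+w. survivors G t (\<tau> j w) \<partial>P)"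
proof -
  let ?F = "\<lambda>(x, s). of_bool (0 \<le> x \<and> x \<le> t \<and> t - x < s) :: ennreal"
  have "?F \<in> borel_measurable (borel \<Otimes>\<^sub>M borel)" by measurable
  from nn_integral_indep_pair[OF indep_arrival_service this, of j]
  show ?thesis by (simp add: present_def distr_sigma present_average)
qed

lemma present_twice: "(\<integral>\<^sup>+w. present j t w * present j s w \<partial>P)
  = (\<integral>\<^sup>+w. of_bool (0 \<le> \<tau> j w \<and> \<tau> j w \<le> min t s) * ennreal (1 - G (max t s - \<tau> j w)) \<partial>P)"
proof -
  let ?F = "\<lambda>(x, y). of_bool (0 \<le> x \<and> x \<le> t \<and> t - x < y) * of_bool (0 \<le> x \<and> x \<le> s \<and> s - x < y) :: ennreal"
  have "?F \<in> borel_measurable (borel \<Otimes>\<^sub>M borel)" by measurable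
  from nn_integral_indep_pair[OF indep_arrival_service this, of j]
  have "(\<integral>\<^sup>+w. present j t w * present j s w \<partial>P) = (\<integral>\<^sup>+w. \<integral>\<^sup>+y. ?F (\<tau> j w, y) \<partial>service_law \<partial>P)"
    by (simp add: present_def distr_sigma)
  also have "\<dots> = (\<integral>\<^sup>+w. of_bool (0 \<le> \<tau> j w \<and> \<tau> j w \<le> min t s) * ennreal (1 - G (max t s - \<tau> j w)) \<partial>P)"
  proof (rule nn_integral_cong)
    fix w
    have "(\<integral>\<^sup>+y. ?F (\<tau> j w, y) \<partial>service_law)
      = (\<integral>\<^sup>+y. of_bool (0 \<le> \<tau> j w \<and> \<tau> j w \<le> min t s) * indicator {max t s - \<tau> j w<..} y \<partial>service_law)"
      by (intro nn_integral_cong) (auto simp: indicator_def)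
    also have "\<dots> = of_bool (0 \<le> \<tau> j w \<and> \<tau> j w \<le> min t s) * emeasure service_law {max t s - \<tau> j w<..}"
      by (subst nn_integral_cmult) auto
    finally show "(\<integral>\<^sup>+y. ?F (\<tau> j w, y) \<partial>service_law)
      = of_bool (0 \<le> \<tau> j w \<and> \<tau> j w \<le> min t s) * ennreal (1 - G (max t s - \<tau> j w))"
      by (simp add: service_tail)
  qed
  finally show ?thesis .
qed

text \<open>Two different customers have independent service times, so averaging over these factorizes.\<close>

lemma present_pair: assumes "i \<noteq> j"
  shows "(\<integral>\<^sup>+w. present i t w * present j s w \<partial>P)
    = (\<integral>\<^sup>+w. survivors G t (\<tau> i w) * survivors G s (\<tau> j w) \<partial>P)"
proof -
  let ?p = "\<lambda>t x y. of_bool (0 \<le> x \<and> x \<le> t \<and> t - x < y) :: ennreal"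
  let ?F = "\<lambda>(x, y). ?p t (fst x) (fst y) * ?p s (snd x) (snd y)"
  have "?F \<in> borel_measurable ((borel \<Otimes>\<^sub>M borel) \<Otimes>\<^sub>M (borel \<Otimes>\<^sub>M borel))" by measurable
  from nn_integral_indep_pair[OF indep_arrivals_services this, of i j]
  have "(\<integral>\<^sup>+w. present i t w * present j s w \<partial>P) = (\<integral>\<^sup>+w. \<integral>\<^sup>+y. ?p t (\<tau> i w) (fst y) * ?p s (\<tau> j w) (snd y)
      \<partial>(service_law \<Otimes>\<^sub>M service_law) \<partial>P)"
    by (simp add: present_def distr_service_pair[OF assms])
  also have "\<dots> = (\<integral>\<^sup>+w. survivors G t (\<tau> i w) * survivors G s (\<tau> j w) \<partial>P)"
  proof (rule nn_integral_cong)
    fix w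
    have "(\<integral>\<^sup>+y. ?p t (\<tau> i w) (fst y) * ?p s (\<tau> j w) (snd y) \<partial>(service_law \<Otimes>\<^sub>M service_law))
      = (\<integral>\<^sup>+y. \<integral>\<^sup>+z. ?p t (\<tau> i w) y * ?p s (\<tau> j w) z \<partial>service_law \<partial>service_law)"
      by (subst service.nn_integral_fst[symmetric]) auto
    also have "\<dots> = (\<integral>\<^sup>+y. ?p t (\<tau> i w) y * (\<integral>\<^sup>+z. ?p s (\<tau> j w) z \<partial>service_law) \<partial>service_law)"
      by (intro nn_integral_cong nn_integral_cmult) auto
    also have "\<dots> = survivors G t (\<tau> i w) * survivors G s (\<tau> j w)"
      by (subst nn_integral_multc) (auto simp: present_average)
    finally show "(\<integral>\<^sup>+y. ?p t (\<tau> i w) (fst y) * ?p s (\<tau> j w) (snd y) \<partial>(service_law \<Otimes>\<^sub>M service_law))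
      = survivors G t (\<tau> i w) * survivors G s (\<tau> j w)" .
  qed
  finally show ?thesis .
qed

text \<open>The queue length as a sum of extended nonnegative terms. It equals \<open>queue_length\<close> at all times
simultaneously outside one null set, where the series defining \<open>queue_length\<close> may diverge.\<close>

definition total :: "real \<Rightarrow> 'w \<Rightarrow> ennreal" where
  "total t w = (\<integral>\<^sup>+j. present j t w \<partial>count_space UNIV)"

lemma AE_queue_length: "AE w in P. \<forall>t. 0 \<le> queue_length \<tau> \<sigma> t w \<and> ennreal (queue_length \<tau> \<sigma> t w) = total t w"
proof -
  have "AE w in P. \<forall>b. finite {j. \<tau> j w \<le> b}" "AE w in P. \<forall>j. 0 \<le> \<tau> j w"
    using poisson by (auto simp: poisson_process_def)
  then show ?thesis
  proof eventually_elim
    case (elim w)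
    show ?case
    proof
      fix t
      have fin: "finite {j. \<tau> j w \<le> t}" using elim by blast
      have q: "queue_length \<tau> \<sigma> t w = (\<Sum>j\<in>{j. \<tau> j w \<le> t}. of_bool (\<tau> j w \<le> t \<and> t - \<tau> j w < \<sigma> j w))"
        unfolding queue_length_def by (rule suminf_finite[OF fin]) auto
      have "total t w = (\<Sum>j\<in>{j. \<tau> j w \<le> t}. present j t w)"
        unfolding total_def nn_integral_count_space_nat
        by (rule suminf_finite[OF fin]) (auto simp: present_def)
      also have "\<dots> = (\<Sum>j\<in>{j. \<tau> j w \<le> t}. ennreal (of_bool (\<tau> j w \<le> t \<and> t - \<tau> j w < \<sigma> j w)))"
        using elim by (intro sum.cong) (auto simp: present_def)
      also have "\<dots> = ennreal (queue_length \<tau> \<sigma> t w)"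
        unfolding q by (rule sum_ennreal) auto
      finally show "0 \<le> queue_length \<tau> \<sigma> t w \<and> ennreal (queue_length \<tau> \<sigma> t w) = total t w"
        unfolding q by (auto intro: sum_nonneg)
    qed
  qed
qed

lemma mean_queue_intensity:
  assumes "t \<le> b" shows "(\<integral>\<^sup>+u. survivors G t u \<partial>intensity_measure lam b) = mean_queue lam G t"
  unfolding mean_queue_def
  by (subst nn_integral_intensity)
    (use assms in \<open>auto intro!: nn_integral_cong simp: survivors_def indicator_def\<close>)

lemma total_mean: "(\<integral>\<^sup>+w. total t w \<partial>P) = mean_queue lam G t"
proof -
  have "(\<integral>\<^sup>+w. total t w \<partial>P) = (\<integral>\<^sup>+j. \<integral>\<^sup>+w. present j t w \<partial>P \<partial>count_space UNIV)"
    unfolding total_def by (rule nn_integral_count_swap) measurable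
  also have "\<dots> = (\<integral>\<^sup>+w. \<integral>\<^sup>+j. survivors G t (\<tau> j w) \<partial>count_space UNIV \<partial>P)"
    unfolding present_mean by (rule nn_integral_count_swap[symmetric]) measurable
  also have "\<dots> = (\<integral>\<^sup>+u. survivors G t u \<partial>intensity_measure lam t)"
    by (rule campbell_mean) (auto simp: survivors_def)
  finally show ?thesis by (simp add: mean_queue_intensity)
qed

text \<open>Equal indices contribute the covariance and distinct indices the product of the means.\<close>

lemma total_product: "(\<integral>\<^sup>+w. total t w * total s w \<partial>P)
  = mean_queue lam G t * mean_queue lam G s + cov_queue lam G t s"
proof -
  define b where "b = max t s"
  define c where "c u = of_bool (0 \<le> u \<and> u \<le> min t s) * ennreal (1 - G (max t s - u))" for u
  have [measurable]: "c \<in> borel_measurable borel" unfolding c_def by measurable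
  have [measurable]: "(\<lambda>w. \<integral>\<^sup>+j. f j w \<partial>count_space UNIV) \<in> borel_measurable P"
    if [measurable]: "\<And>j. f j \<in> borel_measurable P" for f :: "nat \<Rightarrow> 'w \<Rightarrow> ennreal"
    by (subst nn_integral_count_space_nat) (intro borel_measurable_suminf_order, measurable)
  have [measurable]: "(\<lambda>w. \<integral>\<^sup>+x. f x w \<partial>count_space UNIV) \<in> borel_measurable P"
    if [measurable]: "\<And>j. f j \<in> borel_measurable P" for f :: "nat \<times> nat \<Rightarrow> 'w \<Rightarrow> ennreal"
    by (subst nn_integral_bij_count_space[OF bij_prod_decode, symmetric], subst nn_integral_count_space_nat)
      (intro borel_measurable_suminf_order, measurable)
  have "(\<integral>\<^sup>+w. total t w * total s w \<partial>P)
      = (\<integral>\<^sup>+w. \<integral>\<^sup>+j. present j t w * present j s w \<partial>count_space UNIV \<partial>P)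
        + (\<integral>\<^sup>+w. \<integral>\<^sup>+x. of_bool (fst x \<noteq> snd x) * (present (fst x) t w * present (snd x) s w) \<partial>count_space UNIV \<partial>P)"
    unfolding total_def nn_integral_count_product by (rule nn_integral_add) measurable
  also have "(\<integral>\<^sup>+w. \<integral>\<^sup>+j. present j t w * present j s w \<partial>count_space UNIV \<partial>P)
      = (\<integral>\<^sup>+j. \<integral>\<^sup>+w. c (\<tau> j w) \<partial>P \<partial>count_space UNIV)"
    unfolding c_def present_twice[symmetric] by (rule nn_integral_count_swap) measurable
  also have "\<dots> = (\<integral>\<^sup>+w. \<integral>\<^sup>+j. c (\<tau> j w) \<partial>count_space UNIV \<partial>P)"
    by (rule nn_integral_count_swap[symmetric]) measurable
  also have "\<dots> = (\<integral>\<^sup>+u. c u \<partial>intensity_measure lam b)"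
    by (rule campbell_mean) (auto simp: c_def b_def)
  also have "\<dots> = cov_queue lam G t s"
    unfolding cov_queue_def c_def[symmetric]
    by (subst nn_integral_intensity) (auto intro!: nn_integral_cong simp: c_def b_def indicator_def)
  also have "(\<integral>\<^sup>+w. \<integral>\<^sup>+x. of_bool (fst x \<noteq> snd x) * (present (fst x) t w * present (snd x) s w) \<partial>count_space UNIV \<partial>P)
      = (\<integral>\<^sup>+x. \<integral>\<^sup>+w. of_bool (fst x \<noteq> snd x) * (present (fst x) t w * present (snd x) s w) \<partial>P \<partial>count_space UNIV)"
    by (rule nn_integral_count_swap) measurable
  also have "\<dots> = (\<integral>\<^sup>+x. \<integral>\<^sup>+w. of_bool (fst x \<noteq> snd x) * (survivors G t (\<tau> (fst x) w) * survivors G s (\<tau> (snd x) w)) \<partial>P \<partial>count_space UNIV)"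
  proof (rule nn_integral_cong)
    fix x :: "nat \<times> nat"
    show "(\<integral>\<^sup>+w. of_bool (fst x \<noteq> snd x) * (present (fst x) t w * present (snd x) s w) \<partial>P)
      = (\<integral>\<^sup>+w. of_bool (fst x \<noteq> snd x) * (survivors G t (\<tau> (fst x) w) * survivors G s (\<tau> (snd x) w)) \<partial>P)"
      by (cases "fst x = snd x") (simp_all add: present_pair)
  qed
  also have "\<dots> = (\<integral>\<^sup>+w. \<integral>\<^sup>+x. of_bool (fst x \<noteq> snd x) * (survivors G t (\<tau> (fst x) w) * survivors G s (\<tau> (snd x) w)) \<partial>count_space UNIV \<partial>P)"
    by (rule nn_integral_count_swap[symmetric]) measurable
  also have "\<dots> = (\<integral>\<^sup>+u. survivors G t u \<partial>intensity_measure lam b) * (\<integral>\<^sup>+u. survivors G s u \<partial>intensity_measure lam b)"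
    by (rule campbell_distinct_pairs) (auto simp: survivors_def b_def)
  also have "\<dots> = mean_queue lam G t * mean_queue lam G s"
    by (simp add: mean_queue_intensity b_def)
  finally show ?thesis by (simp add: add.commute)
qed

lemma queue_measurable: "(\<lambda>x. queue_length \<tau> \<sigma> (fst x) (snd x)) \<in> borel_measurable (borel \<Otimes>\<^sub>M P)"
  unfolding queue_length_def by measurable

lemma queue_measurable' [measurable]: "queue_length \<tau> \<sigma> t \<in> borel_measurable P"
  unfolding queue_length_def by measurable

lemma queue_mean: "(\<integral>\<^sup>+w. ennreal (queue_length \<tau> \<sigma> t w) \<partial>P) = mean_queue lam G t"
  unfolding total_mean[symmetric]
  by (rule nn_integral_cong_AE) (use AE_queue_length in \<open>eventually_elim, simp\<close>)

lemma queue_product: "(\<integral>\<^sup>+w. ennreal (queue_length \<tau> \<sigma> t w) * ennreal (queue_length \<tau> \<sigma> s w) \<partial>P)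
  = mean_queue lam G t * mean_queue lam G s + cov_queue lam G t s"
  unfolding total_product[symmetric]
  by (rule nn_integral_cong_AE) (use AE_queue_length in \<open>eventually_elim, simp\<close>)

end

text \<open>Only pairs of values \<open>(X\<^sub>k(t), X\<^sub>l(s))\<close> enter, so that independence of the processes as random elements
of the product space suffices, although path integrals are not measurable on that space.\<close>

lemma sample_moments:
  fixes X :: "nat \<Rightarrow> real \<Rightarrow> 'w \<Rightarrow> real"
  assumes S: "Mt_G_infinity_sample P lam G n \<tau> \<sigma>" and n: "1 \<le> n"
    and lam: "\<And>t. 0 \<le> lam t" "\<And>b. set_integrable lborel {0..b} lam" "lam \<in> borel_measurable borel"
  defines "Y \<equiv> \<lambda>t w. (\<Sum>k=1..n. queue_length (\<tau> k) (\<sigma> k) t w) / real n"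
  shows "AE w in P. \<forall>k\<in>{1..n}. \<forall>t. 0 \<le> queue_length (\<tau> k) (\<sigma> k) t w"
    and "\<And>k. k \<in> {1..n} \<Longrightarrow>
        (\<lambda>x. queue_length (\<tau> k) (\<sigma> k) (fst x) (snd x)) \<in> borel_measurable (borel \<Otimes>\<^sub>M P)"
    and "\<And>k t. k \<in> {1..n} \<Longrightarrow> (\<integral>\<^sup>+w. ennreal (queue_length (\<tau> k) (\<sigma> k) t w) \<partial>P) = mean_queue lam G t"
    and "\<And>t. (\<integral>\<^sup>+w. ennreal (Y t w) \<partial>P) = mean_queue lam G t"
    and "\<And>t s. (\<integral>\<^sup>+w. ennreal (Y t w * Y s w) \<partial>P)
        = mean_queue lam G t * mean_queue lam G s + ennreal (1 / real n) * cov_queue lam G t s"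
proof -
  interpret prob_space P using S by (simp add: Mt_G_infinity_sample_def)
  have Q: "infinite_server_queue P lam (\<tau> k) G (\<sigma> k)" if "k \<in> {1..n}" for k
  proof -
    have "Mt_G_infinity P lam G (\<tau> k) (\<sigma> k)" using S that by (simp add: Mt_G_infinity_sample_def)
    then show ?thesis using lam
      by unfold_locales (auto simp: Mt_G_infinity_def)
  qed
  note [measurable] = infinite_server_queue.queue_measurable'[OF Q]
  have Xm: "(\<lambda>w. ennreal (queue_length (\<tau> k) (\<sigma> k) t w)) \<in> borel_measurable P" if "k \<in> {1..n}" for k t
    using that by measurable
  have "AE w in P. \<forall>k\<in>{1..n}. \<forall>t. 0 \<le> queue_length (\<tau> k) (\<sigma> k) t w \<and>
      ennreal (queue_length (\<tau> k) (\<sigma> k) t w) = infinite_server_queue.total (\<tau> k) (\<sigma> k) t w"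
  proof (rule AE_finite_allI)
    fix k assume "k \<in> {1..n}"
    from infinite_server_queue.AE_queue_length[OF Q[OF this]]
    show "AE w in P. \<forall>t. 0 \<le> queue_length (\<tau> k) (\<sigma> k) t w \<and>
      ennreal (queue_length (\<tau> k) (\<sigma> k) t w) = infinite_server_queue.total (\<tau> k) (\<sigma> k) t w" .
  qed simp
  then show AE: "AE w in P. \<forall>k\<in>{1..n}. \<forall>t. 0 \<le> queue_length (\<tau> k) (\<sigma> k) t w"
    by eventually_elim blast
  show "(\<lambda>x. queue_length (\<tau> k) (\<sigma> k) (fst x) (snd x)) \<in> borel_measurable (borel \<Otimes>\<^sub>M P)"
    if "k \<in> {1..n}" for k using infinite_server_queue.queue_measurable[OF Q[OF that]] .
  show mean: "(\<integral>\<^sup>+w. ennreal (queue_length (\<tau> k) (\<sigma> k) t w) \<partial>P) = mean_queue lam G t"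
    if "k \<in> {1..n}" for k t using infinite_server_queue.queue_mean[OF Q[OF that]] .
  let ?X = "\<lambda>k t w. ennreal (queue_length (\<tau> k) (\<sigma> k) t w)"
  have AEY: "AE w in P. \<forall>t. 0 \<le> Y t w \<and> ennreal (Y t w) = ennreal (1 / n) * (\<Sum>k=1..n. ?X k t w)"
    using AE
  proof eventually_elim
    case (elim w)
    show ?case
    proof
      fix t
      have "(\<Sum>k=1..n. ?X k t w) = ennreal (\<Sum>k=1..n. queue_length (\<tau> k) (\<sigma> k) t w)"
        using elim by (intro sum_ennreal) auto
      moreover have nn: "0 \<le> (\<Sum>k=1..n. queue_length (\<tau> k) (\<sigma> k) t w)"
        using elim by (auto intro: sum_nonneg)
      ultimately have "ennreal (1 / n) * (\<Sum>k=1..n. ?X k t w) = ennreal (Y t w)"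
        unfolding Y_def by (simp only: ennreal_mult''[symmetric] mult_1 times_divide_eq_left)
      then show "0 \<le> Y t w \<and> ennreal (Y t w) = ennreal (1 / n) * (\<Sum>k=1..n. ?X k t w)"
        using nn unfolding Y_def by auto
    qed
  qed
  have inv: "ennreal (1 / real n) * of_nat n = 1"
    using n by (simp add: ennreal_of_nat_eq_real_of_nat ennreal_mult[symmetric] ennreal_1[symmetric] del: ennreal_1)
  show "(\<integral>\<^sup>+w. ennreal (Y t w) \<partial>P) = mean_queue lam G t" for t
  proof -
    have "(\<integral>\<^sup>+w. ennreal (Y t w) \<partial>P) = (\<integral>\<^sup>+w. ennreal (1 / n) * (\<Sum>k=1..n. ?X k t w) \<partial>P)"
      by (rule nn_integral_cong_AE) (use AEY in \<open>eventually_elim, blast\<close>)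
    also have "\<dots> = ennreal (1 / n) * (\<Sum>k=1..n. \<integral>\<^sup>+w. ?X k t w \<partial>P)"
      by (subst nn_integral_cmult) (intro borel_measurable_sum Xm, assumption, subst nn_integral_sum, erule Xm, rule refl)
    also have "\<dots> = (ennreal (1 / n) * of_nat n) * mean_queue lam G t"
      by (simp add: mean mult.assoc)
    finally show ?thesis unfolding inv by simp
  qed
  show "(\<integral>\<^sup>+w. ennreal (Y t w * Y s w) \<partial>P)
      = mean_queue lam G t * mean_queue lam G s + ennreal (1 / real n) * cov_queue lam G t s" for t s
  proof -
    have pair: "(\<integral>\<^sup>+w. ?X k t w * ?X l s w \<partial>P)
      = mean_queue lam G t * mean_queue lam G s + of_bool (k = l) * cov_queue lam G t s"
      if k: "k \<in> {1..n}" and l: "l \<in> {1..n}" for k l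
    proof (cases "k = l")
      case True
      then show ?thesis using infinite_server_queue.queue_product[OF Q[OF k]] by simp
    next
      case False
      let ?T = "\<lambda>i. if i = k then t else s"
      have "indep_vars (\<lambda>_. \<Pi>\<^sub>M t\<in>UNIV. borel) (\<lambda>k w t. queue_length (\<tau> k) (\<sigma> k) t w) {1..n}"
        using S by (simp add: Mt_G_infinity_sample_def)
      then have "indep_vars (\<lambda>_. \<Pi>\<^sub>M t\<in>UNIV. borel) (\<lambda>k w t. queue_length (\<tau> k) (\<sigma> k) t w) {k, l}"
        by (rule indep_vars_subset) (use k l in auto)
      from indep_vars_compose2[OF this, of "\<lambda>i x. ennreal (x (?T i))" "\<lambda>_. borel"]
      have "indep_vars (\<lambda>_. borel) (\<lambda>i w. ?X i (?T i) w) {k, l}" by simp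
      from indep_vars_nn_integral[OF _ this] False
      show ?thesis by (simp add: mean[OF k] mean[OF l])
    qed
    have "(\<integral>\<^sup>+w. ennreal (Y t w * Y s w) \<partial>P)
        = (\<integral>\<^sup>+w. (ennreal (1 / n) * ennreal (1 / n)) * (\<Sum>k=1..n. \<Sum>l=1..n. ?X k t w * ?X l s w) \<partial>P)"
    proof (rule nn_integral_cong_AE)
      show "AE w in P. ennreal (Y t w * Y s w)
          = (ennreal (1 / n) * ennreal (1 / n)) * (\<Sum>k=1..n. \<Sum>l=1..n. ?X k t w * ?X l s w)"
        using AEY
      proof eventually_elim
        case (elim w)
        then have "ennreal (Y t w * Y s w)
            = (ennreal (1 / n) * (\<Sum>k=1..n. ?X k t w)) * (ennreal (1 / n) * (\<Sum>k=1..n. ?X k s w))"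
          by (simp add: ennreal_mult)
        also have "\<dots> = (ennreal (1 / n) * ennreal (1 / n)) * ((\<Sum>k=1..n. ?X k t w) * (\<Sum>k=1..n. ?X k s w))"
          by (simp only: mult.assoc mult.left_commute)
        finally show ?case by (simp only: sum_product)
      qed
    qed
    also have "\<dots> = (ennreal (1 / n) * ennreal (1 / n)) * (\<Sum>k=1..n. \<Sum>l=1..n. \<integral>\<^sup>+w. ?X k t w * ?X l s w \<partial>P)"
    proof (subst nn_integral_cmult)
      show "(\<lambda>w. \<Sum>k=1..n. \<Sum>l=1..n. ?X k t w * ?X l s w) \<in> borel_measurable P"
        by (intro borel_measurable_sum borel_measurable_times_ennreal Xm)
      show "ennreal (1 / n) * ennreal (1 / n) * (\<integral>\<^sup>+w. (\<Sum>k=1..n. \<Sum>l=1..n. ?X k t w * ?X l s w) \<partial>P)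
        = ennreal (1 / n) * ennreal (1 / n) * (\<Sum>k=1..n. \<Sum>l=1..n. \<integral>\<^sup>+w. ?X k t w * ?X l s w \<partial>P)"
        by (subst nn_integral_sum; intro arg_cong2[where f = times] refl sum.cong
            borel_measurable_sum borel_measurable_times_ennreal Xm nn_integral_sum; assumption)
    qed
    also have "(\<Sum>k=1..n. \<Sum>l=1..n. \<integral>\<^sup>+w. ?X k t w * ?X l s w \<partial>P)
        = (\<Sum>k=1..n. \<Sum>l=1..n. mean_queue lam G t * mean_queue lam G s + of_bool (k = l) * cov_queue lam G t s)"
      by (intro sum.cong refl pair)
    also have "\<dots> = (\<Sum>k=1..n. of_nat n * (mean_queue lam G t * mean_queue lam G s) + cov_queue lam G t s)"
    proof (intro sum.cong refl)
      fix k assume "k \<in> {1..n}"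
      then have "(\<Sum>l=1..n. of_bool (k = l) * cov_queue lam G t s) = cov_queue lam G t s"
        by (subst sum.remove[of _ k]) (auto intro!: sum.neutral)
      then show "(\<Sum>l=1..n. mean_queue lam G t * mean_queue lam G s + of_bool (k = l) * cov_queue lam G t s)
          = of_nat n * (mean_queue lam G t * mean_queue lam G s) + cov_queue lam G t s"
        by (simp add: sum.distrib)
    qed
    also have "\<dots> = of_nat n * (of_nat n * (mean_queue lam G t * mean_queue lam G s) + cov_queue lam G t s)"
      by simp
    also have "(ennreal (1 / n) * ennreal (1 / n)) * \<dots>
        = (ennreal (1 / n) * of_nat n) * ((ennreal (1 / n) * of_nat n) * (mean_queue lam G t * mean_queue lam G s)
          + ennreal (1 / n) * cov_queue lam G t s)"
      by (simp only: distrib_left mult.assoc mult.left_commute)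
    finally show ?thesis unfolding inv by simp
  qed
qed

section \<open>Quadratic functionals and the Plancherel inequality\<close>

lemma iexp_measurable [measurable]: "(\<lambda>x::real. exp (\<i> * of_real x)) \<in> borel_measurable borel"
  by (intro borel_measurable_continuous_onI continuous_intros)

lemma cnj_measurable [measurable]: "cnj \<in> borel_measurable borel"
  by (intro borel_measurable_continuous_onI continuous_intros)

lemma nn_integral_times:
  assumes [measurable]: "f \<in> borel_measurable M" "g \<in> borel_measurable N"
  shows "(\<integral>\<^sup>+x. \<integral>\<^sup>+y. f x * g y \<partial>N \<partial>M) = (\<integral>\<^sup>+x. f x \<partial>M) * (\<integral>\<^sup>+y. g y \<partial>N)"
  by (simp add: nn_integral_cmult nn_integral_multc)

text \<open>Writing \<open>|\<integral> l Z|\<^sup>2\<close> as a double integral and exchanging it with the expectation turns the second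
moment of a linear functional into a quadratic form in the covariances \<open>D\<close>. The bound \<open>B\<close> on the absolute
moments serves only to justify the exchange.\<close>

lemma (in sigma_finite_measure) square_linear_functional_le:
  fixes l :: "real \<Rightarrow> complex" and Z :: "real \<Rightarrow> 'a \<Rightarrow> complex" and D :: "real \<Rightarrow> real \<Rightarrow> complex"
  assumes l [measurable]: "l \<in> borel_measurable borel"
    and Z [measurable]: "(\<lambda>x. Z (fst x) (snd x)) \<in> borel_measurable (borel \<Otimes>\<^sub>M M)"
    and B: "\<And>t s. (\<integral>\<^sup>+w. ennreal (cmod (Z t w) * cmod (Z s w)) \<partial>M) \<le> B t s"
    and fin: "(\<integral>\<^sup>+t. \<integral>\<^sup>+s. ennreal (cmod (l t) * cmod (l s)) * B t s \<partial>lborel \<partial>lborel) < \<infinity>"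
    and D: "\<And>t s. (LINT w|M. Z t w * cnj (Z s w)) = D t s"
  shows "(\<integral>\<^sup>+w. ennreal ((cmod (LINT t|lborel. l t * Z t w))\<^sup>2) \<partial>M)
    \<le> (\<integral>\<^sup>+t. \<integral>\<^sup>+s. ennreal (cmod (l t) * cmod (l s)) * ennreal (cmod (D t s)) \<partial>lborel \<partial>lborel)"
proof -
  interpret LM: pair_sigma_finite "lborel \<Otimes>\<^sub>M (lborel :: real measure)" M ..
  have Z' [measurable]: "Z t \<in> borel_measurable M" for t
    using measurable_compose[OF measurable_Pair1' Z, of t] by simp
  have [measurable]: "(\<lambda>x. Z (fst (fst x)) (snd x)) \<in> borel_measurable ((borel \<Otimes>\<^sub>M borel) \<Otimes>\<^sub>M M)"
    "(\<lambda>x. Z (snd (fst x)) (snd x)) \<in> borel_measurable ((borel \<Otimes>\<^sub>M borel) \<Otimes>\<^sub>M M)"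
    using measurable_compose[OF _ Z, of "\<lambda>x. (fst (fst x), snd x)" "(borel \<Otimes>\<^sub>M borel) \<Otimes>\<^sub>M M"]
      measurable_compose[OF _ Z, of "\<lambda>x. (snd (fst x), snd x)" "(borel \<Otimes>\<^sub>M borel) \<Otimes>\<^sub>M M"] by simp_all
  define V where "V w = (LINT t|lborel. l t * Z t w)" for w
  have Vm [measurable]: "V \<in> borel_measurable M"
  proof -
    have "(\<lambda>x. l (snd x) * Z (snd x) (fst x)) \<in> borel_measurable (M \<Otimes>\<^sub>M lborel)"
      using measurable_compose[OF _ Z, of "\<lambda>x. (snd x, fst x)" "M \<Otimes>\<^sub>M lborel"] by simp
    then show ?thesis unfolding V_def
      by (intro lborel.borel_measurable_lebesgue_integral) (simp add: case_prod_unfold)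
  qed
  define q where "q x w = l (fst x) * cnj (l (snd x)) * (Z (fst x) w * cnj (Z (snd x) w))" for x w
  have [measurable]: "(\<lambda>x. q (fst x) (snd x)) \<in> borel_measurable ((lborel \<Otimes>\<^sub>M lborel) \<Otimes>\<^sub>M M)"
    unfolding q_def by measurable
  have nq: "cmod (q x w) = cmod (l (fst x)) * cmod (l (snd x)) * (cmod (Z (fst x) w) * cmod (Z (snd x) w))" for x w
    by (simp add: q_def norm_mult)
  have iq: "integrable ((lborel \<Otimes>\<^sub>M lborel) \<Otimes>\<^sub>M M) (\<lambda>x. q (fst x) (snd x))"
  proof (rule integrableI_bounded)
    let ?I = "\<lambda>t s. \<integral>\<^sup>+w. ennreal (cmod (Z t w) * cmod (Z s w)) \<partial>M"
    have "(\<integral>\<^sup>+x. ennreal (norm (q (fst x) (snd x))) \<partial>((lborel \<Otimes>\<^sub>M lborel) \<Otimes>\<^sub>M M))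
        = (\<integral>\<^sup>+x. ennreal (cmod (l (fst x)) * cmod (l (snd x))) * ?I (fst x) (snd x) \<partial>(lborel \<Otimes>\<^sub>M lborel))"
      by (subst nn_integral_fst[symmetric], measurable)
        (simp add: nq ennreal_mult' nn_integral_cmult)
    also have "\<dots> = (\<integral>\<^sup>+t. \<integral>\<^sup>+s. ennreal (cmod (l t) * cmod (l s)) * ?I t s \<partial>lborel \<partial>lborel)"
      by (subst lborel.nn_integral_fst[symmetric]) simp_all
    also have "\<dots> \<le> (\<integral>\<^sup>+t. \<integral>\<^sup>+s. ennreal (cmod (l t) * cmod (l s)) * B t s \<partial>lborel \<partial>lborel)"
      by (intro nn_integral_mono mult_left_mono B) simp
    finally show "(\<integral>\<^sup>+x. ennreal (norm (q (fst x) (snd x))) \<partial>((lborel \<Otimes>\<^sub>M lborel) \<Otimes>\<^sub>M M)) < \<infinity>"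
      using fin by (rule le_less_trans)
  qed measurable
  have Vq: "AE w in M. (LINT x|(lborel \<Otimes>\<^sub>M lborel). q x w) = of_real ((cmod (V w))\<^sup>2)"
  proof -
    have "AE w in M. integrable (lborel \<Otimes>\<^sub>M lborel) (\<lambda>x. q x w)"
      using LM.AE_integrable_snd[of q] iq by (simp add: case_prod_unfold)
    then show ?thesis
    proof eventually_elim
      case (elim w)
      then have "(LINT x|(lborel \<Otimes>\<^sub>M lborel). q x w) = (LINT t|lborel. LINT s|lborel. q (t, s) w)"
        using lborel_pair.integral_fst'[of "\<lambda>x. q x w"] by simp
      also have "\<dots> = (LINT t|lborel. (l t * Z t w) * (LINT s|lborel. cnj (l s * Z s w)))"
        by (simp add: q_def mult_ac flip: integral_mult_right_zero)
      also have "\<dots> = V w * cnj (V w)"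
        by (simp only: Bochner_Integration.integral_cnj V_def integral_mult_left_zero)
      also have "\<dots> = of_real ((cmod (V w))\<^sup>2)" by (rule complex_norm_square[symmetric])
      finally show ?case .
    qed
  qed
  have i1: "integrable M (\<lambda>w. LINT x|(lborel \<Otimes>\<^sub>M lborel). q x w)"
    using LM.integrable_snd[of q] iq by (simp add: case_prod_unfold)
  have i2: "integrable M (\<lambda>w. complex_of_real ((cmod (V w))\<^sup>2))"
    by (rule integrable_cong_AE_imp[OF i1 _ Vq]) measurable
  then have iV: "integrable M (\<lambda>w. (cmod (V w))\<^sup>2)"
    by (simp only: complex_of_real_integrable_eq)
  have "(LINT w|M. complex_of_real ((cmod (V w))\<^sup>2)) = (LINT w|M. LINT x|(lborel \<Otimes>\<^sub>M lborel). q x w)"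
    by (rule integral_cong_AE[symmetric, OF _ _ Vq]) (rule borel_measurable_integrable[OF i1], measurable)
  also have "\<dots> = (LINT x|(lborel \<Otimes>\<^sub>M lborel). LINT w|M. q x w)"
    using LM.Fubini_integral[of q] iq by (simp add: case_prod_unfold)
  also have "\<dots> = (LINT x|(lborel \<Otimes>\<^sub>M lborel). l (fst x) * cnj (l (snd x)) * D (fst x) (snd x))"
    unfolding q_def by (simp only: integral_mult_right_zero D)
  finally have eq: "complex_of_real (LINT w|M. (cmod (V w))\<^sup>2)
      = (LINT x|(lborel \<Otimes>\<^sub>M lborel). l (fst x) * cnj (l (snd x)) * D (fst x) (snd x))"
    by (simp only: integral_complex_of_real)
  have "(\<integral>\<^sup>+w. ennreal ((cmod (V w))\<^sup>2) \<partial>M) = ennreal (LINT w|M. (cmod (V w))\<^sup>2)"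
    using iV by (simp add: nn_integral_eq_integral)
  also have "\<dots> \<le> ennreal (cmod (LINT x|(lborel \<Otimes>\<^sub>M lborel). l (fst x) * cnj (l (snd x)) * D (fst x) (snd x)))"
    unfolding eq[symmetric] norm_of_real by (intro ennreal_leI abs_ge_self)
  also have "\<dots> \<le> (\<integral>\<^sup>+x. ennreal (norm (l (fst x) * cnj (l (snd x)) * D (fst x) (snd x))) \<partial>(lborel \<Otimes>\<^sub>M lborel))"
  proof (cases "integrable (lborel \<Otimes>\<^sub>M lborel) (\<lambda>x. l (fst x) * cnj (l (snd x)) * D (fst x) (snd x))")
    case True then show ?thesis by (rule integral_norm_bound_ennreal)
  qed (simp add: not_integrable_integral_eq)
  also have "\<dots> = (\<integral>\<^sup>+t. \<integral>\<^sup>+s. ennreal (cmod (l t) * cmod (l s)) * ennreal (cmod (D t s)) \<partial>lborel \<partial>lborel)"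
  proof -
    have [measurable]: "(\<lambda>x. D (fst x) (snd x)) \<in> borel_measurable (lborel \<Otimes>\<^sub>M lborel)"
      unfolding D[symmetric] by measurable
    show ?thesis
      by (subst lborel.nn_integral_fst[symmetric]) (simp_all add: norm_mult ennreal_mult')
  qed
  finally show ?thesis unfolding V_def .
qed

text \<open>By symmetry of \<open>D\<close> and \<open>2 a(t) a(s) \<le> a(t)\<^sup>2 + a(s)\<^sup>2\<close>, only the integrals of the rows of \<open>D\<close> matter.\<close>

lemma schur_symmetric:
  fixes a :: "real \<Rightarrow> real" and D :: "real \<Rightarrow> real \<Rightarrow> ennreal"
  assumes a [measurable]: "a \<in> borel_measurable borel" and a0: "\<And>t. 0 \<le> a t"
    and D [measurable]: "(\<lambda>x. D (fst x) (snd x)) \<in> borel_measurable (borel \<Otimes>\<^sub>M borel)"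
    and sym: "\<And>t s. D t s = D s t"
  shows "(\<integral>\<^sup>+t. \<integral>\<^sup>+s. ennreal (a t * a s) * D t s \<partial>lborel \<partial>lborel)
    \<le> (\<integral>\<^sup>+t. ennreal ((a t)\<^sup>2) * (\<integral>\<^sup>+s. D t s \<partial>lborel) \<partial>lborel)"
proof -
  have D' [measurable]: "D t \<in> borel_measurable borel" for t
    using measurable_compose[OF measurable_Pair1' D, of t] by simp
  have [measurable]: "(\<lambda>x. D (snd x) (fst x)) \<in> borel_measurable (borel \<Otimes>\<^sub>M borel)"
    using measurable_compose[OF _ D, of "\<lambda>x. (snd x, fst x)" "borel \<Otimes>\<^sub>M borel"] by simp
  let ?q = "\<lambda>t s. ennreal ((a t)\<^sup>2 / 2) * D t s"
  have q: "(\<lambda>x. ?q (fst x) (snd x)) \<in> borel_measurable (borel \<Otimes>\<^sub>M borel)" by measurable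
  have "(\<integral>\<^sup>+t. \<integral>\<^sup>+s. ennreal (a t * a s) * D t s \<partial>lborel \<partial>lborel) \<le> (\<integral>\<^sup>+t. \<integral>\<^sup>+s. ?q t s + ?q s t \<partial>lborel \<partial>lborel)"
  proof (intro nn_integral_mono)
    fix t s
    have "a t * a s \<le> (a t)\<^sup>2 / 2 + (a s)\<^sup>2 / 2"
      using sum_squares_bound[of "a t" "a s"] by (simp add: field_simps)
    then have "ennreal (a t * a s) \<le> ennreal ((a t)\<^sup>2 / 2) + ennreal ((a s)\<^sup>2 / 2)"
      by (subst ennreal_plus[symmetric]) (simp_all add: ennreal_leI del: ennreal_plus)
    then have "ennreal (a t * a s) * D t s \<le> (ennreal ((a t)\<^sup>2 / 2) + ennreal ((a s)\<^sup>2 / 2)) * D t s"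
      by (rule mult_right_mono) simp
    then show "ennreal (a t * a s) * D t s \<le> ?q t s + ?q s t"
      using sym[of t s] by (simp add: distrib_right)
  qed
  also have "\<dots> = (\<integral>\<^sup>+t. (\<integral>\<^sup>+s. ?q t s \<partial>lborel) + (\<integral>\<^sup>+s. ?q s t \<partial>lborel) \<partial>lborel)"
    using q by (intro nn_integral_cong nn_integral_add) (measurable, simp add: sym)
  also have "\<dots> = (\<integral>\<^sup>+t. \<integral>\<^sup>+s. ?q t s \<partial>lborel \<partial>lborel) + (\<integral>\<^sup>+t. \<integral>\<^sup>+s. ?q s t \<partial>lborel \<partial>lborel)"
    by (rule nn_integral_add) measurable
  also have "(\<integral>\<^sup>+t. \<integral>\<^sup>+s. ?q s t \<partial>lborel \<partial>lborel) = (\<integral>\<^sup>+t. \<integral>\<^sup>+s. ?q t s \<partial>lborel \<partial>lborel)"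
    by (rule lborel_pair.Fubini') (simp add: case_prod_unfold)
  also have "(\<integral>\<^sup>+t. \<integral>\<^sup>+s. ?q t s \<partial>lborel \<partial>lborel) + (\<integral>\<^sup>+t. \<integral>\<^sup>+s. ?q t s \<partial>lborel \<partial>lborel)
      = (\<integral>\<^sup>+t. (\<integral>\<^sup>+s. ?q t s \<partial>lborel) + (\<integral>\<^sup>+s. ?q t s \<partial>lborel) \<partial>lborel)"
    by (rule nn_integral_add[symmetric]) measurable
  also have "\<dots> = (\<integral>\<^sup>+t. ennreal ((a t)\<^sup>2) * (\<integral>\<^sup>+s. D t s \<partial>lborel) \<partial>lborel)"
  proof (rule nn_integral_cong)
    fix t
    have "(\<integral>\<^sup>+s. ?q t s \<partial>lborel) + (\<integral>\<^sup>+s. ?q t s \<partial>lborel) = (ennreal ((a t)\<^sup>2 / 2) + ennreal ((a t)\<^sup>2 / 2)) * (\<integral>\<^sup>+s. D t s \<partial>lborel)"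
      by (subst (1 2) nn_integral_cmult) (simp_all add: distrib_right)
    also have "ennreal ((a t)\<^sup>2 / 2) + ennreal ((a t)\<^sup>2 / 2) = ennreal ((a t)\<^sup>2)"
      by (subst ennreal_plus[symmetric]) auto
    finally show "(\<integral>\<^sup>+s. ?q t s \<partial>lborel) + (\<integral>\<^sup>+s. ?q t s \<partial>lborel) = ennreal ((a t)\<^sup>2) * (\<integral>\<^sup>+s. D t s \<partial>lborel)" .
  qed
  finally show ?thesis .
qed

text \<open>A bias-variance bound for estimators that are linear in a process with mean \<open>H\<close> and covariance \<open>D\<close>.
The elementary inequality \<open>|x + y|\<^sup>2 \<le> 2 |x|\<^sup>2 + 2 |y|\<^sup>2\<close> replaces the exact decomposition and costs a factor
\<open>2\<close>.\<close>

lemma (in prob_space) mean_square_linear_functional: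
  fixes l :: "real \<Rightarrow> complex" and X :: "real \<Rightarrow> 'a \<Rightarrow> real" and H :: "real \<Rightarrow> real" and D :: "real \<Rightarrow> real \<Rightarrow> real"
  assumes l [measurable]: "l \<in> borel_measurable borel"
    and X [measurable]: "(\<lambda>x. X (fst x) (snd x)) \<in> borel_measurable (borel \<Otimes>\<^sub>M M)"
    and H [measurable]: "H \<in> borel_measurable borel"
    and nn: "AE w in M. \<forall>t. 0 \<le> X t w" "\<And>t. 0 \<le> H t" "\<And>t s. 0 \<le> D t s"
    and m1: "\<And>t. (\<integral>\<^sup>+w. ennreal (X t w) \<partial>M) = ennreal (H t)"
    and m2: "\<And>t s. (\<integral>\<^sup>+w. ennreal (X t w * X s w) \<partial>M) = ennreal (H t * H s + D t s)"
    and f1: "(\<integral>\<^sup>+t. ennreal (cmod (l t) * H t) \<partial>lborel) < \<infinity>"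
    and f2: "(\<integral>\<^sup>+t. \<integral>\<^sup>+s. ennreal (cmod (l t) * cmod (l s) * D t s) \<partial>lborel \<partial>lborel) < \<infinity>"
  shows "AE w in M. integrable lborel (\<lambda>t. l t * of_real (X t w))"
    and "(\<integral>\<^sup>+w. ennreal ((cmod (b - (LINT t|lborel. l t * of_real (X t w))))\<^sup>2) \<partial>M)
      \<le> 2 * ennreal ((cmod (b - (LINT t|lborel. l t * of_real (H t))))\<^sup>2)
        + 2 * (\<integral>\<^sup>+t. \<integral>\<^sup>+s. ennreal (cmod (l t) * cmod (l s) * D t s) \<partial>lborel \<partial>lborel)"
proof -
  have X' [measurable]: "X t \<in> borel_measurable M" for t
    using measurable_compose[OF measurable_Pair1' X, of t] by simp
  have lH: "integrable lborel (\<lambda>t. l t * of_real (H t))"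
    by (rule integrableI_bounded) (use f1 nn(2) in \<open>simp_all add: norm_mult\<close>)
  interpret LM: pair_sigma_finite lborel M ..
  have iX: "integrable (lborel \<Otimes>\<^sub>M M) (\<lambda>x. l (fst x) * of_real (X (fst x) (snd x)))"
  proof (rule integrableI_bounded)
    have "(\<integral>\<^sup>+x. ennreal (norm (l (fst x) * of_real (X (fst x) (snd x)))) \<partial>(lborel \<Otimes>\<^sub>M M))
        = (\<integral>\<^sup>+t. \<integral>\<^sup>+w. ennreal (cmod (l t)) * ennreal \<bar>X t w\<bar> \<partial>M \<partial>lborel)"
      by (subst nn_integral_fst[symmetric]) (simp_all add: norm_mult ennreal_mult)
    also have "\<dots> = (\<integral>\<^sup>+t. ennreal (cmod (l t)) * (\<integral>\<^sup>+w. ennreal \<bar>X t w\<bar> \<partial>M) \<partial>lborel)"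
      by (simp add: nn_integral_cmult)
    also have "(\<lambda>t. (\<integral>\<^sup>+w. ennreal \<bar>X t w\<bar> \<partial>M)) = (\<lambda>t. \<integral>\<^sup>+w. ennreal (X t w) \<partial>M)"
      by (intro ext nn_integral_cong_AE) (use nn(1) in \<open>eventually_elim, simp\<close>)
    finally show "(\<integral>\<^sup>+x. ennreal (norm (l (fst x) * of_real (X (fst x) (snd x)))) \<partial>(lborel \<Otimes>\<^sub>M M)) < \<infinity>"
      using f1 by (simp add: m1 ennreal_mult nn)
  qed measurable
  then have iXw: "AE w in M. integrable lborel (\<lambda>t. l t * of_real (X t w))"
    using LM.AE_integrable_snd[of "\<lambda>x y. l x * of_real (X x y)"] by (simp add: case_prod_unfold)
  then show "AE w in M. integrable lborel (\<lambda>t. l t * of_real (X t w))" .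
  define Z where "Z t w = X t w - H t" for t w
  have Zm [measurable]: "Z t \<in> borel_measurable M" for t
    unfolding Z_def by measurable
  have EX: "has_bochner_integral M (X t) (H t)" for t
    by (rule has_bochner_integral_nn_integral) (use nn m1 in auto)
  have EXX: "has_bochner_integral M (\<lambda>w. X t w * X s w) (H t * H s + D t s)" for t s
    by (rule has_bochner_integral_nn_integral) (use nn m2 in auto)
  have const: "has_bochner_integral M (\<lambda>_. c) c" for c :: real
    using has_bochner_integral_integrable[OF integrable_const, of c] by (simp add: prob_space)
  have EZZ: "has_bochner_integral M (\<lambda>w. Z t w * Z s w) (D t s)" for t s
  proof -
    have "has_bochner_integral M (\<lambda>w. (X t w * X s w - X t w * H s) - (H t * X s w - H t * H s))
       ((H t * H s + D t s - H t * H s) - (H t * H s - H t * H s))"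
      by (intro has_bochner_integral_diff EXX has_bochner_integral_mult_left has_bochner_integral_mult_right EX const)
    then show ?thesis by (simp add: Z_def algebra_simps)
  qed
  have Zabs: "(\<integral>\<^sup>+w. ennreal \<bar>Z t w * Z s w\<bar> \<partial>M) \<le> ennreal (4 * (H t * H s) + D t s)" for t s
  proof -
    have "(\<integral>\<^sup>+w. ennreal \<bar>Z t w * Z s w\<bar> \<partial>M)
       \<le> (\<integral>\<^sup>+w. ennreal (X t w * X s w + X t w * H s + (H t * X s w + H t * H s)) \<partial>M)"
    proof (rule nn_integral_mono_AE)
      show "AE w in M. ennreal \<bar>Z t w * Z s w\<bar> \<le> ennreal (X t w * X s w + X t w * H s + (H t * X s w + H t * H s))"
        using nn(1)
      proof eventually_elim
        case (elim w)
        have "\<bar>Z t w * Z s w\<bar> \<le> (X t w + H t) * (X s w + H s)"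
          unfolding abs_mult Z_def using elim nn(2)
          by (intro mult_mono) (auto simp: abs_le_iff add_increasing2 add_increasing)
        then show ?case by (intro ennreal_leI) (simp add: algebra_simps)
      qed
    qed
    also have "\<dots> = ennreal ((H t * H s + D t s) + H t * H s + (H t * H s + H t * H s))"
    proof (rule nn_integral_eq_integral[THEN trans])
      have b: "has_bochner_integral M (\<lambda>w. X t w * X s w + X t w * H s + (H t * X s w + H t * H s))
         ((H t * H s + D t s) + H t * H s + (H t * H s + H t * H s))"
        by (intro has_bochner_integral_add EXX has_bochner_integral_mult_left has_bochner_integral_mult_right EX const)
      then show "integrable M (\<lambda>w. X t w * X s w + X t w * H s + (H t * X s w + H t * H s))"
        by (rule integrable.intros)
      show "ennreal (LINT w|M. X t w * X s w + X t w * H s + (H t * X s w + H t * H s))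
        = ennreal ((H t * H s + D t s) + H t * H s + (H t * H s + H t * H s))"
        using has_bochner_integral_integral_eq[OF b] by simp
      show "AE w in M. 0 \<le> X t w * X s w + X t w * H s + (H t * X s w + H t * H s)"
        using nn(1) by eventually_elim (use nn(2) in auto)
    qed
    finally show ?thesis by (simp add: algebra_simps)
  qed
  have [measurable]: "(\<lambda>x. X (fst (fst x)) (snd x)) \<in> borel_measurable ((borel \<Otimes>\<^sub>M borel) \<Otimes>\<^sub>M M)"
    "(\<lambda>x. X (snd (fst x)) (snd x)) \<in> borel_measurable ((borel \<Otimes>\<^sub>M borel) \<Otimes>\<^sub>M M)"
    using measurable_compose[OF _ X, of "\<lambda>x. (fst (fst x), snd x)" "(borel \<Otimes>\<^sub>M borel) \<Otimes>\<^sub>M M"]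
      measurable_compose[OF _ X, of "\<lambda>x. (snd (fst x), snd x)" "(borel \<Otimes>\<^sub>M borel) \<Otimes>\<^sub>M M"] by simp_all
  have Dm [measurable]: "(\<lambda>x. D (fst x) (snd x)) \<in> borel_measurable (lborel \<Otimes>\<^sub>M lborel)"
  proof -
    have "D t s = enn2real (\<integral>\<^sup>+w. ennreal (X t w * X s w) \<partial>M) - H t * H s" for t s
      using nn(2,3) by (simp add: m2 del: ennreal_plus)
    then have "(\<lambda>x. D (fst x) (snd x)) = (\<lambda>x. enn2real (\<integral>\<^sup>+w. ennreal (X (fst x) w * X (snd x) w) \<partial>M) - H (fst x) * H (snd x))"
      by simp
    moreover have "(\<lambda>x. enn2real (\<integral>\<^sup>+w. ennreal (X (fst x) w * X (snd x) w) \<partial>M) - H (fst x) * H (snd x)) \<in> borel_measurable (lborel \<Otimes>\<^sub>M lborel)"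
      by measurable
    ultimately show ?thesis by simp
  qed
  have [measurable]: "D t \<in> borel_measurable borel" for t
    using measurable_compose[OF measurable_Pair1' Dm, of t] by simp
  let ?L = "\<integral>\<^sup>+t. \<integral>\<^sup>+s. ennreal (cmod (l t) * cmod (l s) * D t s) \<partial>lborel \<partial>lborel"
  define V where "V w = (LINT t|lborel. l t * of_real (Z t w))" for w
  have EV: "(\<integral>\<^sup>+w. ennreal ((cmod (V w))\<^sup>2) \<partial>M) \<le> ?L"
  proof -
    let ?a = "\<lambda>t. ennreal (cmod (l t) * H t)"
    have "(\<integral>\<^sup>+t. \<integral>\<^sup>+s. ennreal (cmod (l t) * cmod (l s)) * ennreal (4 * (H t * H s) + D t s) \<partial>lborel \<partial>lborel)
        = (\<integral>\<^sup>+t. \<integral>\<^sup>+s. 4 * ?a t * ?a s + ennreal (cmod (l t) * cmod (l s) * D t s) \<partial>lborel \<partial>lborel)"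
    proof (intro nn_integral_cong)
      fix t s
      have "ennreal (cmod (l t) * cmod (l s)) * ennreal (4 * (H t * H s) + D t s)
          = ennreal (4 * ((cmod (l t) * H t) * (cmod (l s) * H s)) + cmod (l t) * cmod (l s) * D t s)"
        by (subst ennreal_mult'[symmetric]) (simp_all add: algebra_simps)
      then show "ennreal (cmod (l t) * cmod (l s)) * ennreal (4 * (H t * H s) + D t s)
          = 4 * ?a t * ?a s + ennreal (cmod (l t) * cmod (l s) * D t s)"
        using nn by (simp add: ennreal_mult'' ennreal_mult mult.assoc)
    qed
    also have "\<dots> = (\<integral>\<^sup>+t. \<integral>\<^sup>+s. 4 * ?a t * ?a s \<partial>lborel \<partial>lborel) + ?L"
      by (subst nn_integral_add[symmetric], measurable) (intro nn_integral_cong nn_integral_add, measurable)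
    also have "\<dots> = 4 * (\<integral>\<^sup>+t. ?a t \<partial>lborel) * (\<integral>\<^sup>+t. ?a t \<partial>lborel) + ?L"
      by (subst nn_integral_times) (simp_all add: nn_integral_cmult)
    also have "\<dots> < \<infinity>" using f1 f2 by (simp add: ennreal_mult_less_top)
    finally have fin: "(\<integral>\<^sup>+t. \<integral>\<^sup>+s. ennreal (cmod (l t) * cmod (l s)) * ennreal (4 * (H t * H s) + D t s) \<partial>lborel \<partial>lborel) < \<infinity>" .
    have "(\<integral>\<^sup>+w. ennreal ((cmod (V w))\<^sup>2) \<partial>M)
        \<le> (\<integral>\<^sup>+t. \<integral>\<^sup>+s. ennreal (cmod (l t) * cmod (l s)) * ennreal (cmod (of_real (D t s))) \<partial>lborel \<partial>lborel)"
      unfolding V_def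
    proof (rule square_linear_functional_le[OF l _ _ fin])
      show "(\<lambda>x. complex_of_real (Z (fst x) (snd x))) \<in> borel_measurable (borel \<Otimes>\<^sub>M M)"
        unfolding Z_def by measurable
      show "(\<integral>\<^sup>+w. ennreal (cmod (of_real (Z t w)) * cmod (of_real (Z s w))) \<partial>M) \<le> ennreal (4 * (H t * H s) + D t s)" for t s
        using Zabs[of t s] by (simp add: abs_mult)
      show "(LINT w|M. of_real (Z t w) * cnj (of_real (Z s w))) = complex_of_real (D t s)" for t s
        using has_bochner_integral_integral_eq[OF EZZ[of t s]]
        by (simp only: complex_cnj_complex_of_real of_real_mult[symmetric] integral_complex_of_real)
    qed
    also have "\<dots> = ?L" using nn(3) by (simp add: ennreal_mult')
    finally show ?thesis .
  qed
  let ?B = "b - (LINT t|lborel. l t * of_real (H t))"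
  have [measurable]: "V \<in> borel_measurable M"
  proof -
    have "(\<lambda>x. l (snd x) * of_real (X (snd x) (fst x) - H (snd x))) \<in> borel_measurable (M \<Otimes>\<^sub>M lborel)"
      using measurable_compose[OF _ X, of "\<lambda>x. (snd x, fst x)" "M \<Otimes>\<^sub>M lborel"] by simp
    then show ?thesis unfolding V_def Z_def
      by (intro lborel.borel_measurable_lebesgue_integral) (simp add: case_prod_unfold)
  qed
  have "(\<integral>\<^sup>+w. ennreal ((cmod (b - (LINT t|lborel. l t * of_real (X t w))))\<^sup>2) \<partial>M)
      \<le> (\<integral>\<^sup>+w. 2 * ennreal ((cmod ?B)\<^sup>2) + 2 * ennreal ((cmod (V w))\<^sup>2) \<partial>M)"
  proof (rule nn_integral_mono_AE)
    show "AE w in M. ennreal ((cmod (b - (LINT t|lborel. l t * of_real (X t w))))\<^sup>2)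
        \<le> 2 * ennreal ((cmod ?B)\<^sup>2) + 2 * ennreal ((cmod (V w))\<^sup>2)"
      using iXw
    proof eventually_elim
      case (elim w)
      have "V w = (LINT t|lborel. l t * of_real (X t w)) - (LINT t|lborel. l t * of_real (H t))"
        unfolding V_def Z_def
        by (subst Bochner_Integration.integral_diff[OF elim lH, symmetric]) (simp add: algebra_simps)
      then have bV: "b - (LINT t|lborel. l t * of_real (X t w)) = ?B - V w" by simp
      have "(cmod (?B - V w))\<^sup>2 \<le> 2 * (cmod ?B)\<^sup>2 + 2 * (cmod (V w))\<^sup>2"
      proof -
        have "(cmod (?B - V w))\<^sup>2 \<le> (cmod ?B + cmod (V w))\<^sup>2"
          by (intro power_mono norm_triangle_ineq4) simp
        also have "\<dots> \<le> 2 * (cmod ?B)\<^sup>2 + 2 * (cmod (V w))\<^sup>2"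
          using sum_squares_bound[of "cmod ?B" "cmod (V w)"] by (simp add: power2_sum)
        finally show ?thesis .
      qed
      then have "ennreal ((cmod (b - (LINT t|lborel. l t * of_real (X t w))))\<^sup>2)
          \<le> ennreal (2 * (cmod ?B)\<^sup>2 + 2 * (cmod (V w))\<^sup>2)"
        unfolding bV by (intro ennreal_leI)
      then show ?case by (simp add: ennreal_mult')
    qed
  qed
  also have "\<dots> = 2 * ennreal ((cmod ?B)\<^sup>2) + 2 * (\<integral>\<^sup>+w. ennreal ((cmod (V w))\<^sup>2) \<partial>M)"
    by (subst nn_integral_add) (auto simp: nn_integral_cmult emeasure_space_1)
  also have "\<dots> \<le> 2 * ennreal ((cmod ?B)\<^sup>2)
      + 2 * (\<integral>\<^sup>+t. \<integral>\<^sup>+s. ennreal (cmod (l t) * cmod (l s) * D t s) \<partial>lborel \<partial>lborel)"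
    using EV by (intro add_left_mono mult_left_mono) auto
  finally show "(\<integral>\<^sup>+w. ennreal ((cmod (b - (LINT t|lborel. l t * of_real (X t w))))\<^sup>2) \<partial>M)
      \<le> 2 * ennreal ((cmod ?B)\<^sup>2)
        + 2 * (\<integral>\<^sup>+t. \<integral>\<^sup>+s. ennreal (cmod (l t) * cmod (l s) * D t s) \<partial>lborel \<partial>lborel)" .
qed


text \<open>The characteristic function of the standard normal law, rescaled.\<close>

lemma gaussian_fourier:
  assumes e: "0 < e"
  shows "has_bochner_integral lborel (\<lambda>w. exp (\<i> * of_real (w * t)) * of_real (exp (- e * w\<^sup>2)))
    (of_real (sqrt (pi / e) * exp (- t\<^sup>2 / (4 * e))))"
proof -
  define c where "c = 1 / sqrt (2 * e)"
  have c: "0 < c" "c\<^sup>2 = 1 / (2 * e)" using e by (auto simp: c_def power_divide)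
  have ch: "char std_normal_distribution (c * t) = of_real (exp (- t\<^sup>2 / (4 * e)))"
    by (simp add: char_std_normal_distribution power_mult_distrib c)
  have int: "integrable lborel (\<lambda>x. std_normal_density x *\<^sub>R exp (\<i> * of_real (c * t) * of_real x) :: complex)"
    by (rule Bochner_Integration.integrable_bound[OF integrable_normal_density[of 1 0]]) (auto simp: norm_mult)
  have "char std_normal_distribution (c * t) = (LINT x|lborel. std_normal_density x *\<^sub>R exp (\<i> * of_real (c * t) * of_real x))"
    unfolding char_def by (subst integral_density) (auto simp: normal_density_nonneg mult_ac)
  with int have "has_bochner_integral lborel (\<lambda>x. std_normal_density x *\<^sub>R exp (\<i> * of_real (c * t) * of_real x) :: complex)
      (of_real (exp (- t\<^sup>2 / (4 * e))))"
    by (metis ch has_bochner_integral_integrable)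
  then have "has_bochner_integral lborel
      (\<lambda>w. std_normal_density (0 + (1 / c) * w) *\<^sub>R exp (\<i> * of_real (c * t) * of_real (0 + (1 / c) * w)) :: complex)
      (of_real (exp (- t\<^sup>2 / (4 * e))) /\<^sub>R \<bar>1 / c\<bar>)"
    by (rule lborel_has_bochner_integral_real_affine_iff[THEN iffD1, rotated]) (use c in simp)
  then have "has_bochner_integral lborel
      (\<lambda>w. of_real (sqrt (2 * pi)) * (std_normal_density (0 + (1 / c) * w) *\<^sub>R exp (\<i> * of_real (c * t) * of_real (0 + (1 / c) * w)) :: complex))
      (of_real (sqrt (2 * pi)) * (of_real (exp (- t\<^sup>2 / (4 * e))) /\<^sub>R \<bar>1 / c\<bar>))"
    by (rule has_bochner_integral_mult_right)
  moreover have "of_real (sqrt (2 * pi)) * (std_normal_density (0 + (1 / c) * w) *\<^sub>R exp (\<i> * of_real (c * t) * of_real (0 + (1 / c) * w)))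
      = exp (\<i> * of_real (w * t)) * of_real (exp (- e * w\<^sup>2))" for w
  proof -
    have "sqrt (2 * pi) * std_normal_density (0 + (1 / c) * w) = exp (- e * w\<^sup>2)"
      using e c by (simp add: std_normal_density_def power_divide)
    moreover have "(\<i> * of_real (c * t) * of_real (0 + (1 / c) * w)) = \<i> * of_real (w * t)"
      using c by simp
    ultimately show ?thesis by (simp add: scaleR_conv_of_real flip: of_real_mult)
  qed
  moreover have "of_real (sqrt (2 * pi)) * (of_real (exp (- t\<^sup>2 / (4 * e))) /\<^sub>R \<bar>1 / c\<bar>)
      = complex_of_real (sqrt (pi / e) * exp (- t\<^sup>2 / (4 * e)))"
  proof -
    have "sqrt (2 * pi) * c = sqrt (pi / e)"
      using e by (simp add: c_def real_sqrt_mult real_sqrt_divide)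
    then show ?thesis using c
      by (simp add: scaleR_conv_of_real flip: of_real_mult of_real_inverse)
  qed
  ultimately show ?thesis by simp
qed

lemma gaussian_integral:
  assumes e: "0 < e"
  shows "integrable lborel (\<lambda>w::real. exp (- e * w\<^sup>2))" and "(LINT w|lborel. exp (- e * w\<^sup>2)) = sqrt (pi / e)"
proof -
  have h: "has_bochner_integral lborel (\<lambda>w. complex_of_real (exp (- e * w\<^sup>2))) (of_real (sqrt (pi / e)))"
    using gaussian_fourier[OF e, of 0] by simp
  from has_bochner_integral_Re[OF this]
  show "integrable lborel (\<lambda>w::real. exp (- e * w\<^sup>2))" "(LINT w|lborel. exp (- e * w\<^sup>2)) = sqrt (pi / e)"
    by (auto simp: has_bochner_integral_iff)
qed

text \<open>With the weight \<open>exp (- e t\<^sup>2)\<close> the integral becomes a quadratic form in \<open>F\<close> whose kernel is Gaussian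
with row integrals \<open>2 \<pi>\<close>, so the Schur test gives the bound for every \<open>e > 0\<close>. Fatou's lemma then lets
\<open>e\<close> tend to \<open>0\<close>.\<close>

lemma plancherel_le:
  fixes F :: "real \<Rightarrow> complex"
  assumes F: "integrable lborel F" and F2: "integrable lborel (\<lambda>w. (cmod (F w))\<^sup>2)"
  shows "(\<integral>\<^sup>+t. ennreal ((cmod (LINT w|lborel. F w * exp (\<i> * of_real (w * t))))\<^sup>2) \<partial>lborel)
    \<le> ennreal (2 * pi * (LINT w|lborel. (cmod (F w))\<^sup>2))"
proof -
  have Fm [measurable]: "F \<in> borel_measurable borel" using F by simp
  define g where "g t = (LINT w|lborel. F w * exp (\<i> * of_real (w * t)))" for t
  have gm [measurable]: "g \<in> borel_measurable borel"
  proof -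
    have "(\<lambda>x. F (snd x) * exp (\<i> * of_real (snd x * fst x))) \<in> borel_measurable (borel \<Otimes>\<^sub>M lborel)"
      by measurable
    then show ?thesis unfolding g_def
      by (intro lborel.borel_measurable_lebesgue_integral) (simp add: case_prod_unfold)
  qed
  have bound: "(\<integral>\<^sup>+t. ennreal ((cmod (g t))\<^sup>2 * exp (- e * t\<^sup>2)) \<partial>lborel) \<le> ennreal (2 * pi * (LINT w|lborel. (cmod (F w))\<^sup>2))"
    if e: "0 < e" for e
  proof -
    define E where "E t = exp (- e * t\<^sup>2 / 2)" for t :: real
    have E2: "E t * E t = exp (- e * t\<^sup>2)" for t
      by (simp add: E_def exp_add[symmetric])
    define Z where "Z w t = exp (\<i> * of_real (w * t)) * of_real (E t)" for w t
    define D where "D w v = sqrt (pi / e) * exp (- (w - v)\<^sup>2 / (4 * e))" for w v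
    have nZ: "cmod (Z w t) = E t" for w t
      unfolding Z_def by (simp add: norm_mult E_def)
    have "(cmod (g t))\<^sup>2 * exp (- e * t\<^sup>2) = (cmod (LINT w|lborel. F w * Z w t))\<^sup>2" for t
    proof -
      have "(LINT w|lborel. F w * Z w t) = g t * of_real (E t)"
        unfolding Z_def g_def mult.assoc[symmetric] by (rule integral_mult_left_zero)
      then show ?thesis
        by (simp add: norm_mult power_mult_distrib power2_eq_square[of "E t"] E2)
    qed
    then have "(\<integral>\<^sup>+t. ennreal ((cmod (g t))\<^sup>2 * exp (- e * t\<^sup>2)) \<partial>lborel)
        = (\<integral>\<^sup>+t. ennreal ((cmod (LINT w|lborel. F w * Z w t))\<^sup>2) \<partial>lborel)" by simp
    also have "\<dots> \<le> (\<integral>\<^sup>+w. \<integral>\<^sup>+v. ennreal (cmod (F w) * cmod (F v)) * ennreal (cmod (of_real (D w v))) \<partial>lborel \<partial>lborel)"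
    proof (rule lborel.square_linear_functional_le)
      show "(\<lambda>x. Z (fst x) (snd x)) \<in> borel_measurable (borel \<Otimes>\<^sub>M lborel)"
        unfolding Z_def E_def by measurable
      show "(\<integral>\<^sup>+t. ennreal (cmod (Z w t) * cmod (Z v t)) \<partial>lborel) \<le> ennreal (sqrt (pi / e))" for w v
        unfolding nZ E2 using gaussian_integral[OF e] by (subst nn_integral_eq_integral) simp_all
      have "(\<integral>\<^sup>+w. \<integral>\<^sup>+v. ennreal (cmod (F w) * cmod (F v)) * ennreal (sqrt (pi / e)) \<partial>lborel \<partial>lborel)
          = (\<integral>\<^sup>+w. \<integral>\<^sup>+v. ennreal (cmod (F w)) * (ennreal (cmod (F v)) * ennreal (sqrt (pi / e))) \<partial>lborel \<partial>lborel)"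
        by (simp add: ennreal_mult mult.assoc)
      also have "\<dots> = (\<integral>\<^sup>+w. ennreal (cmod (F w)) \<partial>lborel) * ((\<integral>\<^sup>+w. ennreal (cmod (F w)) \<partial>lborel) * ennreal (sqrt (pi / e)))"
        by (subst nn_integral_times) (simp_all add: nn_integral_multc)
      also have "\<dots> < \<infinity>" using F by (auto simp: integrable_iff_bounded ennreal_mult_less_top)
      finally show "(\<integral>\<^sup>+w. \<integral>\<^sup>+v. ennreal (cmod (F w) * cmod (F v)) * ennreal (sqrt (pi / e)) \<partial>lborel \<partial>lborel) < \<infinity>" .
      show "(LINT t|lborel. Z w t * cnj (Z v t)) = of_real (D w v)" for w v
      proof -
        have "Z w t * cnj (Z v t) = exp (\<i> * of_real (t * (w - v))) * of_real (exp (- e * t\<^sup>2))" for t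
        proof -
          have "exp (\<i> * of_real (w * t)) * cnj (exp (\<i> * of_real (v * t))) = exp (\<i> * of_real (t * (w - v)))"
            by (simp add: exp_cnj flip: exp_add) (simp add: algebra_simps)
          moreover have "complex_of_real (E t) * of_real (E t) = of_real (exp (- e * t\<^sup>2))"
            by (simp only: of_real_mult[symmetric] E2)
          ultimately show ?thesis unfolding Z_def complex_cnj_mult complex_cnj_complex_of_real by (metis mult.assoc mult.left_commute)
        qed
        then show ?thesis
          by (simp only: has_bochner_integral_integral_eq[OF gaussian_fourier[OF e]] D_def)
      qed
    qed measurable
    also have "\<dots> \<le> (\<integral>\<^sup>+w. ennreal ((cmod (F w))\<^sup>2) * (\<integral>\<^sup>+v. ennreal (cmod (of_real (D w v))) \<partial>lborel) \<partial>lborel)"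
      by (rule schur_symmetric) (simp_all add: D_def power2_commute)
    also have "\<dots> = (\<integral>\<^sup>+w. ennreal ((cmod (F w))\<^sup>2) * ennreal (2 * pi) \<partial>lborel)"
    proof (intro nn_integral_cong arg_cong2[where f = times] refl)
      fix w
      have "(\<integral>\<^sup>+v. ennreal (cmod (of_real (D w v))) \<partial>lborel) = (\<integral>\<^sup>+v. ennreal (sqrt (pi / e)) * ennreal (exp (- (1 / (4 * e)) * (w - v)\<^sup>2)) \<partial>lborel)"
        unfolding norm_of_real D_def using e by (simp add: ennreal_mult abs_mult)
      also have "\<dots> = (\<integral>\<^sup>+v. ennreal (sqrt (pi / e)) * ennreal (exp (- (1 / (4 * e)) * v\<^sup>2)) \<partial>lborel)"
        by (subst nn_integral_real_affine[of _ "-1" w]) simp_all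
      also have "\<dots> = ennreal (sqrt (pi / e)) * ennreal (sqrt (pi / (1 / (4 * e))))"
        using gaussian_integral[of "1 / (4 * e)"] e
        by (subst nn_integral_cmult) (simp_all add: nn_integral_eq_integral)
      also have "\<dots> = ennreal (sqrt ((2 * pi)\<^sup>2))"
        using e by (subst ennreal_mult[symmetric]) (simp_all add: power2_eq_square flip: real_sqrt_mult)
      also have "\<dots> = ennreal (2 * pi)" unfolding real_sqrt_abs by simp
      finally show "(\<integral>\<^sup>+v. ennreal (cmod (of_real (D w v))) \<partial>lborel) = ennreal (2 * pi)" .
    qed
    also have "\<dots> = ennreal (LINT w|lborel. (cmod (F w))\<^sup>2) * ennreal (2 * pi)"
      using F2 by (subst nn_integral_multc) (simp_all add: nn_integral_eq_integral)
    also have "\<dots> = ennreal (2 * pi * (LINT w|lborel. (cmod (F w))\<^sup>2))"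
      by (subst ennreal_mult'[symmetric]) (simp_all add: mult.commute)
    finally show ?thesis .
  qed
  let ?f = "\<lambda>n t. ennreal ((cmod (g t))\<^sup>2 * exp (- (1 / real (Suc n)) * t\<^sup>2))"
  have lim: "(\<lambda>n. ?f n t) \<longlonglongrightarrow> ennreal ((cmod (g t))\<^sup>2)" for t
  proof (intro tendsto_ennrealI)
    have "(\<lambda>n. (cmod (g t))\<^sup>2 * exp (- (1 / real (Suc n)) * t\<^sup>2)) \<longlonglongrightarrow> (cmod (g t))\<^sup>2 * exp (- 0 * t\<^sup>2)"
      by (intro tendsto_intros LIMSEQ_Suc[OF lim_1_over_n])
    then show "(\<lambda>n. (cmod (g t))\<^sup>2 * exp (- (1 / real (Suc n)) * t\<^sup>2)) \<longlonglongrightarrow> (cmod (g t))\<^sup>2" by simp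
  qed
  have "(\<integral>\<^sup>+t. ennreal ((cmod (g t))\<^sup>2) \<partial>lborel) = (\<integral>\<^sup>+t. liminf (\<lambda>n. ?f n t) \<partial>lborel)"
    by (intro nn_integral_cong) (simp only: lim_imp_Liminf[OF trivial_limit_sequentially lim])
  also have "\<dots> \<le> liminf (\<lambda>n. \<integral>\<^sup>+t. ?f n t \<partial>lborel)"
    by (rule nn_integral_liminf) measurable
  also have "\<dots> \<le> liminf (\<lambda>n. ennreal (2 * pi * (LINT w|lborel. (cmod (F w))\<^sup>2)))"
    by (intro Liminf_mono always_eventually allI bound) simp
  also have "\<dots> = ennreal (2 * pi * (LINT w|lborel. (cmod (F w))\<^sup>2))" by (simp add: Liminf_const)
  finally show ?thesis unfolding g_def .
qed

section \<open>Fourier inversion\<close>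

text \<open>Inserting the factor \<open>exp (- e w\<^sup>2)\<close> turns the left-hand side into a convolution of \<open>f\<close> with a Gaussian of
variance \<open>2 e\<close>. As \<open>e\<close> tends to \<open>0\<close>, dominated convergence applies on both sides.\<close>

lemma fourier_inversion:
  fixes f :: "real \<Rightarrow> complex"
  assumes f: "integrable lborel f" and cont: "continuous_on UNIV f" and B: "\<And>t. cmod (f t) \<le> B"
    and F: "integrable lborel (\<lambda>w. LINT t|lborel. f t * exp (- \<i> * of_real (w * t)))"
  shows "(LINT w|lborel. (LINT t|lborel. f t * exp (- \<i> * of_real (w * t))) * exp (\<i> * of_real (w * y)))
    = 2 * pi * f y"
proof -
  have [measurable]: "f \<in> borel_measurable borel" using f by simp
  define F where "F w = (LINT t|lborel. f t * exp (- \<i> * of_real (w * t)))" for w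
  have Fi: "integrable lborel F" using F unfolding F_def .
  then have [measurable]: "F \<in> borel_measurable borel" by simp
  define e where "e n = 1 / real (Suc n)" for n
  have e: "0 < e n" for n by (simp add: e_def)
  have e0: "e \<longlonglongrightarrow> 0" unfolding e_def using LIMSEQ_Suc[OF lim_1_over_n] by simp
  have smooth: "(LINT w|lborel. F w * exp (\<i> * of_real (w * y)) * of_real (exp (- e n * w\<^sup>2)))
      = (LINT u|lborel. of_real (2 * sqrt pi * exp (- u\<^sup>2)) * f (y + 2 * sqrt (e n) * u))" for n
  proof -
    define q where "q t w = f t * (exp (\<i> * of_real (w * (y - t))) * of_real (exp (- e n * w\<^sup>2)))" for t w
    have [measurable]: "(\<lambda>x. q (fst x) (snd x)) \<in> borel_measurable (lborel \<Otimes>\<^sub>M lborel)"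
      unfolding q_def by measurable
    have iq: "integrable (lborel \<Otimes>\<^sub>M lborel) (\<lambda>x. q (fst x) (snd x))"
    proof (rule integrableI_bounded)
      have "(\<integral>\<^sup>+x. ennreal (norm (q (fst x) (snd x))) \<partial>(lborel \<Otimes>\<^sub>M lborel))
          = (\<integral>\<^sup>+t. \<integral>\<^sup>+w. ennreal (cmod (f t)) * ennreal (exp (- e n * w\<^sup>2)) \<partial>lborel \<partial>lborel)"
        by (subst lborel.nn_integral_fst[symmetric], measurable)
          (simp add: q_def norm_mult ennreal_mult)
      also have "\<dots> = (\<integral>\<^sup>+t. ennreal (cmod (f t)) \<partial>lborel) * (\<integral>\<^sup>+w. ennreal (exp (- e n * w\<^sup>2)) \<partial>lborel)"
        by (simp add: nn_integral_cmult nn_integral_multc)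
      also have "\<dots> < \<infinity>"
        using f gaussian_integral(1)[OF e[of n]] by (auto simp: integrable_iff_bounded ennreal_mult_less_top)
      finally show "(\<integral>\<^sup>+x. ennreal (norm (q (fst x) (snd x))) \<partial>(lborel \<Otimes>\<^sub>M lborel)) < \<infinity>" .
    qed measurable
    have "(LINT w|lborel. F w * exp (\<i> * of_real (w * y)) * of_real (exp (- e n * w\<^sup>2)))
        = (LINT w|lborel. LINT t|lborel. q t w)"
    proof (intro Bochner_Integration.integral_cong refl)
      fix w
      have "q t w = f t * exp (- \<i> * of_real (w * t)) * exp (\<i> * of_real (w * y)) * of_real (exp (- e n * w\<^sup>2))" for t
      proof -
        have "exp (\<i> * of_real (w * (y - t))) = exp (- \<i> * of_real (w * t)) * exp (\<i> * of_real (w * y))"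
          by (subst exp_add[symmetric]) (simp add: algebra_simps)
        then show ?thesis by (simp add: q_def)
      qed
      then show "F w * exp (\<i> * of_real (w * y)) * of_real (exp (- e n * w\<^sup>2)) = (LINT t|lborel. q t w)"
        by (simp only: F_def integral_mult_left_zero)
    qed
    also have "\<dots> = (LINT t|lborel. LINT w|lborel. q t w)"
      using lborel_pair.Fubini_integral[of q] iq by (simp add: case_prod_unfold)
    also have "\<dots> = (LINT t|lborel. f t * of_real (sqrt (pi / e n) * exp (- (y - t)\<^sup>2 / (4 * e n))))"
      unfolding q_def
      by (intro Bochner_Integration.integral_cong refl)
        (simp only: integral_mult_right_zero has_bochner_integral_integral_eq[OF gaussian_fourier[OF e]])
    also have "\<dots> = \<bar>2 * sqrt (e n)\<bar> *\<^sub>R (LINT u|lborel. f (y + 2 * sqrt (e n) * u)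
        * of_real (sqrt (pi / e n) * exp (- (y - (y + 2 * sqrt (e n) * u))\<^sup>2 / (4 * e n))))"
      using e[of n] by (rule_tac lborel_integral_real_affine) simp
    also have "\<dots> = (LINT u|lborel. \<bar>2 * sqrt (e n)\<bar> *\<^sub>R (f (y + 2 * sqrt (e n) * u)
        * of_real (sqrt (pi / e n) * exp (- (y - (y + 2 * sqrt (e n) * u))\<^sup>2 / (4 * e n)))))"
      by (rule integral_scaleR_right[symmetric])
    also have "\<dots> = (LINT u|lborel. of_real (2 * sqrt pi * exp (- u\<^sup>2)) * f (y + 2 * sqrt (e n) * u))"
    proof (intro Bochner_Integration.integral_cong refl)
      fix u
      have "(y - (y + 2 * sqrt (e n) * u))\<^sup>2 / (4 * e n) = u\<^sup>2"
        using e[of n] by (simp add: power_mult_distrib)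
      moreover have "\<bar>2 * sqrt (e n)\<bar> * sqrt (pi / e n) = 2 * sqrt pi"
        using e[of n] by (simp add: real_sqrt_divide)
      ultimately have E: "\<bar>2 * sqrt (e n)\<bar> * (sqrt (pi / e n) * exp (- (y - (y + 2 * sqrt (e n) * u))\<^sup>2 / (4 * e n))) = 2 * sqrt pi * exp (- u\<^sup>2)"
        by (simp add: mult.assoc[symmetric])
      show "\<bar>2 * sqrt (e n)\<bar> *\<^sub>R (f (y + 2 * sqrt (e n) * u)
        * of_real (sqrt (pi / e n) * exp (- (y - (y + 2 * sqrt (e n) * u))\<^sup>2 / (4 * e n))))
        = of_real (2 * sqrt pi * exp (- u\<^sup>2)) * f (y + 2 * sqrt (e n) * u)"
        unfolding E[symmetric] scaleR_conv_of_real of_real_mult by (simp only: mult_ac)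
    qed
    finally show ?thesis .
  qed
  have lim1: "(\<lambda>n. LINT w|lborel. F w * exp (\<i> * of_real (w * y)) * of_real (exp (- e n * w\<^sup>2)))
      \<longlonglongrightarrow> (LINT w|lborel. F w * exp (\<i> * of_real (w * y)))"
  proof (rule integral_dominated_convergence[where w = "\<lambda>w. cmod (F w)"])
    show "AE w in lborel. (\<lambda>n. F w * exp (\<i> * of_real (w * y)) * of_real (exp (- e n * w\<^sup>2))) \<longlonglongrightarrow> F w * exp (\<i> * of_real (w * y))"
    proof (rule AE_I2)
      fix w
      have "(\<lambda>n. F w * exp (\<i> * of_real (w * y)) * of_real (exp (- e n * w\<^sup>2))) \<longlonglongrightarrow> F w * exp (\<i> * of_real (w * y)) * of_real (exp (- 0 * w\<^sup>2))"
        by (intro tendsto_intros e0)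
      then show "(\<lambda>n. F w * exp (\<i> * of_real (w * y)) * of_real (exp (- e n * w\<^sup>2))) \<longlonglongrightarrow> F w * exp (\<i> * of_real (w * y))"
        by (simp only: minus_zero mult_zero_left exp_zero of_real_1 mult_1_right)
    qed
    show "AE w in lborel. norm (F w * exp (\<i> * of_real (w * y)) * of_real (exp (- e n * w\<^sup>2))) \<le> cmod (F w)" for n
    proof (rule AE_I2)
      fix w
      have "0 \<le> e n * w\<^sup>2" using e[of n] by (intro mult_nonneg_nonneg) auto
      then have "exp (- e n * w\<^sup>2) \<le> 1" by simp
      then have "cmod (F w) * exp (- e n * w\<^sup>2) \<le> cmod (F w)" by (rule mult_left_le) simp
      then show "norm (F w * exp (\<i> * of_real (w * y)) * of_real (exp (- e n * w\<^sup>2))) \<le> cmod (F w)"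
        by (simp only: norm_mult norm_exp_i_times norm_of_real abs_exp_cancel mult_1_right)
    qed
    show "integrable lborel (\<lambda>w. cmod (F w))"
      by (rule integrable_norm[OF Fi])
    show "(\<lambda>w. F w * exp (\<i> * of_real (w * y))) \<in> borel_measurable lborel"
      by measurable
    show "(\<lambda>w. F w * exp (\<i> * of_real (w * y)) * of_real (exp (- e n * w\<^sup>2))) \<in> borel_measurable lborel" for n
      by measurable
  qed
  have lim2: "(\<lambda>n. LINT u|lborel. of_real (2 * sqrt pi * exp (- u\<^sup>2)) * f (y + 2 * sqrt (e n) * u))
      \<longlonglongrightarrow> (LINT u|lborel. of_real (2 * sqrt pi * exp (- u\<^sup>2)) * f y)"
  proof (rule integral_dominated_convergence[where w = "\<lambda>u. 2 * sqrt pi * exp (- u\<^sup>2) * B"])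
    show "AE u in lborel. (\<lambda>n. of_real (2 * sqrt pi * exp (- u\<^sup>2)) * f (y + 2 * sqrt (e n) * u)) \<longlonglongrightarrow> of_real (2 * sqrt pi * exp (- u\<^sup>2)) * f y"
    proof (rule AE_I2)
      fix u
      have "(\<lambda>n. y + 2 * sqrt (e n) * u) \<longlonglongrightarrow> y + 2 * sqrt 0 * u"
        by (intro tendsto_intros e0)
      then have "(\<lambda>n. f (y + 2 * sqrt (e n) * u)) \<longlonglongrightarrow> f y"
        unfolding real_sqrt_zero mult_zero_right mult_zero_left add_0_right
        by (rule continuous_on_tendsto_compose[OF cont]) simp_all
      then show "(\<lambda>n. of_real (2 * sqrt pi * exp (- u\<^sup>2)) * f (y + 2 * sqrt (e n) * u)) \<longlonglongrightarrow> of_real (2 * sqrt pi * exp (- u\<^sup>2)) * f y"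
        by (rule tendsto_mult_left)
    qed
    show "integrable lborel (\<lambda>u. 2 * sqrt pi * exp (- u\<^sup>2) * B)"
      using gaussian_integral(1)[of 1] by simp
    show "AE u in lborel. norm (of_real (2 * sqrt pi * exp (- u\<^sup>2)) * f (y + 2 * sqrt (e n) * u)) \<le> 2 * sqrt pi * exp (- u\<^sup>2) * B" for n
      unfolding norm_mult norm_of_real by (intro AE_I2 mult_mono B) auto
    show "(\<lambda>u. of_real (2 * sqrt pi * exp (- u\<^sup>2)) * f y) \<in> borel_measurable lborel"
      by measurable
    show "(\<lambda>u. of_real (2 * sqrt pi * exp (- u\<^sup>2)) * f (y + 2 * sqrt (e n) * u)) \<in> borel_measurable lborel" for n
      by measurable
  qed
  have val: "(LINT u|lborel. of_real (2 * sqrt pi * exp (- u\<^sup>2)) * f y) = 2 * pi * f y"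
  proof -
    have "(LINT u|lborel. complex_of_real (2 * sqrt pi * exp (- u\<^sup>2)) * f y)
        = of_real (LINT u|lborel. 2 * sqrt pi * exp (- u\<^sup>2)) * f y"
      by (simp only: integral_mult_left_zero integral_complex_of_real)
    also have "(LINT u|lborel. 2 * sqrt pi * exp (- u\<^sup>2)) = 2 * pi"
      using gaussian_integral(2)[of 1] by simp
    finally show ?thesis by (simp only: of_real_mult of_real_numeral)
  qed
  show ?thesis
    unfolding F_def[symmetric] using LIMSEQ_unique[OF lim1 lim2[folded smooth]] unfolding val .
qed

lemma integrable_power_decay:
  fixes q :: real assumes q: "1 < q"
  shows "integrable lborel (\<lambda>v. (1 + v\<^sup>2) powr (- q / 2))"
proof -
  let ?f = "\<lambda>v::real. (1 + v\<^sup>2) powr (- q / 2)"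
  have nn: "0 \<le> v powr (- q)" for v :: real by simp
  have "(\<lambda>x::real. x powr (- q)) integrable_on {1..}"
    using has_integral_powr_to_inf[of "- q" 1] q by (auto simp: integrable_on_def)
  then have "(\<lambda>x::real. x powr (- q)) absolutely_integrable_on {1..}"
    by (intro nonnegative_absolutely_integrable_1) auto
  then have 1: "set_integrable lborel {1..} (\<lambda>x::real. x powr (- q))"
    unfolding set_integrable_def by (subst integrable_completion[symmetric]) auto
  have dom: "?f v \<le> v powr (- q)" if "1 \<le> v" for v
  proof -
    have "?f v \<le> (v\<^sup>2) powr (- q / 2)"
      using that q by (intro powr_mono2') auto
    also have "\<dots> = v powr (- q)"
      using that by (simp add: powr_powr flip: powr_numeral)
    finally show ?thesis .
  qed
  have 2: "set_integrable lborel {1..} ?f"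
    unfolding set_integrable_def
    by (rule Bochner_Integration.integrable_bound[OF 1[unfolded set_integrable_def]])
      (auto simp: indicator_def intro!: AE_I2 dom[simplified])
  have "set_integrable lborel {..-1} ?f"
    using lborel_integrable_real_affine[OF 2[unfolded set_integrable_def], of "-1" 0]
    unfolding set_integrable_def by (auto simp: indicator_def minus_le_iff cong: if_cong)
  moreover have "set_integrable lborel {-1..1} ?f"
    by (rule borel_integrable_atLeastAtMost')
      (auto intro!: continuous_intros simp: add_nonneg_eq_0_iff)
  ultimately have u: "set_integrable lborel (({..-1} \<union> {-1..1}) \<union> {1..}) ?f"
    using 2 by (intro set_integrable_Un) auto
  have un: "({..-1} \<union> {-1..1}) \<union> {1..} = (UNIV :: real set)" by auto
  have "set_integrable lborel UNIV ?f" using u unfolding un .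
  then show ?thesis unfolding set_integrable_def indicator_UNIV scaleR_one .
qed

section \<open>Laplace transforms of the smoothing kernel and of the intensity\<close>

lemma cexp_measurable [measurable]: "(exp :: complex \<Rightarrow> complex) \<in> borel_measurable borel"
  by (intro borel_measurable_continuous_onI continuous_intros)

lemma admissible_kernel_derivatives:
  assumes K: "admissible_kernel K m r C"
  shows kernel_cont: "j \<le> r \<Longrightarrow> continuous_on UNIV ((deriv ^^ j) K)"
    and kernel_deriv: "j < r \<Longrightarrow> ((deriv ^^ j) K has_real_derivative (deriv ^^ Suc j) K t) (at t)"
    and kernel_support: "j \<le> r \<Longrightarrow> t \<notin> {0..1} \<Longrightarrow> (deriv ^^ j) K t = 0"
    and kernel_bound: "j \<le> r \<Longrightarrow> \<bar>(deriv ^^ j) K t\<bar> \<le> C"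
    and kernel_C_nonneg: "0 \<le> C"
proof -
  have dif: "(deriv ^^ j) K differentiable_on UNIV" if "j < r" for j
    using K that by (auto simp: admissible_kernel_def times_cont_diff_on_def)
  have contr: "continuous_on UNIV ((deriv ^^ r) K)"
    using K by (auto simp: admissible_kernel_def times_cont_diff_on_def)
  show der: "((deriv ^^ j) K has_real_derivative (deriv ^^ Suc j) K t) (at t)" if "j < r" for j t
    using dif[OF that] by (auto simp: differentiable_on_def DERIV_deriv_iff_real_differentiable)
  show "continuous_on UNIV ((deriv ^^ j) K)" if "j \<le> r"
    using that contr differentiable_imp_continuous_on[OF dif[of j]] by (cases "j = r") auto
  show sup: "(deriv ^^ j) K t = 0" if "j \<le> r" "t \<notin> {0..1}" for j t
    using that
  proof (induction j arbitrary: t)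
    case 0
    then show ?case using K by (auto simp: admissible_kernel_def)
  next
    case (Suc j)
    have "((deriv ^^ j) K has_real_derivative 0) (at t)"
    proof (rule DERIV_cong_ev[THEN iffD1, OF refl _ refl DERIV_const[of 0]])
      have "open (- {0..1::real})" by (intro open_Compl closed_atLeastAtMost)
      then have "eventually (\<lambda>x. x \<in> - {0..1}) (nhds t)"
        using Suc.prems by (intro eventually_nhds_in_open) auto
      then show "eventually (\<lambda>x. 0 = (deriv ^^ j) K x) (nhds t)"
        by eventually_elim (use Suc in auto)
    qed
    moreover have "((deriv ^^ j) K has_real_derivative (deriv ^^ Suc j) K t) (at t)"
      using Suc.prems by (intro der) auto
    ultimately show ?case by (rule DERIV_unique[rotated])
  qed
  have "\<bar>(deriv ^^ 0) K 0\<bar> \<le> C" using K unfolding admissible_kernel_def by (metis atLeastAtMost_iff le0 order_refl zero_le_one)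
  then show C: "0 \<le> C" by linarith
  show "\<bar>(deriv ^^ j) K t\<bar> \<le> C" if "j \<le> r" for j t
    using that K sup[OF that, of t] C by (cases "t \<in> {0..1}") (auto simp: admissible_kernel_def)
qed

lemma laplace_compact_integrable:
  fixes g :: "real \<Rightarrow> real" and z :: complex
  assumes g: "continuous_on UNIV g" and s: "\<And>t. t \<notin> {0..1} \<Longrightarrow> g t = 0"
  shows "integrable lborel (\<lambda>t. exp (- z * of_real t) * of_real (g t))"
proof -
  have "set_integrable lborel {0..1} (\<lambda>t. exp (- z * of_real t) * of_real (g t))"
    by (intro borel_integrable_atLeastAtMost' continuous_intros continuous_on_subset[OF g]) auto
  then show ?thesis unfolding set_integrable_def
    by (rule Bochner_Integration.integrable_cong[THEN iffD1, OF refl, rotated])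
      (use s in \<open>auto simp: indicator_def\<close>)
qed

lemma laplace_by_parts:
  fixes g g' :: "real \<Rightarrow> real"
  assumes g: "\<And>t. (g has_real_derivative g' t) (at t)" and g': "continuous_on UNIV g'"
    and s: "\<And>t. t \<notin> {0..1} \<Longrightarrow> g t = 0" "\<And>t. t \<notin> {0..1} \<Longrightarrow> g' t = 0"
  shows "bilateral_laplace g z * z = bilateral_laplace g' z"
proof -
  have cg: "continuous_on UNIV g"
    using g by (meson DERIV_continuous_on has_field_derivative_at_within)
  let ?h = "\<lambda>t. exp (- z * of_real t) * of_real (g' t) - z * (exp (- z * of_real t) * of_real (g t))"
  have "(LINT t|lborel. indicator {-1..2} t *\<^sub>R ?h t)
      = exp (- z * of_real 2) * of_real (g 2) - exp (- z * of_real (-1)) * of_real (g (-1))"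
  proof (rule integral_FTC_Icc)
    show "((\<lambda>t. exp (- z * of_real t) * of_real (g t)) has_vector_derivative ?h t) (at t within {-1..2})" for t
    proof -
      have "((\<lambda>t. exp (- z * of_real t)) has_vector_derivative exp (- z * of_real t) * (- z)) (at t within {-1..2})"
        by (rule has_vector_derivative_real_field) (auto intro!: derivative_eq_intros)
      moreover have "((\<lambda>t. complex_of_real (g t)) has_vector_derivative of_real (g' t)) (at t within {-1..2})"
        using g[of t] by (intro has_vector_derivative_of_real has_vector_derivative_at_within) (simp add: has_real_derivative_iff_has_vector_derivative)
      ultimately have "((\<lambda>t. exp (- z * of_real t) * of_real (g t)) has_vector_derivative
          exp (- z * of_real t) * of_real (g' t) + exp (- z * of_real t) * (- z) * of_real (g t)) (at t within {-1..2})"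
        by (rule has_vector_derivative_mult)
      then show ?thesis by (simp add: algebra_simps)
    qed
    show "continuous_on {-1..2} ?h"
      by (intro continuous_intros continuous_on_subset[OF g'] continuous_on_subset[OF cg]) auto
  qed simp
  also have "\<dots> = 0" by (simp add: s)
  also have "(LINT t|lborel. indicator {-1..2} t *\<^sub>R ?h t) = (LINT t|lborel. ?h t)"
    by (intro Bochner_Integration.integral_cong) (auto simp: indicator_def s)
  also have "\<dots> = bilateral_laplace g' z - z * bilateral_laplace g z"
  proof -
    have i: "integrable lborel (\<lambda>t. exp (- z * of_real t) * of_real (g' t))"
      "integrable lborel (\<lambda>t. exp (- z * of_real t) * of_real (g t))"
      by (intro laplace_compact_integrable g' cg s; assumption)+
    show ?thesis
      by (simp only: Bochner_Integration.integral_diff[OF i(1) integrable_mult_right[OF i(2)]]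
          integral_mult_right_zero bilateral_laplace_def)
  qed
  finally show ?thesis by (simp add: mult.commute)
qed

lemma laplace_compact_bound:
  fixes g :: "real \<Rightarrow> real"
  assumes g: "continuous_on UNIV g" and s: "\<And>t. t \<notin> {0..1} \<Longrightarrow> g t = 0" and b: "\<And>t. \<bar>g t\<bar> \<le> C" and C: "0 \<le> C"
  shows "cmod (bilateral_laplace g z) \<le> C * exp \<bar>Re z\<bar>"
proof -
  have i: "integrable lborel (\<lambda>t. exp (- z * of_real t) * of_real (g t))"
    by (rule laplace_compact_integrable[OF g s])
  have "cmod (bilateral_laplace g z) \<le> (LINT t|lborel. norm (exp (- z * of_real t) * of_real (g t)))"
    unfolding bilateral_laplace_def by (rule integral_norm_bound)
  also have "\<dots> \<le> (LINT t::real|lborel. indicator {0..1} t * (C * exp \<bar>Re z\<bar>))"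
  proof (rule Bochner_Integration.integral_mono)
    show "integrable lborel (\<lambda>t::real. indicator {0..1} t * (C * exp \<bar>Re z\<bar>))" by simp
    show "integrable lborel (\<lambda>t. norm (exp (- z * of_real t) * of_real (g t)))"
      by (rule integrable_norm[OF i])
      fix t :: real
      show "norm (exp (- z * of_real t) * of_real (g t)) \<le> indicator {0..1} t * (C * exp \<bar>Re z\<bar>)"
      proof (cases "t \<in> {0..1}")
        case True
        have "- (Re z * t) \<le> \<bar>Re z * t\<bar>" by (rule abs_ge_minus_self)
        also have "\<dots> = \<bar>Re z\<bar> * t" using True by (simp add: abs_mult)
        also have "\<dots> \<le> \<bar>Re z\<bar>" using True by (simp add: mult_left_le)
        finally have "exp (- (Re z * t)) \<le> exp \<bar>Re z\<bar>" by simp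
        then have "exp (- (Re z * t)) * \<bar>g t\<bar> \<le> exp \<bar>Re z\<bar> * C"
          using b[of t] by (intro mult_mono) auto
        then show ?thesis using True by (simp add: norm_mult mult.commute)
      qed (simp add: s)
  qed
  finally show ?thesis by simp
qed

lemma kernel_laplace_power:
  assumes K: "admissible_kernel K m r C" and j: "j \<le> r"
  shows "bilateral_laplace K z * z ^ j = bilateral_laplace ((deriv ^^ j) K) z"
  using j
proof (induction j)
  case (Suc j)
  have "bilateral_laplace K z * z ^ Suc j = bilateral_laplace ((deriv ^^ j) K) z * z"
    using Suc by (simp add: mult_ac)
  also have "\<dots> = bilateral_laplace ((deriv ^^ Suc j) K) z"
    using Suc.prems by (intro laplace_by_parts kernel_deriv[OF K] kernel_cont[OF K] kernel_support[OF K]) auto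
  finally show ?case .
qed simp

text \<open>Integration by parts \<open>r\<close> times gives decay of order \<open>|z| powr (- r)\<close>; the trivial bound covers small
\<open>Im z\<close>.\<close>

lemma kernel_laplace_decay:
  assumes K: "admissible_kernel K m r C"
  shows "cmod (bilateral_laplace K z) \<le> 2 powr (r / 2) * C * exp \<bar>Re z\<bar> * (1 + (Im z)\<^sup>2) powr (- real r / 2)"
proof -
  let ?D = "C * exp \<bar>Re z\<bar>"
  have C: "0 \<le> C" by (rule kernel_C_nonneg[OF K])
  have b: "cmod (bilateral_laplace K z) * cmod z ^ j \<le> ?D" if "j \<le> r" for j
    unfolding norm_power[symmetric] norm_mult[symmetric] kernel_laplace_power[OF K that]
    by (rule laplace_compact_bound[OF kernel_cont[OF K that] kernel_support[OF K that] kernel_bound[OF K that] C])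
  have pos: "0 < 1 + (Im z)\<^sup>2" by (smt (verit) zero_le_power2)
  have "cmod (bilateral_laplace K z) * (1 + (Im z)\<^sup>2) powr (r / 2) \<le> 2 powr (r / 2) * ?D"
  proof (cases "\<bar>Im z\<bar> \<le> 1")
    case True
    then have "(Im z)\<^sup>2 \<le> 1" by (simp add: abs_square_le_1)
    then have "(1 + (Im z)\<^sup>2) powr (r / 2) \<le> 2 powr (r / 2)"
      by (intro powr_mono2) auto
    then have "cmod (bilateral_laplace K z) * (1 + (Im z)\<^sup>2) powr (r / 2) \<le> ?D * 2 powr (r / 2)"
      using b[of 0] C by (intro mult_mono) auto
    then show ?thesis by (simp add: mult.commute)
  next
    case False
    then have "\<not> (Im z)\<^sup>2 \<le> 1" by (simp only: abs_square_le_1 not_False_eq_True)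
    then have "1 \<le> (Im z)\<^sup>2" by linarith
    then have "(1 + (Im z)\<^sup>2) powr (r / 2) \<le> (2 * (Im z)\<^sup>2) powr (r / 2)"
      by (intro powr_mono2) auto
    also have "\<dots> = 2 powr (r / 2) * \<bar>Im z\<bar> ^ r"
    proof -
      have "((Im z)\<^sup>2) powr (r / 2) = (\<bar>Im z\<bar> powr 2) powr (r / 2)"
        using False by (subst powr_numeral) auto
      also have "\<dots> = \<bar>Im z\<bar> powr real r" unfolding powr_powr by simp
      also have "\<dots> = \<bar>Im z\<bar> ^ r"
        using False by (intro powr_realpow) auto
      finally show ?thesis by (simp add: powr_mult)
    qed
    also have "\<dots> \<le> 2 powr (r / 2) * cmod z ^ r"
      by (intro mult_left_mono power_mono abs_Im_le_cmod) auto
    finally have "cmod (bilateral_laplace K z) * (1 + (Im z)\<^sup>2) powr (r / 2)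
        \<le> cmod (bilateral_laplace K z) * (2 powr (r / 2) * cmod z ^ r)"
      by (intro mult_left_mono) auto
    also have "\<dots> = 2 powr (r / 2) * (cmod (bilateral_laplace K z) * cmod z ^ r)" by simp
    also have "\<dots> \<le> 2 powr (r / 2) * ?D"
      by (intro mult_left_mono b) auto
    finally show ?thesis .
  qed
  then have "cmod (bilateral_laplace K z) \<le> 2 powr (r / 2) * ?D / (1 + (Im z)\<^sup>2) powr (r / 2)"
    using pos by (simp add: pos_le_divide_eq)
  moreover have "(1 + (Im z)\<^sup>2) powr (- real r / 2) = 1 / (1 + (Im z)\<^sup>2) powr (r / 2)"
    unfolding minus_divide_left[symmetric] by (rule powr_minus_divide)
  ultimately show ?thesis by simp
qed

text \<open>The decay of the numerator beats the growth of order \<open>\<gamma>\<close> of the reciprocal denominator. The bound is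
stated as a function of \<open>h \<omega>\<close>, with constants that depend on \<open>s\<close> and \<open>h\<close> only through the bound \<open>B\<close> on
\<open>|s| h\<close>; this makes the scaling in \<open>h\<close> explicit and keeps the final constant uniform.\<close>

lemma deconvolution_integrand_bound:
  assumes K: "admissible_kernel K m r C" and low: "laplace_lower_bound lam \<sigma> lam\<^sub>0 k\<^sub>0 \<gamma>"
    and pos: "0 < lam\<^sub>0" "0 < k\<^sub>0" "0 \<le> \<gamma>" "0 \<le> \<sigma>" and s: "s < - \<sigma>" and h: "0 < h" "\<bar>s\<bar> * h \<le> B"
  shows "cmod (bilateral_laplace K (Complex s \<omega> * of_real h) / bilateral_laplace lam (- Complex s \<omega>))
    \<le> 2 powr (r / 2) * C * exp B * (1 + B\<^sup>2) powr (\<gamma> / 2) / (lam\<^sub>0 * k\<^sub>0) * h powr (- \<gamma>)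
      * (1 + (h * \<omega>)\<^sup>2) powr (- (r - \<gamma>) / 2)"
proof -
  have C: "0 \<le> C" by (rule kernel_C_nonneg[OF K])
  define d where "d = - s - \<sigma>"
  have d: "0 < d" "d \<le> \<bar>s\<bar>" using s pos by (auto simp: d_def)
  let ?y = "1 + (h * \<omega>)\<^sup>2"
  have y: "1 \<le> ?y" by simp
  have "cmod (bilateral_laplace K (Complex s \<omega> * of_real h))
      \<le> 2 powr (r / 2) * C * exp \<bar>s * h\<bar> * ?y powr (- real r / 2)"
    using kernel_laplace_decay[OF K, of "Complex s \<omega> * of_real h"] by (simp add: mult.commute)
  also have "\<dots> \<le> 2 powr (r / 2) * C * exp B * ?y powr (- real r / 2)"
    using h C by (intro mult_right_mono mult_left_mono) (auto simp: abs_mult)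
  finally have num: "cmod (bilateral_laplace K (Complex s \<omega> * of_real h)) \<le> 2 powr (r / 2) * C * exp B * ?y powr (- real r / 2)" .
  have dw: "0 < d\<^sup>2 + \<omega>\<^sup>2" using d by (simp add: add_pos_nonneg)
  have "- Complex s \<omega> = Complex (- s) (- \<omega>)" by (simp add: complex_eq_iff)
  moreover have "\<sigma> < - s" using s by simp
  ultimately have l: "lam\<^sub>0 * k\<^sub>0 / (d\<^sup>2 + \<omega>\<^sup>2) powr (\<gamma> / 2) \<le> cmod (bilateral_laplace lam (- Complex s \<omega>))"
    using low unfolding laplace_lower_bound_def d_def by (metis power2_minus)
  have den: "1 / cmod (bilateral_laplace lam (- Complex s \<omega>)) \<le> (d\<^sup>2 + \<omega>\<^sup>2) powr (\<gamma> / 2) / (lam\<^sub>0 * k\<^sub>0)"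
  proof -
    have "0 < lam\<^sub>0 * k\<^sub>0 / (d\<^sup>2 + \<omega>\<^sup>2) powr (\<gamma> / 2)"
      using pos less_imp_neq[OF dw, symmetric] by (intro divide_pos_pos mult_pos_pos) (auto simp only: powr_gt_zero)
    from le_imp_inverse_le[OF l this] show ?thesis by (simp add: inverse_eq_divide)
  qed
  have "d\<^sup>2 + \<omega>\<^sup>2 \<le> h powr (- 2) * ((1 + B\<^sup>2) * ?y)"
  proof -
    have "h * d \<le> B" using d h by (smt (verit) mult.commute mult_left_mono)
    then have "(h * d)\<^sup>2 \<le> B\<^sup>2" using d h by (intro power_mono) auto
    then have "(h * d)\<^sup>2 + (h * \<omega>)\<^sup>2 \<le> (1 + B\<^sup>2) * ?y"
      by (simp add: algebra_simps add_increasing add_increasing2)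
    then have "h powr (- 2) * ((h * d)\<^sup>2 + (h * \<omega>)\<^sup>2) \<le> h powr (- 2) * ((1 + B\<^sup>2) * ?y)"
      by (intro mult_left_mono) auto
    moreover have "h powr (- 2) * ((h * d)\<^sup>2 + (h * \<omega>)\<^sup>2) = d\<^sup>2 + \<omega>\<^sup>2"
      using h by (simp add: powr_minus power_mult_distrib field_simps)
    ultimately show ?thesis by simp
  qed
  then have "(d\<^sup>2 + \<omega>\<^sup>2) powr (\<gamma> / 2) \<le> (h powr (- 2) * ((1 + B\<^sup>2) * ?y)) powr (\<gamma> / 2)"
    using pos dw by (intro powr_mono2) auto
  also have "\<dots> = h powr (- \<gamma>) * ((1 + B\<^sup>2) powr (\<gamma> / 2) * ?y powr (\<gamma> / 2))"
    using y by (simp add: powr_mult powr_powr)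
  finally have p: "(d\<^sup>2 + \<omega>\<^sup>2) powr (\<gamma> / 2) \<le> h powr (- \<gamma>) * ((1 + B\<^sup>2) powr (\<gamma> / 2) * ?y powr (\<gamma> / 2))" .
  have "cmod (bilateral_laplace K (Complex s \<omega> * of_real h) / bilateral_laplace lam (- Complex s \<omega>))
      = cmod (bilateral_laplace K (Complex s \<omega> * of_real h)) * (1 / cmod (bilateral_laplace lam (- Complex s \<omega>)))"
    by (simp add: norm_divide)
  also have "\<dots> \<le> (2 powr (r / 2) * C * exp B * ?y powr (- real r / 2))
      * (h powr (- \<gamma>) * ((1 + B\<^sup>2) powr (\<gamma> / 2) * ?y powr (\<gamma> / 2)) / (lam\<^sub>0 * k\<^sub>0))"
  proof (intro mult_mono num)
    show "1 / cmod (bilateral_laplace lam (- Complex s \<omega>)) \<le> h powr (- \<gamma>) * ((1 + B\<^sup>2) powr (\<gamma> / 2) * ?y powr (\<gamma> / 2)) / (lam\<^sub>0 * k\<^sub>0)"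
      using pos by (intro order_trans[OF den] divide_right_mono p) auto
  qed (use C in auto)
  also have "\<dots> = 2 powr (r / 2) * C * exp B * (1 + B\<^sup>2) powr (\<gamma> / 2) / (lam\<^sub>0 * k\<^sub>0) * h powr (- \<gamma>)
      * (?y powr (- real r / 2) * ?y powr (\<gamma> / 2))" by simp
  also have "?y powr (- real r / 2) * ?y powr (\<gamma> / 2) = ?y powr (- (r - \<gamma>) / 2)"
    by (simp add: powr_add[symmetric] diff_divide_distrib)
  finally show ?thesis .
qed

text \<open>The difference quotients of \<open>exp (- z t)\<close> near \<open>z\<^sub>0\<close> are dominated by \<open>t exp (- c t)\<close> for some \<open>c > \<sigma>\<close>, so
differentiation under the integral is justified by dominated convergence.\<close>

lemma laplace_holomorphic:
  fixes f :: "real \<Rightarrow> real"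
  assumes f [measurable]: "f \<in> borel_measurable borel" and f0: "\<And>t. t < 0 \<Longrightarrow> f t = 0"
    and i: "\<And>c. \<sigma> < c \<Longrightarrow> integrable lborel (\<lambda>t. exp (- c * t) * f t)"
  shows "bilateral_laplace f holomorphic_on {z. \<sigma> < Re z}"
    and "\<sigma> < Re z \<Longrightarrow> integrable lborel (\<lambda>t. exp (- z * of_real t) * of_real (f t))"
proof -
  show ii: "integrable lborel (\<lambda>t. exp (- z * of_real t) * of_real (f t))" if "\<sigma> < Re z" for z
    by (rule Bochner_Integration.integrable_bound[OF i[OF that]]) (auto simp: norm_mult)
  show "bilateral_laplace f holomorphic_on {z. \<sigma> < Re z}"
    unfolding holomorphic_on_def
  proof
    fix z0 assume "z0 \<in> {z. \<sigma> < Re z}"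
    then have z0: "\<sigma> < Re z0" by simp
    define e where "e = (Re z0 - \<sigma>) / 3"
    have e: "0 < e" "Re z0 = \<sigma> + 3 * e" unfolding e_def using z0 by (simp_all add: field_simps)
    define S where "S = {z. \<sigma> + 2 * e < Re z}"
    have S: "open S" "convex S" "z0 \<in> S"
      using e by (auto simp: S_def open_halfspace_Re_gt convex_halfspace_Re_gt)
    let ?D = "LINT t|lborel. exp (- z0 * of_real t) * (- of_real t) * of_real (f t)"
    have "(bilateral_laplace f has_field_derivative ?D) (at z0 within S)"
      unfolding has_field_derivative_iff
    proof (subst tendsto_at_iff_sequentially, intro allI impI)
      fix X assume X: "\<forall>n. X n \<in> S - {z0}" "X \<longlonglongrightarrow> z0"
      let ?g = "\<lambda>n t. (exp (- X n * of_real t) - exp (- z0 * of_real t)) / (X n - z0) * of_real (f t)"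
      have "(\<lambda>n. LINT t|lborel. ?g n t) \<longlonglongrightarrow> ?D"
      proof (rule integral_dominated_convergence[where w = "\<lambda>t. 1 / e * (exp (- (\<sigma> + e) * t) * \<bar>f t\<bar>)"])
        have "integrable lborel (\<lambda>t. \<bar>exp (- (\<sigma> + e) * t) * f t\<bar>)"
          using e by (intro integrable_abs i) auto
        then show "integrable lborel (\<lambda>t. 1 / e * (exp (- (\<sigma> + e) * t) * \<bar>f t\<bar>))"
          by (intro integrable_mult_right) (simp add: abs_mult)
        show "AE t in lborel. (\<lambda>n. ?g n t) \<longlonglongrightarrow> exp (- z0 * of_real t) * (- of_real t) * of_real (f t)"
        proof (intro AE_I2 tendsto_mult tendsto_const)
          fix t :: real
          have "((\<lambda>z. exp (- z * of_real t)) has_field_derivative exp (- z0 * of_real t) * (- of_real t)) (at z0 within S)"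
            by (auto intro!: derivative_eq_intros)
          then have "((\<lambda>y. (exp (- y * of_real t) - exp (- z0 * of_real t)) / (y - z0)) \<longlongrightarrow> exp (- z0 * of_real t) * (- of_real t)) (at z0 within S)"
            by (simp add: has_field_derivative_iff)
          then show "(\<lambda>n. (exp (- X n * of_real t) - exp (- z0 * of_real t)) / (X n - z0)) \<longlonglongrightarrow> exp (- z0 * of_real t) * (- of_real t)"
            using X by (subst (asm) tendsto_at_iff_sequentially) (auto simp: comp_def)
        qed
        show "AE t in lborel. norm (?g n t) \<le> 1 / e * (exp (- (\<sigma> + e) * t) * \<bar>f t\<bar>)" for n
        proof (rule AE_I2)
          fix t :: real
          show "norm (?g n t) \<le> 1 / e * (exp (- (\<sigma> + e) * t) * \<bar>f t\<bar>)"
          proof (cases "t < 0")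
            case False
            have nz: "X n \<noteq> z0" "X n \<in> S" using X by auto
            have "norm (exp (- X n * of_real t) - exp (- z0 * of_real t)) \<le> (t * exp (- (\<sigma> + 2 * e) * t)) * norm (X n - z0)"
            proof (rule field_differentiable_bound[OF S(2)])
              show "((\<lambda>z. exp (- z * of_real t)) has_field_derivative exp (- z * of_real t) * (- of_real t)) (at z within S)" for z
                by (auto intro!: derivative_eq_intros)
              show "norm (exp (- z * of_real t) * (- of_real t)) \<le> t * exp (- (\<sigma> + 2 * e) * t)" if "z \<in> S" for z
              proof -
                have "(\<sigma> + 2 * e) * t \<le> Re z * t" using that False by (intro mult_right_mono) (auto simp: S_def)
                then have "exp (- (Re z * t)) \<le> exp (- (\<sigma> + 2 * e) * t)"
                  by (simp only: exp_le_cancel_iff minus_mult_left[symmetric] neg_le_iff_le)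
                then have "t * exp (- (Re z * t)) \<le> t * exp (- (\<sigma> + 2 * e) * t)"
                  using False by (intro mult_left_mono) auto
                then show ?thesis using False by (simp add: norm_mult mult.commute)
              qed
            qed (use nz S in auto)
            then have "norm (exp (- X n * of_real t) - exp (- z0 * of_real t)) / norm (X n - z0) \<le> t * exp (- (\<sigma> + 2 * e) * t)"
              using nz by (simp add: pos_divide_le_eq)
            also have "\<dots> \<le> 1 / e * exp (- (\<sigma> + e) * t)"
            proof -
              have "e * t \<le> exp (e * t)" using exp_ge_add_one_self[of "e * t"] by linarith
              then have "t \<le> 1 / e * exp (e * t)" using e by (simp add: field_simps)
              then have "t * exp (- (\<sigma> + 2 * e) * t) \<le> 1 / e * exp (e * t) * exp (- (\<sigma> + 2 * e) * t)"
                by (intro mult_right_mono) auto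
              also have "\<dots> = 1 / e * exp (- (\<sigma> + e) * t)"
                by (simp add: mult.assoc exp_add[symmetric] algebra_simps)
              finally show ?thesis .
            qed
            finally have "norm (exp (- X n * of_real t) - exp (- z0 * of_real t)) / norm (X n - z0) * \<bar>f t\<bar>
                \<le> 1 / e * exp (- (\<sigma> + e) * t) * \<bar>f t\<bar>"
              by (intro mult_right_mono) auto
            then show ?thesis by (simp add: norm_mult norm_divide)
          qed (simp add: f0)
        qed
      qed measurable
      moreover have "(LINT t|lborel. ?g n t) = (bilateral_laplace f (X n) - bilateral_laplace f z0) / (X n - z0)" for n
      proof -
        have "X n \<in> S" using X by auto
        then have "\<sigma> < Re (X n)" using e by (auto simp: S_def)
        then have "bilateral_laplace f (X n) - bilateral_laplace f z0
            = (LINT t|lborel. exp (- X n * of_real t) * of_real (f t) - exp (- z0 * of_real t) * of_real (f t))"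
          unfolding bilateral_laplace_def using z0 by (intro Bochner_Integration.integral_diff[symmetric] ii)
        then have "(bilateral_laplace f (X n) - bilateral_laplace f z0) / (X n - z0)
            = (LINT t|lborel. (exp (- X n * of_real t) * of_real (f t) - exp (- z0 * of_real t) * of_real (f t)) / (X n - z0))"
          by (simp only: integral_divide_zero)
        also have "\<dots> = (LINT t|lborel. ?g n t)"
          by (intro Bochner_Integration.integral_cong refl) (simp add: diff_divide_distrib algebra_simps)
        finally show ?thesis ..
      qed
      ultimately show "((\<lambda>y. (bilateral_laplace f y - bilateral_laplace f z0) / (y - z0)) \<circ> X) \<longlonglongrightarrow> ?D"
        by (simp only: comp_def)
    qed
    then have "(bilateral_laplace f has_field_derivative ?D) (at z0)"
      unfolding at_within_open[OF S(3,1)] .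
    then show "bilateral_laplace f field_differentiable at z0 within {z. \<sigma> < Re z}"
      unfolding field_differentiable_def by (blast intro: has_field_derivative_at_within)
  qed
qed

section \<open>Independence of the deconvolution kernel of the line of integration\<close>

lemma decay_tendsto_0:
  assumes "0 < h" "0 < q"
  shows "(\<lambda>n. (1 + (h * real n)\<^sup>2) powr (- q)) \<longlonglongrightarrow> 0"
proof -
  have "filterlim (\<lambda>n. 1 + (h * real n)\<^sup>2) at_top sequentially"
    using assms by real_asymp
  then show ?thesis using assms by (intro tendsto_neg_powr) auto
qed

text \<open>The bandwidth \<open>h\<close> is a parameter of the locale, since a single bandwidth is considered until the
rate is computed.\<close>

locale deconvolution =
  fixes K :: "real \<Rightarrow> real" and m r :: nat and C :: real and lam :: "real \<Rightarrow> real" and \<sigma> lam\<^sub>0 k\<^sub>0 \<gamma> h :: real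
  assumes K: "admissible_kernel K m r C" and low: "laplace_lower_bound lam \<sigma> lam\<^sub>0 k\<^sub>0 \<gamma>"
    and pos: "0 < lam\<^sub>0" "0 < k\<^sub>0" "0 \<le> \<gamma>" "0 \<le> \<sigma>" and r: "\<gamma> + 1 < real r" and h: "0 < h"
    and lam_measurable [measurable]: "lam \<in> borel_measurable borel"
    and lam_nonneg: "\<And>t. 0 \<le> lam t" and lam_neg: "\<And>t. t < 0 \<Longrightarrow> lam t = 0"
    and lam_int: "\<And>c. \<sigma> < c \<Longrightarrow> integrable lborel (\<lambda>t. exp (- c * t) * lam t)"
begin

definition integrand :: "real \<Rightarrow> real \<Rightarrow> complex" where
  "integrand s \<omega> = bilateral_laplace K (Complex s \<omega> * of_real h) / bilateral_laplace lam (- Complex s \<omega>)"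

definition bound_const :: "real \<Rightarrow> real" where
  "bound_const B = 2 powr (r / 2) * C * exp B * (1 + B\<^sup>2) powr (\<gamma> / 2) / (lam\<^sub>0 * k\<^sub>0)"

lemma bound_const_nonneg: "0 \<le> bound_const B"
  using pos kernel_C_nonneg[OF K] by (simp add: bound_const_def)

lemma integrand_bound:
  assumes "s < - \<sigma>" "\<bar>s\<bar> * h \<le> B"
  shows "cmod (integrand s \<omega>) \<le> bound_const B * h powr (- \<gamma>) * (1 + (h * \<omega>)\<^sup>2) powr (- (r - \<gamma>) / 2)"
  unfolding integrand_def bound_const_def
  by (rule deconvolution_integrand_bound[OF K low pos assms(1) h assms(2)])

lemma K_cont: "continuous_on UNIV K" and K_support: "t \<notin> {0..1} \<Longrightarrow> K t = 0" and K_bound: "\<bar>K t\<bar> \<le> C"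
  using kernel_cont[OF K, of 0] kernel_support[OF K, of 0 t] kernel_bound[OF K, of 0 t] by simp_all

lemma K_measurable [measurable]: "K \<in> borel_measurable borel"
  by (rule borel_measurable_continuous_onI[OF K_cont])

lemma K_laplace_holomorphic: "bilateral_laplace K holomorphic_on UNIV"
proof -
  have i: "integrable lborel (\<lambda>t. exp (- c * t) * K t)" for c
  proof -
    have "set_integrable lborel {0..1} (\<lambda>t. exp (- c * t) * K t)"
      by (intro borel_integrable_atLeastAtMost' continuous_intros continuous_on_subset[OF K_cont]) auto
    then show ?thesis unfolding set_integrable_def
      by (rule Bochner_Integration.integrable_cong[THEN iffD1, OF refl, rotated])
        (use K_support in \<open>auto simp: indicator_def\<close>)
  qed
  have hol: "bilateral_laplace K holomorphic_on {z. Re z0 - 1 < Re z}" for z0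
    by (rule laplace_holomorphic(1)) (use K_support i in auto)
  have "bilateral_laplace K field_differentiable at z0" for z0
    by (rule holomorphic_on_imp_differentiable_at[OF hol[of z0] open_halfspace_Re_gt]) simp
  then show ?thesis by (simp add: holomorphic_on_def)
qed

lemma lam_laplace_nz: "\<sigma> < Re z \<Longrightarrow> bilateral_laplace lam z \<noteq> 0"
  using low by (auto simp: laplace_lower_bound_def)

text \<open>The holomorphic function whose integrals along vertical lines define \<open>L_h(t)\<close>, up to the factor
\<open>2 \<pi>\<close>.\<close>

definition phase :: "real \<Rightarrow> complex \<Rightarrow> complex" where
  "phase t z = bilateral_laplace K (z * of_real h) / bilateral_laplace lam (- z) * exp (z * of_real t)"

lemma phase_holomorphic: "phase t holomorphic_on {z. Re z < - \<sigma>}"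
proof -
  have num: "(bilateral_laplace K \<circ> (\<lambda>z. z * of_real h)) holomorphic_on {z. Re z < - \<sigma>}"
    by (rule holomorphic_on_compose_gen[OF _ K_laplace_holomorphic]) (auto intro!: holomorphic_intros)
  have den: "(bilateral_laplace lam \<circ> uminus) holomorphic_on {z. Re z < - \<sigma>}"
    by (rule holomorphic_on_compose_gen[OF _ laplace_holomorphic(1)[of lam \<sigma>]])
      (auto intro!: holomorphic_intros simp: lam_neg lam_int[simplified])
  have "(\<lambda>z. (bilateral_laplace K \<circ> (\<lambda>z. z * of_real h)) z / (bilateral_laplace lam \<circ> uminus) z * exp (z * of_real t))
     holomorphic_on {z. Re z < - \<sigma>}"
    by (intro holomorphic_on_mult holomorphic_on_divide num den) (auto intro!: holomorphic_intros simp: lam_laplace_nz)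
  then show ?thesis by (simp add: phase_def[abs_def] comp_def)
qed

lemma phase_line: "phase t (Complex s \<omega>) = of_real (exp (s * t)) * (integrand s \<omega> * exp (\<i> * of_real \<omega> * of_real t))"
proof -
  have "Complex s \<omega> * of_real t = of_real (s * t) + \<i> * of_real \<omega> * of_real t"
    by (simp add: complex_eq_iff)
  then have "exp (Complex s \<omega> * of_real t) = of_real (exp (s * t)) * exp (\<i> * of_real \<omega> * of_real t)"
    by (simp only: exp_add exp_of_real)
  then show ?thesis by (simp add: phase_def integrand_def)
qed

lemma cmod_phase_line: "cmod (phase t (Complex s \<omega>)) = exp (s * t) * cmod (integrand s \<omega>)"
proof -
  have "\<i> * of_real \<omega> * of_real t = \<i> * of_real (\<omega> * t)" by simp
  then show ?thesis by (simp only: phase_line norm_mult norm_of_real norm_exp_i_times abs_exp_cancel mult_1_right)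
qed

lemma integrand_measurable: assumes "s < - \<sigma>" shows "integrand s \<in> borel_measurable borel"
proof -
  have "continuous_on {z. Re z < - \<sigma>} (phase 0)"
    by (rule holomorphic_on_imp_continuous_on[OF phase_holomorphic])
  then have "continuous_on UNIV (\<lambda>\<omega>. phase 0 (Complex s \<omega>))"
    by (rule continuous_on_compose2) (use assms in \<open>auto intro!: continuous_intros simp: Complex_eq\<close>)
  then have "(\<lambda>\<omega>. phase 0 (Complex s \<omega>)) \<in> borel_measurable borel"
    by (rule borel_measurable_continuous_onI)
  then show ?thesis by (simp add: phase_line)
qed

lemma decay_integrable:
  assumes "1 < q" shows "integrable lborel (\<lambda>\<omega>. (1 + (h * \<omega>)\<^sup>2) powr (- q / 2))"
    and "(LINT \<omega>|lborel. (1 + (h * \<omega>)\<^sup>2) powr (- q / 2)) = (LINT v|lborel. (1 + v\<^sup>2) powr (- q / 2)) / h"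
proof -
  show "integrable lborel (\<lambda>\<omega>. (1 + (h * \<omega>)\<^sup>2) powr (- q / 2))"
    using lborel_integrable_real_affine[OF integrable_power_decay[OF assms], of h 0] h by simp
  show "(LINT \<omega>|lborel. (1 + (h * \<omega>)\<^sup>2) powr (- q / 2)) = (LINT v|lborel. (1 + v\<^sup>2) powr (- q / 2)) / h"
    using lborel_integral_real_affine[of h "\<lambda>v. (1 + v\<^sup>2) powr (- q / 2)" 0] h by simp
qed

lemma integrand_integrable: assumes s: "s < - \<sigma>" shows "integrable lborel (integrand s)"
proof (rule Bochner_Integration.integrable_bound)
  show "integrable lborel (\<lambda>\<omega>. bound_const (\<bar>s\<bar> * h) * h powr (- \<gamma>) * (1 + (h * \<omega>)\<^sup>2) powr (- (r - \<gamma>) / 2))"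
    using r by (intro integrable_mult_right decay_integrable) simp
  show "integrand s \<in> borel_measurable lborel" using integrand_measurable[OF s] by simp
  show "AE \<omega> in lborel. norm (integrand s \<omega>) \<le> norm (bound_const (\<bar>s\<bar> * h) * h powr (- \<gamma>) * (1 + (h * \<omega>)\<^sup>2) powr (- (r - \<gamma>) / 2))"
    using integrand_bound[OF s order_refl] bound_const_nonneg by (intro AE_I2) (simp add: abs_mult)
qed

lemma L_kernel_phase: "L_kernel K lam s h t = (LINT \<omega>|lborel. phase t (Complex s \<omega>)) / of_real (2 * pi)"
  unfolding L_kernel_def phase_line integrand_def[symmetric]
  by (simp only: integral_mult_right_zero) simp

lemma phase_line_integrable: assumes s: "s < - \<sigma>" shows "integrable lborel (\<lambda>\<omega>. phase t (Complex s \<omega>))"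
proof (rule Bochner_Integration.integrable_bound)
  show "integrable lborel (\<lambda>\<omega>. of_real (exp (s * t)) * integrand s \<omega>)"
    by (intro integrable_mult_right integrand_integrable s)
  have "continuous_on {z. Re z < - \<sigma>} (phase t)"
    by (rule holomorphic_on_imp_continuous_on[OF phase_holomorphic])
  then have "continuous_on UNIV (\<lambda>\<omega>. phase t (Complex s \<omega>))"
    by (rule continuous_on_compose2) (use s in \<open>auto intro!: continuous_intros simp: Complex_eq\<close>)
  then show "(\<lambda>\<omega>. phase t (Complex s \<omega>)) \<in> borel_measurable lborel"
    by (simp add: borel_measurable_continuous_onI)
qed (simp add: cmod_phase_line norm_mult)

text \<open>The integrand has a holomorphic primitive \<open>g\<close> on the half-plane. The integrals over long vertical
segments are increments of \<open>g\<close>; those on two lines differ by increments of \<open>g\<close> along two horizontal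
segments, which vanish in the limit because the integrand does.\<close>

lemma L_kernel_shift:
  assumes s: "s < - \<sigma>" "s' < - \<sigma>"
  shows "L_kernel K lam s h t = L_kernel K lam s' h t"
proof -
  let ?S = "{z. Re z < - \<sigma>}"
  obtain g where g: "\<And>z. z \<in> ?S \<Longrightarrow> (g has_field_derivative phase t z) (at z within ?S)"
    using holomorphic_convex_primitive'[OF convex_halfspace_Re_lt open_halfspace_Re_lt phase_holomorphic] by blast
  have line: "(LINT \<omega>|lborel. indicator {- real n..real n} \<omega> *\<^sub>R phase t (Complex u \<omega>))
      = (g (Complex u n) - g (Complex u (- real n))) / \<i>" if u: "u < - \<sigma>" for u n
  proof -
    have "(LINT \<omega>|lborel. indicator {- real n..real n} \<omega> *\<^sub>R phase t (Complex u \<omega>))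
      = g (Complex u n) / \<i> - g (Complex u (- real n)) / \<i>"
    proof (rule integral_FTC_Icc)
      fix x :: real
      have "(g has_field_derivative phase t (Complex u x)) (at (Complex u x))"
        using g[of "Complex u x"] u by (simp add: at_within_open[OF _ open_halfspace_Re_lt])
      moreover have "((\<lambda>x. Complex u x) has_vector_derivative \<i>) (at x within {- real n..real n})"
        unfolding Complex_eq by (auto intro!: derivative_eq_intros)
      ultimately have "(g \<circ> (\<lambda>x. Complex u x) has_vector_derivative (\<i> * phase t (Complex u x))) (at x within {- real n..real n})"
        by (rule field_vector_diff_chain_within[rotated, OF has_field_derivative_at_within])
      then have "((\<lambda>x. (g \<circ> (\<lambda>x. Complex u x)) x / \<i>) has_vector_derivative (\<i> * phase t (Complex u x)) / \<i>) (at x within {- real n..real n})"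
        by (rule has_vector_derivative_divide)
      then show "((\<lambda>x. g (Complex u x) / \<i>) has_vector_derivative phase t (Complex u x)) (at x within {- real n..real n})"
        by (simp add: comp_def)
    next
      have "continuous_on {z. Re z < - \<sigma>} (phase t)"
        by (rule holomorphic_on_imp_continuous_on[OF phase_holomorphic])
      then show "continuous_on {- real n..real n} (\<lambda>\<omega>. phase t (Complex u \<omega>))"
        by (rule continuous_on_compose2) (use u in \<open>auto intro!: continuous_intros simp: Complex_eq\<close>)
    qed simp
    then show ?thesis by (simp only: diff_divide_distrib)
  qed
  have lim: "(\<lambda>n. (g (Complex u (real n)) - g (Complex u (- real n))) / \<i>) \<longlonglongrightarrow> (LINT \<omega>|lborel. phase t (Complex u \<omega>))"
    if u: "u < - \<sigma>" for u
    unfolding line[OF u, symmetric]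
  proof (rule integral_dominated_convergence[where w = "\<lambda>\<omega>. cmod (phase t (Complex u \<omega>))"])
    note i = phase_line_integrable[OF u, of t]
    show "integrable lborel (\<lambda>\<omega>. cmod (phase t (Complex u \<omega>)))" by (rule integrable_norm[OF i])
    show m: "(\<lambda>\<omega>. phase t (Complex u \<omega>)) \<in> borel_measurable lborel" by (rule borel_measurable_integrable[OF i])
    show "(\<lambda>\<omega>. indicator {- real n..real n} \<omega> *\<^sub>R phase t (Complex u \<omega>)) \<in> borel_measurable lborel" for n
      using m by measurable
    show "AE \<omega> in lborel. norm (indicator {- real n..real n} \<omega> *\<^sub>R phase t (Complex u \<omega>)) \<le> cmod (phase t (Complex u \<omega>))" for n
      by (intro AE_I2) (auto simp: indicator_def)
    show "AE \<omega> in lborel. (\<lambda>n. indicator {- real n..real n} \<omega> *\<^sub>R phase t (Complex u \<omega>)) \<longlonglongrightarrow> phase t (Complex u \<omega>)"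
    proof (rule AE_I2)
      fix \<omega> :: real
      obtain N where N: "\<bar>\<omega>\<bar> \<le> real N" using real_arch_simple by blast
      have "eventually (\<lambda>n. indicator {- real n..real n} \<omega> *\<^sub>R phase t (Complex u \<omega>) = phase t (Complex u \<omega>)) sequentially"
        using eventually_ge_at_top[of N] by eventually_elim (use N in \<open>auto simp: indicator_def\<close>)
      then show "(\<lambda>n. indicator {- real n..real n} \<omega> *\<^sub>R phase t (Complex u \<omega>)) \<longlonglongrightarrow> phase t (Complex u \<omega>)"
        by (rule tendsto_eventually)
    qed
  qed
  define b where "b = max \<bar>s\<bar> \<bar>s'\<bar>"
  define q where "q = (real r - \<gamma>) / 2"
  have side: "cmod (g (Complex s w) - g (Complex s' w))
      \<le> exp (b * \<bar>t\<bar>) * (bound_const (b * h) * h powr (- \<gamma>) * (1 + (h * w)\<^sup>2) powr (- q)) * \<bar>s - s'\<bar>" for w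
  proof -
    let ?I = "closed_segment (Complex s w) (Complex s' w)"
    have seg: "\<exists>u. z = Complex u w \<and> u < - \<sigma> \<and> \<bar>u\<bar> \<le> b" if z: "z \<in> ?I" for z
    proof -
      obtain v where v: "0 \<le> v" "v \<le> 1" "z = (1 - v) *\<^sub>R Complex s w + v *\<^sub>R Complex s' w"
        using z by (auto simp: closed_segment_def)
      define u where "u = (1 - v) * s + v * s'"
      have "z = Complex u w" unfolding v u_def by (simp add: complex_eq_iff algebra_simps)
      moreover have "u < - \<sigma>" unfolding u_def using v s by (intro convex_bound_lt) auto
      moreover have "\<bar>u\<bar> \<le> b"
      proof -
        have "\<bar>u\<bar> \<le> \<bar>(1 - v) * s\<bar> + \<bar>v * s'\<bar>" unfolding u_def by (rule abs_triangle_ineq)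
        also have "\<dots> = (1 - v) * \<bar>s\<bar> + v * \<bar>s'\<bar>" using v by (simp add: abs_mult)
        also have "\<dots> \<le> b" by (rule convex_bound_le) (use v in \<open>auto simp: b_def\<close>)
        finally show ?thesis .
      qed
      ultimately show ?thesis by blast
    qed
    have "cmod (g (Complex s w) - g (Complex s' w))
      \<le> exp (b * \<bar>t\<bar>) * (bound_const (b * h) * h powr (- \<gamma>) * (1 + (h * w)\<^sup>2) powr (- q)) * cmod (Complex s w - Complex s' w)"
    proof (rule field_differentiable_bound[OF convex_closed_segment])
      fix z assume z: "z \<in> ?I"
      then obtain u where u: "z = Complex u w" "u < - \<sigma>" "\<bar>u\<bar> \<le> b" using seg by blast
      show "(g has_field_derivative phase t z) (at z within ?I)"
        using g[of z] u by (simp add: at_within_open[OF _ open_halfspace_Re_lt] has_field_derivative_at_within)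
      have "u * t \<le> \<bar>u\<bar> * \<bar>t\<bar>" unfolding abs_mult[symmetric] by (rule abs_ge_self)
      also have "\<dots> \<le> b * \<bar>t\<bar>" using u by (intro mult_right_mono) auto
      finally have "exp (u * t) \<le> exp (b * \<bar>t\<bar>)" by simp
      moreover have "cmod (integrand u w) \<le> bound_const (b * h) * h powr (- \<gamma>) * (1 + (h * w)\<^sup>2) powr (- q)"
        using integrand_bound[OF u(2), of "b * h" w] u h by (simp add: q_def mult_right_mono minus_divide_left)
      ultimately show "cmod (phase t z) \<le> exp (b * \<bar>t\<bar>) * (bound_const (b * h) * h powr (- \<gamma>) * (1 + (h * w)\<^sup>2) powr (- q))"
        unfolding u(1) cmod_phase_line by (intro mult_mono) auto
    qed auto
    also have "cmod (Complex s w - Complex s' w) = \<bar>s - s'\<bar>" by (simp add: cmod_def)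
    finally show ?thesis .
  qed
  have side0: "(\<lambda>n. g (Complex s (f n)) - g (Complex s' (f n))) \<longlonglongrightarrow> 0"
    if f: "\<And>n. \<bar>f n\<bar> = real n" for f :: "nat \<Rightarrow> real"
  proof (rule Lim_null_comparison)
    have "(h * f n)\<^sup>2 = (h * real n)\<^sup>2" for n 
      unfolding power_mult_distrib using f[of n] by (metis power2_abs abs_of_nat)
    then show "eventually (\<lambda>n. cmod (g (Complex s (f n)) - g (Complex s' (f n)))
        \<le> exp (b * \<bar>t\<bar>) * (bound_const (b * h) * h powr (- \<gamma>) * (1 + (h * real n)\<^sup>2) powr (- q)) * \<bar>s - s'\<bar>) sequentially"
      using side[of "f _"] by (intro always_eventually allI) simp
    have "(\<lambda>n. exp (b * \<bar>t\<bar>) * (bound_const (b * h) * h powr (- \<gamma>) * (1 + (h * real n)\<^sup>2) powr (- q)) * \<bar>s - s'\<bar>)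
        \<longlonglongrightarrow> exp (b * \<bar>t\<bar>) * (bound_const (b * h) * h powr (- \<gamma>) * 0) * \<bar>s - s'\<bar>"
      using r pos h by (intro tendsto_mult tendsto_const decay_tendsto_0) (auto simp: q_def)
    then show "(\<lambda>n. exp (b * \<bar>t\<bar>) * (bound_const (b * h) * h powr (- \<gamma>) * (1 + (h * real n)\<^sup>2) powr (- q)) * \<bar>s - s'\<bar>) \<longlonglongrightarrow> 0"
      by simp
  qed
  have "(\<lambda>n. (g (Complex s (real n)) - g (Complex s (- real n))) / \<i> - (g (Complex s' (real n)) - g (Complex s' (- real n))) / \<i>)
      \<longlonglongrightarrow> (LINT \<omega>|lborel. phase t (Complex s \<omega>)) - (LINT \<omega>|lborel. phase t (Complex s' \<omega>))"
    by (intro tendsto_diff lim s)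
  moreover have "(\<lambda>n. (g (Complex s (real n)) - g (Complex s (- real n))) / \<i> - (g (Complex s' (real n)) - g (Complex s' (- real n))) / \<i>) \<longlonglongrightarrow> 0"
  proof -
    have "(\<lambda>n. ((g (Complex s (real n)) - g (Complex s' (real n))) - (g (Complex s (- real n)) - g (Complex s' (- real n)))) / \<i>) \<longlonglongrightarrow> (0 - 0) / \<i>"
      by (intro tendsto_intros side0) auto
    moreover have "((g (Complex s (real n)) - g (Complex s' (real n))) - (g (Complex s (- real n)) - g (Complex s' (- real n)))) / \<i>
        = (g (Complex s (real n)) - g (Complex s (- real n))) / \<i> - (g (Complex s' (real n)) - g (Complex s' (- real n))) / \<i>" for n
      by (simp add: algebra_simps)
    ultimately show ?thesis by (simp only: diff_self div_0)
  qed
  ultimately have "(LINT \<omega>|lborel. phase t (Complex s \<omega>)) - (LINT \<omega>|lborel. phase t (Complex s' \<omega>)) = 0"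
    by (rule LIMSEQ_unique)
  then show ?thesis by (simp add: L_kernel_phase)
qed

end

section \<open>Size of the deconvolution kernel and its defining identity\<close>

context deconvolution begin

definition decay_L1 :: real where "decay_L1 = (LINT v|lborel. (1 + v\<^sup>2) powr (- (real r - \<gamma>) / 2))"
definition decay_L2 :: real where "decay_L2 = (LINT v|lborel. (1 + v\<^sup>2) powr (- (2 * (real r - \<gamma>)) / 2))"

lemma phase_line_measurable:
  assumes s: "s < - \<sigma>"
  shows "(\<lambda>x. phase (fst x) (Complex s (snd x))) \<in> borel_measurable (borel \<Otimes>\<^sub>M borel)"
proof -
  note [measurable] = integrand_measurable[OF s]
  show ?thesis unfolding phase_line by measurable
qed

lemma L_kernel_measurable:
  assumes s: "s < - \<sigma>" shows "L_kernel K lam s h \<in> borel_measurable borel"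
proof -
  have "(\<lambda>x. phase (fst x) (Complex s (snd x))) \<in> borel_measurable (borel \<Otimes>\<^sub>M lborel)"
    using phase_line_measurable[OF s] by simp
  then have "(\<lambda>t. LINT \<omega>|lborel. phase t (Complex s \<omega>)) \<in> borel_measurable borel"
    by (intro lborel.borel_measurable_lebesgue_integral) (simp add: case_prod_unfold)
  then have "(\<lambda>t. (LINT \<omega>|lborel. phase t (Complex s \<omega>)) / of_real (2 * pi)) \<in> borel_measurable borel"
    by measurable
  then show ?thesis unfolding L_kernel_phase .
qed

lemma L_kernel_pointwise:
  assumes s: "s < - \<sigma>" "\<bar>s\<bar> * h \<le> B"
  shows "cmod (L_kernel K lam s h t) \<le> exp (s * t) * (bound_const B * h powr (- \<gamma>) * (decay_L1 / h))"
proof -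
  let ?D = "\<lambda>\<omega>. bound_const B * h powr (- \<gamma>) * (1 + (h * \<omega>)\<^sup>2) powr (- (real r - \<gamma>) / 2)"
  have i: "integrable lborel ?D" using r by (intro integrable_mult_right decay_integrable) simp
  have "cmod (L_kernel K lam s h t) = cmod (LINT \<omega>|lborel. phase t (Complex s \<omega>)) / (2 * pi)"
    unfolding L_kernel_phase norm_divide norm_of_real by simp
  also have "\<dots> \<le> cmod (LINT \<omega>|lborel. phase t (Complex s \<omega>))"
  proof -
    have "1 \<le> 2 * pi" using pi_gt3 by simp
    then show ?thesis by (simp add: pos_divide_le_eq mult_le_cancel_left1)
  qed
  also have "\<dots> \<le> (LINT \<omega>|lborel. cmod (phase t (Complex s \<omega>)))" by (rule integral_norm_bound)
  also have "\<dots> \<le> (LINT \<omega>|lborel. exp (s * t) * ?D \<omega>)"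
  proof (rule Bochner_Integration.integral_mono)
    show "integrable lborel (\<lambda>\<omega>. cmod (phase t (Complex s \<omega>)))"
      by (rule integrable_norm[OF phase_line_integrable[OF s(1)]])
    show "integrable lborel (\<lambda>\<omega>. exp (s * t) * ?D \<omega>)" using i by (rule integrable_mult_right)
    show "cmod (phase t (Complex s \<omega>)) \<le> exp (s * t) * ?D \<omega>" for \<omega>
      unfolding cmod_phase_line by (intro mult_left_mono integrand_bound s) simp
  qed
  also have "\<dots> = exp (s * t) * (bound_const B * h powr (- \<gamma>) * (decay_L1 / h))"
    unfolding decay_L1_def using r by (simp only: integral_mult_right_zero) (subst decay_integrable(2), auto)
  finally show ?thesis .
qed

text \<open>Up to the factor \<open>exp (s t) / (2 \<pi>)\<close>, \<open>L_h\<close> is the Fourier integral of a function bounded by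
\<open>deconvolution_integrand_bound\<close>, so this is Plancherel's inequality.\<close>

lemma L_kernel_square:
  assumes s: "s < - \<sigma>" "\<bar>s\<bar> * h \<le> B"
  shows "(\<integral>\<^sup>+t. ennreal ((cmod (L_kernel K lam s h t))\<^sup>2 * exp (- 2 * s * t)) \<partial>lborel)
    \<le> ennreal ((bound_const B)\<^sup>2 * decay_L2 * h powr (- 2 * \<gamma> - 1))"
proof -
  let ?F = "integrand s"
  let ?D = "\<lambda>\<omega>. (bound_const B)\<^sup>2 * h powr (- 2 * \<gamma>) * (1 + (h * \<omega>)\<^sup>2) powr (- (2 * (real r - \<gamma>)) / 2)"
  have iD: "integrable lborel ?D" using r by (intro integrable_mult_right decay_integrable) simp
  have FD: "(cmod (?F \<omega>))\<^sup>2 \<le> ?D \<omega>" for \<omega>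
  proof -
    have "(cmod (?F \<omega>))\<^sup>2 \<le> (bound_const B * h powr (- \<gamma>) * (1 + (h * \<omega>)\<^sup>2) powr (- (real r - \<gamma>) / 2))\<^sup>2"
      by (intro power_mono integrand_bound s) simp
    also have "\<dots> = (bound_const B)\<^sup>2 * (h powr (- \<gamma>))\<^sup>2 * ((1 + (h * \<omega>)\<^sup>2) powr (- (real r - \<gamma>) / 2))\<^sup>2"
      by (simp only: power_mult_distrib)
    also have "(h powr (- \<gamma>))\<^sup>2 = h powr (- 2 * \<gamma>)"
      unfolding power2_eq_square powr_add[symmetric] by simp
    also have "((1 + (h * \<omega>)\<^sup>2) powr (- (real r - \<gamma>) / 2))\<^sup>2 = (1 + (h * \<omega>)\<^sup>2) powr (- (2 * (real r - \<gamma>)) / 2)"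
    proof -
      have "- (real r - \<gamma>) / 2 + - (real r - \<gamma>) / 2 = - (2 * (real r - \<gamma>)) / 2" by (simp add: field_simps)
      then show ?thesis by (simp only: power2_eq_square powr_add[symmetric])
    qed
    finally show ?thesis .
  qed
  have m: "?F \<in> borel_measurable borel" by (rule integrand_measurable[OF s(1)])
  have iF2: "integrable lborel (\<lambda>\<omega>. (cmod (?F \<omega>))\<^sup>2)"
  proof (rule Bochner_Integration.integrable_bound[OF iD])
    show "(\<lambda>\<omega>. (cmod (?F \<omega>))\<^sup>2) \<in> borel_measurable lborel" using m by simp
    show "AE \<omega> in lborel. norm ((cmod (?F \<omega>))\<^sup>2) \<le> norm (?D \<omega>)"
    proof (rule AE_I2)
      fix \<omega>
      have "norm ((cmod (?F \<omega>))\<^sup>2) = (cmod (?F \<omega>))\<^sup>2" by simp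
      also have "\<dots> \<le> ?D \<omega>" by (rule FD)
      also have "\<dots> \<le> norm (?D \<omega>)" by simp
      finally show "norm ((cmod (?F \<omega>))\<^sup>2) \<le> norm (?D \<omega>)" .
    qed
  qed
  have I2: "(LINT \<omega>|lborel. (cmod (?F \<omega>))\<^sup>2) \<le> (bound_const B)\<^sup>2 * decay_L2 * h powr (- 2 * \<gamma> - 1)"
  proof -
    have "(LINT \<omega>|lborel. (cmod (?F \<omega>))\<^sup>2) \<le> (LINT \<omega>|lborel. ?D \<omega>)"
      by (rule Bochner_Integration.integral_mono[OF iF2 iD FD])
    also have "\<dots> = (bound_const B)\<^sup>2 * h powr (- 2 * \<gamma>) * (decay_L2 / h)"
      unfolding decay_L2_def using r by (simp only: integral_mult_right_zero) (subst decay_integrable(2), auto)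
    also have "\<dots> = (bound_const B)\<^sup>2 * decay_L2 * (h powr (- 2 * \<gamma>) / h)" by simp
    also have "h powr (- 2 * \<gamma>) / h = h powr (- 2 * \<gamma> - 1)"
      using h by (simp add: powr_diff)
    finally show ?thesis .
  qed
  let ?g = "\<lambda>t. LINT \<omega>|lborel. ?F \<omega> * exp (\<i> * of_real (\<omega> * t))"
  have Lg: "(cmod (L_kernel K lam s h t))\<^sup>2 * exp (- 2 * s * t) = 1 / (2 * pi)\<^sup>2 * (cmod (?g t))\<^sup>2" for t
  proof -
    have e: "\<i> * of_real (\<omega> * t) = \<i> * of_real \<omega> * of_real t" for \<omega> by simp
    have "cmod (L_kernel K lam s h t) = exp (s * t) / (2 * pi) * cmod (?g t)"
      unfolding L_kernel_def integrand_def[symmetric] norm_mult norm_of_real e by simp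
    then have "(cmod (L_kernel K lam s h t))\<^sup>2 * exp (- 2 * s * t) = (exp (s * t))\<^sup>2 * exp (- 2 * s * t) * (1 / (2 * pi)\<^sup>2 * (cmod (?g t))\<^sup>2)"
      by (simp add: power_mult_distrib power_divide)
    also have "(exp (s * t))\<^sup>2 * exp (- 2 * s * t) = 1"
      by (simp add: power2_eq_square exp_add[symmetric])
    finally show ?thesis by simp
  qed
  have "(\<integral>\<^sup>+t. ennreal ((cmod (L_kernel K lam s h t))\<^sup>2 * exp (- 2 * s * t)) \<partial>lborel)
      = (\<integral>\<^sup>+t. ennreal (1 / (2 * pi)\<^sup>2) * ennreal ((cmod (?g t))\<^sup>2) \<partial>lborel)"
    unfolding Lg by (intro nn_integral_cong) (rule ennreal_mult, auto)
  also have "\<dots> = ennreal (1 / (2 * pi)\<^sup>2) * (\<integral>\<^sup>+t. ennreal ((cmod (?g t))\<^sup>2) \<partial>lborel)"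
  proof (rule nn_integral_cmult)
    have "(\<lambda>x. ?F (snd x) * exp (\<i> * of_real (snd x * fst x))) \<in> borel_measurable (borel \<Otimes>\<^sub>M lborel)"
      using m by measurable
    then have "?g \<in> borel_measurable borel"
      by (intro lborel.borel_measurable_lebesgue_integral) (simp add: case_prod_unfold)
    then show "(\<lambda>t. ennreal ((cmod (?g t))\<^sup>2)) \<in> borel_measurable lborel" by simp
  qed
  also have "\<dots> \<le> ennreal (1 / (2 * pi)\<^sup>2) * ennreal (2 * pi * (LINT \<omega>|lborel. (cmod (?F \<omega>))\<^sup>2))"
    by (intro mult_left_mono plancherel_le integrand_integrable s iF2) simp
  also have "\<dots> = ennreal (1 / (2 * pi) * (LINT \<omega>|lborel. (cmod (?F \<omega>))\<^sup>2))"
    by (subst ennreal_mult[symmetric]) (auto simp: power2_eq_square)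
  also have "\<dots> \<le> ennreal (1 * (LINT \<omega>|lborel. (cmod (?F \<omega>))\<^sup>2))"
    using pi_gt3 by (intro ennreal_leI mult_right_mono) auto
  also have "\<dots> \<le> ennreal ((bound_const B)\<^sup>2 * decay_L2 * h powr (- 2 * \<gamma> - 1))"
    using I2 by (intro ennreal_leI) simp
  finally show ?thesis .
qed

text \<open>Fourier inversion of \<open>exp (- s t) K(t/h) / h\<close>, whose Fourier transform is the Laplace transform of \<open>K\<close>
on the line \<open>Re z = s\<close>, rescaled by \<open>h\<close>.\<close>

lemma kernel_fourier:
  "(LINT \<omega>|lborel. bilateral_laplace K (Complex s \<omega> * of_real h) * exp (Complex s \<omega> * of_real v))
    = of_real (2 * pi * (K (v / h) / h))"
proof -
  define f where "f t = complex_of_real (exp (- s * t) * (K (t / h) / h))" for t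
  have cont: "continuous_on UNIV f"
    unfolding f_def using h
    by (intro continuous_intros continuous_on_compose2[OF K_cont]) auto
  have sup: "f t = 0" if "t \<notin> {0..h}" for t
    using K_support[of "t / h"] that h by (auto simp: f_def field_simps)
  have int: "integrable lborel f"
  proof -
    have "set_integrable lborel {0..h} f"
      by (intro borel_integrable_atLeastAtMost' continuous_on_subset[OF cont]) auto
    then show ?thesis unfolding set_integrable_def
      by (rule Bochner_Integration.integrable_cong[THEN iffD1, OF refl, rotated])
        (use sup in \<open>auto simp: indicator_def\<close>)
  qed
  have bnd: "cmod (f t) \<le> exp (\<bar>s\<bar> * h) * (C / h)" for t
  proof (cases "t \<in> {0..h}")
    case True
    have "- s * t \<le> \<bar>s\<bar> * h" using True by (intro mult_mono) auto
    then have "exp (- s * t) \<le> exp (\<bar>s\<bar> * h)" by simp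
    moreover have "\<bar>K (t / h)\<bar> / h \<le> C / h" using h K_bound by (intro divide_right_mono) auto
    ultimately have "exp (- s * t) * (\<bar>K (t / h)\<bar> / h) \<le> exp (\<bar>s\<bar> * h) * (C / h)"
      using h by (intro mult_mono) auto
    then show ?thesis using h by (simp add: f_def abs_mult norm_mult norm_divide)
  next
    case False
    then show ?thesis using sup[OF False] kernel_C_nonneg[OF K] h by simp
  qed
  have F: "(LINT t|lborel. f t * exp (- \<i> * of_real (\<omega> * t))) = bilateral_laplace K (Complex s \<omega> * of_real h)" for \<omega>
  proof -
    have "(LINT t|lborel. f t * exp (- \<i> * of_real (\<omega> * t)))
        = \<bar>h\<bar> *\<^sub>R (LINT u|lborel. f (0 + h * u) * exp (- \<i> * of_real (\<omega> * (0 + h * u))))"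
      using h by (intro lborel_integral_real_affine) simp
    also have "\<dots> = (LINT u|lborel. \<bar>h\<bar> *\<^sub>R (f (0 + h * u) * exp (- \<i> * of_real (\<omega> * (0 + h * u)))))"
      by (rule integral_scaleR_right[symmetric])
    also have "\<dots> = bilateral_laplace K (Complex s \<omega> * of_real h)"
      unfolding bilateral_laplace_def
    proof (intro Bochner_Integration.integral_cong refl)
      fix u
      have "- (Complex s \<omega> * of_real h) * of_real u = of_real (- s * (h * u)) + - \<i> * of_real (\<omega> * (h * u))"
        by (simp add: complex_eq_iff)
      then have "exp (- (Complex s \<omega> * of_real h) * of_real u) = of_real (exp (- s * (h * u))) * exp (- \<i> * of_real (\<omega> * (h * u)))"
        by (simp only: exp_add exp_of_real)
      then show "\<bar>h\<bar> *\<^sub>R (f (0 + h * u) * exp (- \<i> * of_real (\<omega> * (0 + h * u))))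
        = exp (- (Complex s \<omega> * of_real h) * of_real u) * of_real (K u)"
        using h by (simp add: f_def scaleR_conv_of_real)
    qed
    finally show ?thesis .
  qed
  have Fi: "integrable lborel (\<lambda>\<omega>. bilateral_laplace K (Complex s \<omega> * of_real h))"
  proof (rule Bochner_Integration.integrable_bound)
    show "integrable lborel (\<lambda>\<omega>. 2 powr (r / 2) * C * exp \<bar>s * h\<bar> * (1 + (h * \<omega>)\<^sup>2) powr (- real r / 2))"
      using r pos by (intro integrable_mult_right decay_integrable) simp
    have "continuous_on UNIV (\<lambda>\<omega>. bilateral_laplace K (Complex s \<omega> * of_real h))"
      by (rule continuous_on_compose2[OF holomorphic_on_imp_continuous_on[OF K_laplace_holomorphic]])
        (auto intro!: continuous_intros simp: Complex_eq)
    then show "(\<lambda>\<omega>. bilateral_laplace K (Complex s \<omega> * of_real h)) \<in> borel_measurable lborel"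
      by (simp add: borel_measurable_continuous_onI)
    show "AE \<omega> in lborel. norm (bilateral_laplace K (Complex s \<omega> * of_real h))
        \<le> norm (2 powr (r / 2) * C * exp \<bar>s * h\<bar> * (1 + (h * \<omega>)\<^sup>2) powr (- real r / 2))"
    proof (rule AE_I2)
      fix \<omega>
      have "norm (bilateral_laplace K (Complex s \<omega> * of_real h)) \<le> 2 powr (r / 2) * C * exp \<bar>s * h\<bar> * (1 + (h * \<omega>)\<^sup>2) powr (- real r / 2)"
        using kernel_laplace_decay[OF K, of "Complex s \<omega> * of_real h"] by (simp add: mult.commute)
      also have "\<dots> \<le> norm \<dots>" by simp
      finally show "norm (bilateral_laplace K (Complex s \<omega> * of_real h))
        \<le> norm (2 powr (r / 2) * C * exp \<bar>s * h\<bar> * (1 + (h * \<omega>)\<^sup>2) powr (- real r / 2))" .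
    qed
  qed
  have "(LINT \<omega>|lborel. bilateral_laplace K (Complex s \<omega> * of_real h) * exp (Complex s \<omega> * of_real v))
      = (LINT \<omega>|lborel. of_real (exp (s * v)) * (bilateral_laplace K (Complex s \<omega> * of_real h) * exp (\<i> * of_real (\<omega> * v))))"
  proof (intro Bochner_Integration.integral_cong refl)
    fix \<omega>
    have "Complex s \<omega> * of_real v = of_real (s * v) + \<i> * of_real (\<omega> * v)" by (simp add: complex_eq_iff)
    then have "exp (Complex s \<omega> * of_real v) = of_real (exp (s * v)) * exp (\<i> * of_real (\<omega> * v))"
      by (simp only: exp_add exp_of_real)
    then show "bilateral_laplace K (Complex s \<omega> * of_real h) * exp (Complex s \<omega> * of_real v)
      = of_real (exp (s * v)) * (bilateral_laplace K (Complex s \<omega> * of_real h) * exp (\<i> * of_real (\<omega> * v)))" by simp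
  qed
  also have "\<dots> = of_real (exp (s * v)) * (2 * pi * f v)"
    using fourier_inversion[OF int cont bnd, of v] Fi unfolding F by (simp only: integral_mult_right_zero)
  also have "\<dots> = of_real (exp (s * v) * exp (- s * v) * (2 * pi * (K (v / h) / h)))"
    by (simp add: f_def)
  also have "exp (s * v) * exp (- s * v) = 1" by (simp add: exp_add[symmetric])
  finally show ?thesis by simp
qed

lemma lam_shift_int:
  assumes s: "s < - \<sigma>"
  shows "integrable lborel (\<lambda>t. exp (s * t) * lam (t - v))"
    and "(LINT t|lborel. exp (s * t) * lam (t - v)) = exp (s * v) * (LINT u|lborel. exp (s * u) * lam u)"
proof -
  have i: "integrable lborel (\<lambda>u. exp (s * u) * lam u)" using lam_int[of "- s"] s by simp
  have e: "exp (s * t) * lam (t - v) = exp (s * v) * (exp (s * (- v + 1 * t)) * lam (- v + 1 * t))" for t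
  proof -
    have "exp (s * v) * exp (s * (- v + 1 * t)) = exp (s * t)" by (simp add: exp_add[symmetric] algebra_simps)
    then show ?thesis by (simp add: mult.assoc[symmetric])
  qed
  show "integrable lborel (\<lambda>t. exp (s * t) * lam (t - v))"
    unfolding e using lborel_integrable_real_affine[OF i, of 1 "- v"] by (intro integrable_mult_right) simp
  show "(LINT t|lborel. exp (s * t) * lam (t - v)) = exp (s * v) * (LINT u|lborel. exp (s * u) * lam u)"
    unfolding e integral_mult_right_zero
    using lborel_integral_real_affine[of 1 "\<lambda>u. exp (s * u) * lam u" "- v"] by simp
qed

text \<open>Fubini: integrating \<open>exp (z t)\<close> against the translated intensity yields the Laplace transform of the
intensity, which cancels the denominator of the integrand.\<close>

lemma L_kernel_reproduces:
  assumes s: "s < - \<sigma>"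
  shows "(LINT t|lborel. L_kernel K lam s h t * of_real (lam (t - v))) = of_real (K (v / h) / h)"
proof -
  define q where "q t \<omega> = phase t (Complex s \<omega>) * of_real (lam (t - v))" for t \<omega>
  have [measurable]: "(\<lambda>x. q (fst x) (snd x)) \<in> borel_measurable (lborel \<Otimes>\<^sub>M lborel)"
    unfolding q_def using phase_line_measurable[OF s] by measurable
  have nq: "norm (q t \<omega>) = exp (s * t) * lam (t - v) * cmod (integrand s \<omega>)" for t \<omega>
    unfolding q_def norm_mult cmod_phase_line norm_of_real by (simp add: lam_nonneg)
  note [measurable] = integrand_measurable[OF s]
  have iq: "integrable (lborel \<Otimes>\<^sub>M lborel) (\<lambda>x. q (fst x) (snd x))"
  proof (rule integrableI_bounded)
    have "(\<integral>\<^sup>+x. ennreal (norm (q (fst x) (snd x))) \<partial>(lborel \<Otimes>\<^sub>M lborel))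
        = (\<integral>\<^sup>+t. \<integral>\<^sup>+\<omega>. ennreal (exp (s * t) * lam (t - v)) * ennreal (cmod (integrand s \<omega>)) \<partial>lborel \<partial>lborel)"
      by (subst lborel.nn_integral_fst[symmetric], measurable)
        (simp only: fst_conv snd_conv nq, intro nn_integral_cong ennreal_mult, auto simp: lam_nonneg)
    also have "\<dots> = (\<integral>\<^sup>+t. ennreal (exp (s * t) * lam (t - v)) \<partial>lborel) * (\<integral>\<^sup>+\<omega>. ennreal (cmod (integrand s \<omega>)) \<partial>lborel)"
      by (rule nn_integral_times) measurable
    also have "\<dots> < \<infinity>"
      using lam_shift_int(1)[OF s, of v] integrand_integrable[OF s]
      by (simp add: integrable_iff_bounded ennreal_mult_less_top abs_mult lam_nonneg)
    finally show "(\<integral>\<^sup>+x. ennreal (norm (q (fst x) (snd x))) \<partial>(lborel \<Otimes>\<^sub>M lborel)) < \<infinity>" .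
  qed measurable
  have inner: "(LINT t|lborel. q t \<omega>) = bilateral_laplace K (Complex s \<omega> * of_real h) * exp (Complex s \<omega> * of_real v)" for \<omega>
  proof -
    let ?z = "Complex s \<omega>"
    let ?a = "bilateral_laplace K (?z * of_real h) / bilateral_laplace lam (- ?z)"
    have "(LINT t|lborel. q t \<omega>) = \<bar>1\<bar> *\<^sub>R (LINT u|lborel. q (v + 1 * u) \<omega>)"
      by (rule lborel_integral_real_affine) simp
    also have "\<dots> = (LINT u|lborel. ?a * exp (?z * of_real v) * (exp (- (- ?z) * of_real u) * of_real (lam u)))"
      by (simp add: q_def phase_def distrib_left exp_add mult_ac)
    also have "\<dots> = ?a * exp (?z * of_real v) * bilateral_laplace lam (- ?z)"
      unfolding bilateral_laplace_def by (rule integral_mult_right_zero)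
    also have "\<dots> = bilateral_laplace K (?z * of_real h) * exp (?z * of_real v)"
      using lam_laplace_nz[of "- ?z"] s by simp
    finally show ?thesis .
  qed
  have "(LINT t|lborel. L_kernel K lam s h t * of_real (lam (t - v)))
      = (LINT t|lborel. (LINT \<omega>|lborel. q t \<omega>) / of_real (2 * pi))"
    unfolding L_kernel_phase q_def by (simp only: integral_mult_left_zero times_divide_eq_left)
  also have "\<dots> = (LINT t|lborel. LINT \<omega>|lborel. q t \<omega>) / of_real (2 * pi)"
    by (rule integral_divide_zero)
  also have "(LINT t|lborel. LINT \<omega>|lborel. q t \<omega>) = (LINT \<omega>|lborel. LINT t|lborel. q t \<omega>)"
    using lborel_pair.Fubini_integral[of q] iq by (simp add: case_prod_unfold)
  also have "\<dots> = of_real (2 * pi * (K (v / h) / h))"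
    unfolding inner by (rule kernel_fourier)
  finally show ?thesis by simp
qed

text \<open>Fubini again, with \<open>S\<close> the tail of the service time distribution: the reproducing property is integrated
against \<open>S\<close>.\<close>

lemma deconvolution_identity:
  fixes S :: "real \<Rightarrow> real"
  assumes s: "s < - \<sigma>" and S [measurable]: "S \<in> borel_measurable borel"
    and S0: "\<And>v. 0 \<le> S v" "\<And>v. v < 0 \<Longrightarrow> S v = 0" and Si: "integrable lborel S"
  shows "integrable lborel (\<lambda>t. L_kernel K lam s h (t - x) * of_real (LINT v|lborel. lam (t - v) * S v))"
    and "(LINT t|lborel. L_kernel K lam s h (t - x) * of_real (LINT v|lborel. lam (t - v) * S v))
      = of_real (LINT u|lborel. K u * S (x + h * u))"
proof -
  let ?L = "L_kernel K lam s h"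
  note [measurable] = L_kernel_measurable[OF s]
  define b where "b = bound_const (\<bar>s\<bar> * h) * h powr (- \<gamma>) * (decay_L1 / h)"
  have Lb: "cmod (?L t) \<le> exp (s * t) * b" for t
    unfolding b_def by (rule L_kernel_pointwise[OF s order_refl])
  have b: "0 \<le> b" using order_trans[OF norm_ge_zero Lb[of 0]] by simp
  define q where "q t v = ?L (t - x) * of_real (lam (t - v) * S v)" for t v
  have [measurable]: "(\<lambda>x. q (fst x) (snd x)) \<in> borel_measurable (lborel \<Otimes>\<^sub>M lborel)"
    unfolding q_def by measurable
  have iq: "integrable (lborel \<Otimes>\<^sub>M lborel) (\<lambda>x. q (fst x) (snd x))"
  proof (rule integrableI_bounded)
    let ?c = "b * exp (- s * x) * (LINT u|lborel. exp (s * u) * lam u)"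
    have c: "0 \<le> ?c" using b by (intro mult_nonneg_nonneg integral_nonneg_AE AE_I2) (auto simp: lam_nonneg)
    have "(\<integral>\<^sup>+x. ennreal (norm (q (fst x) (snd x))) \<partial>(lborel \<Otimes>\<^sub>M lborel))
        = (\<integral>\<^sup>+v. \<integral>\<^sup>+t. ennreal (norm (q t v)) \<partial>lborel \<partial>lborel)"
      by (subst lborel_pair.nn_integral_snd[symmetric]) auto
    also have "\<dots> \<le> (\<integral>\<^sup>+v. ennreal (?c * S v) \<partial>lborel)"
    proof (rule nn_integral_mono)
      fix v
      have "(\<integral>\<^sup>+t. ennreal (norm (q t v)) \<partial>lborel)
          \<le> (\<integral>\<^sup>+t. ennreal (b * exp (- s * x) * S v * (exp (s * t) * lam (t - v))) \<partial>lborel)"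
      proof (intro nn_integral_mono ennreal_leI)
        fix t
        have "norm (q t v) = cmod (?L (t - x)) * (lam (t - v) * S v)"
          unfolding q_def norm_mult norm_of_real by (simp add: lam_nonneg S0 abs_mult)
        also have "\<dots> \<le> exp (s * (t - x)) * b * (lam (t - v) * S v)"
          by (intro mult_right_mono Lb) (simp add: lam_nonneg S0)
        also have "exp (s * (t - x)) = exp (- s * x) * exp (s * t)"
          by (simp add: exp_add[symmetric] algebra_simps)
        finally show "norm (q t v) \<le> b * exp (- s * x) * S v * (exp (s * t) * lam (t - v))"
          by (simp add: mult_ac)
      qed
      also have "\<dots> = ennreal (b * exp (- s * x) * S v * (exp (s * v) * (LINT u|lborel. exp (s * u) * lam u)))"
        using b lam_shift_int[OF s, of v]
        by (subst nn_integral_eq_integral) (auto simp: lam_nonneg S0)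
      also have "\<dots> \<le> ennreal (?c * S v)"
      proof (rule ennreal_leI)
        have "exp (s * v) * S v \<le> 1 * S v"
        proof (cases "v < 0")
          case False
          then have "exp (s * v) \<le> 1" using s pos by (simp add: mult_nonpos_nonneg)
          then show ?thesis by (intro mult_right_mono S0)
        qed (simp add: S0)
        then have "?c * (exp (s * v) * S v) \<le> ?c * (1 * S v)" by (intro mult_left_mono c)
        then show "b * exp (- s * x) * S v * (exp (s * v) * (LINT u|lborel. exp (s * u) * lam u)) \<le> ?c * S v"
          by (simp add: mult_ac)
      qed
      finally show "(\<integral>\<^sup>+t. ennreal (norm (q t v)) \<partial>lborel) \<le> ennreal (?c * S v)" .
    qed
    also have "\<dots> = ennreal (LINT v|lborel. ?c * S v)"
      using Si c by (intro nn_integral_eq_integral) (auto simp: S0)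
    also have "\<dots> < \<infinity>" by simp
    finally show "(\<integral>\<^sup>+x. ennreal (norm (q (fst x) (snd x))) \<partial>(lborel \<Otimes>\<^sub>M lborel)) < \<infinity>" .
  qed measurable
  have qt: "(LINT v|lborel. q t v) = ?L (t - x) * of_real (LINT v|lborel. lam (t - v) * S v)" for t
    unfolding q_def by (simp only: integral_mult_right_zero integral_complex_of_real)
  show "integrable lborel (\<lambda>t. ?L (t - x) * of_real (LINT v|lborel. lam (t - v) * S v))"
    using lborel_pair.integrable_fst'[OF iq] by (simp add: qt)
  have inner: "(LINT t|lborel. q t v) = of_real (K ((v - x) / h) / h) * of_real (S v)" for v
  proof -
    have "(LINT t|lborel. q t v) = \<bar>1\<bar> *\<^sub>R (LINT t|lborel. q (x + 1 * t) v)"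
      by (rule lborel_integral_real_affine) simp
    also have "\<dots> = (LINT t|lborel. ?L t * of_real (lam (t - (v - x))) * of_real (S v))"
      by (simp add: q_def algebra_simps)
    also have "\<dots> = of_real (K ((v - x) / h) / h) * of_real (S v)"
      by (simp only: integral_mult_left_zero L_kernel_reproduces[OF s])
    finally show ?thesis .
  qed
  have "(LINT t|lborel. ?L (t - x) * of_real (LINT v|lborel. lam (t - v) * S v)) = (LINT t|lborel. LINT v|lborel. q t v)"
    unfolding qt ..
  also have "\<dots> = (LINT v|lborel. LINT t|lborel. q t v)"
    using lborel_pair.Fubini_integral[of q] iq by (simp add: case_prod_unfold)
  also have "\<dots> = of_real (LINT v|lborel. K ((v - x) / h) / h * S v)"
    unfolding inner by (simp only: of_real_mult[symmetric] integral_complex_of_real)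
  also have "(LINT v|lborel. K ((v - x) / h) / h * S v) = \<bar>h\<bar> *\<^sub>R (LINT u|lborel. K ((x + h * u - x) / h) / h * S (x + h * u))"
    using h by (intro lborel_integral_real_affine) simp
  also have "\<dots> = (LINT u|lborel. \<bar>h\<bar> *\<^sub>R (K ((x + h * u - x) / h) / h * S (x + h * u)))"
    by (rule integral_scaleR_right[symmetric])
  also have "\<dots> = (LINT u|lborel. K u * S (x + h * u))"
    using h by (intro Bochner_Integration.integral_cong refl) simp
  finally show "(LINT t|lborel. ?L (t - x) * of_real (LINT v|lborel. lam (t - v) * S v))
      = of_real (LINT u|lborel. K u * S (x + h * u))" .
qed

end

section \<open>Bias of kernel smoothing, and growth of the intensity\<close>

lemma strict_floor_bounds:
  assumes "0 < \<beta>" shows "real (strict_floor \<beta>) < \<beta>"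
proof -
  obtain N where "\<beta> \<le> real N" using real_arch_simple by blast
  then have "{k::nat. real k < \<beta>} \<subseteq> {..N}" by auto
  then have "finite {k::nat. real k < \<beta>}" by (rule finite_subset) simp
  moreover have "0 \<in> {k::nat. real k < \<beta>}" using assms by simp
  ultimately have "strict_floor \<beta> \<in> {k. real k < \<beta>}"
    unfolding strict_floor_def by (intro Max_in) blast+
  then show ?thesis by simp
qed

text \<open>Taylor's formula with Lagrange remainder of order \<open>strict_floor \<beta>\<close>; the Hoelder condition compares the
derivative at the intermediate point with that at \<open>x\<close>.\<close>

lemma holder_taylor:
  assumes G: "G \<in> holder_class d \<beta> x A" and b: "0 < \<beta>" and A: "0 \<le> A" and y: "0 \<le> y" "y < d"
  shows "\<bar>G (x + y) - (\<Sum>j\<le>strict_floor \<beta>. (deriv ^^ j) G x / fact j * y ^ j)\<bar> \<le> A * y powr \<beta>"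
proof -
  define l where "l = strict_floor \<beta>"
  have lb: "real l < \<beta>" using strict_floor_bounds[OF b] by (simp add: l_def)
  let ?I = "{x - d<..<x + d}"
  have dif: "(deriv ^^ j) G differentiable_on ?I" if "j < l" for j
    using G that by (auto simp: holder_class_def times_cont_diff_on_def l_def)
  have ho: "\<bar>(deriv ^^ l) G t - (deriv ^^ l) G x\<bar> \<le> A * \<bar>t - x\<bar> powr (\<beta> - real l)" if "t \<in> ?I" for t
    using G that y by (auto simp: holder_class_def l_def)
  show ?thesis
  proof (cases "y = 0")
    case True
    have "(\<Sum>j\<le>l. (deriv ^^ j) G x / fact j * 0 ^ j) = (\<Sum>j\<in>{0}. (deriv ^^ j) G x / fact j * 0 ^ j)"
      by (rule sum.mono_neutral_right) auto
    with True show ?thesis by (simp add: l_def[symmetric])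
  next
    case False
    with y have y0: "0 < y" by simp
    have "\<exists>t. x < t \<and> t \<le> x + y \<and> G (x + y) = (\<Sum>j<l. (deriv ^^ j) G x / fact j * y ^ j) + (deriv ^^ l) G t / fact l * y ^ l"
    proof (cases "l = 0")
      case True
      then show ?thesis using y0 by (intro exI[of _ "x + y"]) simp
    next
      case False
      have "\<forall>m t. m < l \<and> x \<le> t \<and> t \<le> x + y \<longrightarrow> DERIV ((deriv ^^ m) G) t :> (deriv ^^ Suc m) G t"
      proof (intro allI impI)
        fix j t assume j: "j < l \<and> x \<le> t \<and> t \<le> x + y"
        then have "t \<in> ?I" using y by auto
        then have "(deriv ^^ j) G differentiable (at t)"
          using dif[of j] j by (simp add: differentiable_on_eq_differentiable_at)
        then show "DERIV ((deriv ^^ j) G) t :> (deriv ^^ Suc j) G t"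
          by (simp add: DERIV_deriv_iff_real_differentiable)
      qed
      from Taylor_up[of l "\<lambda>j. (deriv ^^ j) G" G x "x + y" x] False this y0
      obtain t where "x < t" "t < x + y" "G (x + y) = (\<Sum>m<l. (deriv ^^ m) G x / fact m * y ^ m) + (deriv ^^ l) G t / fact l * y ^ l"
        by auto
      then show ?thesis by (intro exI[of _ t]) auto
    qed
    then obtain t where t: "x < t" "t \<le> x + y"
      "G (x + y) = (\<Sum>j<l. (deriv ^^ j) G x / fact j * y ^ j) + (deriv ^^ l) G t / fact l * y ^ l" by blast
    have "G (x + y) - (\<Sum>j\<le>l. (deriv ^^ j) G x / fact j * y ^ j)
        = ((deriv ^^ l) G t - (deriv ^^ l) G x) / fact l * y ^ l"
      unfolding t(3) by (simp add: lessThan_Suc_atMost[symmetric] diff_divide_distrib left_diff_distrib)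
    then have "\<bar>G (x + y) - (\<Sum>j\<le>l. (deriv ^^ j) G x / fact j * y ^ j)\<bar>
        = \<bar>(deriv ^^ l) G t - (deriv ^^ l) G x\<bar> / fact l * y ^ l"
      using y0 by (simp add: abs_mult)
    also have "\<dots> \<le> \<bar>(deriv ^^ l) G t - (deriv ^^ l) G x\<bar> / 1 * y ^ l"
      using y0 by (intro mult_right_mono divide_left_mono) auto
    also have "\<dots> \<le> A * y powr (\<beta> - real l) * y ^ l"
    proof -
      have "t \<in> ?I" using t y by auto
      from ho[OF this] have "\<bar>(deriv ^^ l) G t - (deriv ^^ l) G x\<bar> \<le> A * \<bar>t - x\<bar> powr (\<beta> - real l)" .
      also have "\<dots> \<le> A * y powr (\<beta> - real l)"
        using t lb A by (intro mult_left_mono powr_mono2) auto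
      finally show ?thesis using y0 by (intro mult_right_mono) auto
    qed
    also have "\<dots> = A * (y powr (\<beta> - real l) * y powr real l)"
      using y0 by (simp add: powr_realpow)
    also have "\<dots> = A * y powr \<beta>"
      by (simp add: powr_add[symmetric])
    finally show ?thesis by (simp add: l_def)
  qed
qed

text \<open>The Taylor polynomial integrates to \<open>G x\<close> because the moments of \<open>K\<close> of positive order vanish; what
remains is the error in \<open>holder_taylor\<close>.\<close>

lemma kernel_bias:
  assumes K: "admissible_kernel K m r C" and G: "G \<in> holder_class d \<beta> x A" and b: "0 < \<beta>"
    and A: "0 \<le> A" and h: "0 < h" "h < d" and m: "strict_floor \<beta> + 1 \<le> m"
    and Gm [measurable]: "G \<in> borel_measurable borel" and G01: "\<And>t. 0 \<le> G t" "\<And>t. G t \<le> 1"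
  shows "\<bar>(LINT u|lborel. K u * (1 - G (x + h * u))) - (1 - G x)\<bar> \<le> C * A * h powr \<beta>"
proof -
  have Kc: "continuous_on UNIV K" and K0: "t \<notin> {0..1} \<Longrightarrow> K t = 0" and KC: "\<bar>K t\<bar> \<le> C" for t
    using kernel_cont[OF K, of 0] kernel_support[OF K, of 0 t] kernel_bound[OF K, of 0 t] by simp_all
  have [measurable]: "K \<in> borel_measurable borel" by (rule borel_measurable_continuous_onI[OF Kc])
  have C: "0 \<le> C" by (rule kernel_C_nonneg[OF K])
  have int: "integrable lborel (\<lambda>u. K u * g u)"
    if [measurable]: "g \<in> borel_measurable borel" and gB: "\<And>u. u \<in> {0..1} \<Longrightarrow> \<bar>g u\<bar> \<le> B" for g B
  proof (rule Bochner_Integration.integrable_bound)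
    show "integrable lborel (\<lambda>u::real. indicator {0..1} u * (C * B))" by simp
    show "AE u in lborel. norm (K u * g u) \<le> norm (indicator {0..1} u * (C * B))"
    proof (rule AE_I2)
      fix u :: real
      show "norm (K u * g u) \<le> norm (indicator {0..1} u * (C * B))"
      proof (cases "u \<in> {0..1}")
        case True
        have "\<bar>K u\<bar> * \<bar>g u\<bar> \<le> C * B" using gB[OF True] KC[of u] C by (intro mult_mono) auto
        then have "\<bar>K u\<bar> * \<bar>g u\<bar> \<le> \<bar>C * B\<bar>" by linarith
        then show ?thesis using True by (simp add: abs_mult)
      qed (simp add: K0)
    qed
  qed measurable
  have mom: "(LINT u|lborel. K u * u ^ j) = (if j = 0 then 1 else 0)" if "j \<le> m" for j
  proof -
    have "(LINT u|lborel. K u * u ^ j) = (LBINT u:{0..1}. u ^ j * K u)"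
      unfolding set_lebesgue_integral_def
      by (intro Bochner_Integration.integral_cong) (auto simp: indicator_def K0)
    then show ?thesis using K that by (auto simp: admissible_kernel_def)
  qed
  define l where "l = strict_floor \<beta>"
  define c where "c j = (deriv ^^ j) G x / fact j * h ^ j" for j
  have cG: "c 0 = G x" by (simp add: c_def)
  have iu: "integrable lborel (\<lambda>u. K u * u ^ j)" for j
    by (rule int[of _ 1]) (auto simp: power_abs power_le_one)
  have poly: "(LINT u|lborel. (\<Sum>j\<le>l. c j * (K u * u ^ j))) = G x"
  proof -
    have "(LINT u|lborel. (\<Sum>j\<le>l. c j * (K u * u ^ j))) = (\<Sum>j\<le>l. (LINT u|lborel. c j * (K u * u ^ j)))"
      by (rule Bochner_Integration.integral_sum) (intro integrable_mult_right iu)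
    also have "\<dots> = (\<Sum>j\<le>l. c j * (LINT u|lborel. K u * u ^ j))"
      by (simp only: integral_mult_right_zero)
    also have "\<dots> = (\<Sum>j\<le>l. (if j = 0 then c 0 else 0))"
      using m by (intro sum.cong refl) (auto simp: mom l_def)
    also have "\<dots> = G x" by (simp add: cG)
    finally show ?thesis .
  qed
  have iK: "integrable lborel K" using iu[of 0] by simp
  have iG: "integrable lborel (\<lambda>u. K u * G (x + h * u))"
    by (rule int[of _ 1]) (auto simp: G01)
  have ip: "integrable lborel (\<lambda>u. \<Sum>j\<le>l. c j * (K u * u ^ j))"
    by (intro Bochner_Integration.integrable_sum integrable_mult_right iu)
  have "(LINT u|lborel. K u * (1 - G (x + h * u))) = (LINT u|lborel. K u * u ^ 0) - (LINT u|lborel. K u * G (x + h * u))"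
    using Bochner_Integration.integral_diff[OF iK iG] by (simp add: right_diff_distrib)
  then have "(LINT u|lborel. K u * (1 - G (x + h * u))) - (1 - G x)
      = (LINT u|lborel. (\<Sum>j\<le>l. c j * (K u * u ^ j))) - (LINT u|lborel. K u * G (x + h * u))"
    unfolding poly using mom[of 0] by simp
  also have "\<dots> = (LINT u|lborel. (\<Sum>j\<le>l. c j * (K u * u ^ j)) - K u * G (x + h * u))"
    by (rule Bochner_Integration.integral_diff[symmetric, OF ip iG])
  finally have eq: "(LINT u|lborel. K u * (1 - G (x + h * u))) - (1 - G x)
      = (LINT u|lborel. (\<Sum>j\<le>l. c j * (K u * u ^ j)) - K u * G (x + h * u))" .
  have "\<bar>LINT u|lborel. (\<Sum>j\<le>l. c j * (K u * u ^ j)) - K u * G (x + h * u)\<bar>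
      \<le> (LINT u|lborel. \<bar>(\<Sum>j\<le>l. c j * (K u * u ^ j)) - K u * G (x + h * u)\<bar>)"
    by (rule integral_abs_bound)
  also have "\<dots> \<le> (LINT u::real|lborel. indicator {0..1} u * (C * (A * h powr \<beta>)))"
  proof (rule Bochner_Integration.integral_mono)
    show "integrable lborel (\<lambda>u. \<bar>(\<Sum>j\<le>l. c j * (K u * u ^ j)) - K u * G (x + h * u)\<bar>)"
      by (intro integrable_abs Bochner_Integration.integrable_diff ip iG)
    fix u :: real
    show "\<bar>(\<Sum>j\<le>l. c j * (K u * u ^ j)) - K u * G (x + h * u)\<bar> \<le> indicator {0..1} u * (C * (A * h powr \<beta>))"
    proof (cases "u \<in> {0..1}")
      case True
      have hu: "0 \<le> h * u" "h * u \<le> h" using True h by (auto simp: mult_left_le)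
      have "(\<Sum>j\<le>l. c j * (K u * u ^ j)) = K u * (\<Sum>j\<le>l. (deriv ^^ j) G x / fact j * (h * u) ^ j)"
        unfolding sum_distrib_left by (intro sum.cong refl) (simp add: c_def power_mult_distrib)
      then have "(\<Sum>j\<le>l. c j * (K u * u ^ j)) - K u * G (x + h * u)
          = K u * ((\<Sum>j\<le>l. (deriv ^^ j) G x / fact j * (h * u) ^ j) - G (x + h * u))"
        by (simp only: right_diff_distrib)
      then have "\<bar>(\<Sum>j\<le>l. c j * (K u * u ^ j)) - K u * G (x + h * u)\<bar>
          = \<bar>K u\<bar> * \<bar>G (x + h * u) - (\<Sum>j\<le>l. (deriv ^^ j) G x / fact j * (h * u) ^ j)\<bar>"
        by (simp add: abs_mult abs_minus_commute)
      also have "\<dots> \<le> C * (A * (h * u) powr \<beta>)"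
      proof (intro mult_mono KC)
        show "\<bar>G (x + h * u) - (\<Sum>j\<le>l. (deriv ^^ j) G x / fact j * (h * u) ^ j)\<bar> \<le> A * (h * u) powr \<beta>"
          unfolding l_def by (rule holder_taylor[OF G b A]) (use hu h in linarith)+
      qed (use C in auto)
      also have "\<dots> \<le> C * (A * h powr \<beta>)"
        using hu A C b by (intro mult_left_mono powr_mono2) auto
      finally show ?thesis using True by simp
    qed (simp add: K0)
  qed simp
  also have "\<dots> = C * A * h powr \<beta>" by simp
  finally show ?thesis unfolding eq .
qed

text \<open>Apply \<open>y \<le> exp y\<close> with \<open>y = e u / p\<close> and raise it to the power \<open>p\<close>. The explicit constant is needed
because it enters the constant of the theorem, which may depend on \<open>p\<close> only.\<close>

lemma rpow_le_exp:
  assumes "0 \<le> p" "0 < e" "0 \<le> u"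
  shows "rpow u p \<le> (1 + (p / e) powr p) * exp (e * u)"
proof (cases "p = 0")
  case True
  have "1 \<le> exp (e * u)" using assms by simp
  then show ?thesis using True by (simp add: rpow_def)
next
  case False
  with assms have p: "0 < p" by simp
  have "e * u / p \<le> exp (e * u / p)" using exp_ge_add_one_self[of "e * u / p"] by linarith
  then have "u \<le> (p / e) * exp (e * u / p)" using p assms by (simp add: field_simps)
  then have "u powr p \<le> ((p / e) * exp (e * u / p)) powr p" using assms p by (intro powr_mono2) auto
  also have "\<dots> = (p / e) powr p * exp (e * u / p) powr p"
    using p assms by (subst powr_mult) auto
  also have "exp (e * u / p) powr p = exp (e * u)"
    using p by (simp add: exp_powr_real)
  finally have "u powr p \<le> (p / e) powr p * exp (e * u)" .
  then have "u powr p \<le> (1 + (p / e) powr p) * exp (e * u)"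
    unfolding distrib_right using exp_ge_zero[of "e * u"] by linarith
  then show ?thesis using p by (simp add: rpow_def)
qed

lemma rpow_mono: "0 \<le> p \<Longrightarrow> 0 \<le> s \<Longrightarrow> s \<le> t \<Longrightarrow> rpow s p \<le> rpow t p"
  by (simp add: rpow_def powr_mono2)

lemma rpow_mult: "0 \<le> s \<Longrightarrow> 0 \<le> t \<Longrightarrow> rpow (s * t) p = rpow s p * rpow t p"
  by (simp add: rpow_def powr_mult)

lemma rpow_nonneg: "0 \<le> rpow t p"
  by (simp add: rpow_def)

lemma arrival_intensity_measurable:
  assumes "arrival_intensity lam \<sigma>" shows "lam \<in> borel_measurable borel"
proof -
  have "(\<lambda>t. indicator {0..real n} t *\<^sub>R lam t) \<in> borel_measurable lborel" for n
    using assms unfolding arrival_intensity_def set_integrable_def by (blast intro: borel_measurable_integrable)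
  then have m: "(\<lambda>t. indicator {0..real n} t *\<^sub>R lam t) \<in> borel_measurable borel" for n by simp
  show ?thesis
  proof (rule borel_measurable_LIMSEQ_metric[OF m])
    fix t
    obtain N where N: "t \<le> real N" using real_arch_simple by blast
    have "eventually (\<lambda>n. indicator {0..real n} t *\<^sub>R lam t = lam t) sequentially"
      using eventually_ge_at_top[of N]
    proof eventually_elim
      case (elim n)
      then show ?case using N assms by (cases "t < 0") (auto simp: indicator_def arrival_intensity_def)
    qed
    then show "(\<lambda>n. indicator {0..real n} t *\<^sub>R lam t) \<longlonglongrightarrow> lam t" by (rule tendsto_eventually)
  qed
qed

lemma arrival_intensity_laplace:
  assumes a: "arrival_intensity lam \<sigma>" and c: "\<sigma> < c"
  shows "integrable lborel (\<lambda>t. exp (- c * t) * lam t)"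
proof -
  note [measurable] = arrival_intensity_measurable[OF a]
  have "Inf {ereal c | c. set_integrable lborel {0..} (\<lambda>t. exp (- c * t) * lam t)} < ereal c"
    using a c by (simp add: arrival_intensity_def laplace_abscissa_def)
  then obtain c' where c': "c' < c" and i: "set_integrable lborel {0..} (\<lambda>t. exp (- c' * t) * lam t)"
    by (auto simp: Inf_less_iff)
  show ?thesis
  proof (rule Bochner_Integration.integrable_bound[OF i[unfolded set_integrable_def]])
    show "AE t in lborel. norm (exp (- c * t) * lam t) \<le> norm (indicator {0..} t *\<^sub>R (exp (- c' * t) * lam t))"
    proof (rule AE_I2)
      fix t :: real
      show "norm (exp (- c * t) * lam t) \<le> norm (indicator {0..} t *\<^sub>R (exp (- c' * t) * lam t))"
      proof (cases "0 \<le> t")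
        case True
        then have "exp (- c * t) \<le> exp (- c' * t)" using c' by (simp add: mult_right_mono)
        then have "exp (- c * t) * \<bar>lam t\<bar> \<le> exp (- c' * t) * \<bar>lam t\<bar>" by (intro mult_right_mono) auto
        then show ?thesis using True by (simp add: abs_mult)
      qed (use a in \<open>simp add: arrival_intensity_def\<close>)
    qed
  qed measurable
qed

lemma intensity_exp_bound:
  assumes g: "intensity_growth lam \<sigma> lam\<^sub>0 p a\<^sub>1 a\<^sub>2" and e: "0 < e" and s: "0 \<le> \<sigma>" and l: "0 < lam\<^sub>0"
  shows "\<exists>c\<ge>0. \<forall>u\<ge>0. lam u \<le> c * exp ((\<sigma> + e) * u)"
proof (cases "0 < \<sigma>")
  case True
  have "lam u \<le> lam\<^sub>0 * exp ((\<sigma> + e) * u)" if "0 \<le> u" for u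
  proof -
    have "exp (\<sigma> * u) \<le> exp ((\<sigma> + e) * u)" using that e by (simp add: mult_right_mono)
    then have "lam\<^sub>0 * exp (\<sigma> * u) \<le> lam\<^sub>0 * exp ((\<sigma> + e) * u)" using l by (intro mult_left_mono) auto
    moreover have "lam u \<le> lam\<^sub>0 * exp (\<sigma> * u)" using g True that by (simp add: intensity_growth_def)
    ultimately show ?thesis by linarith
  qed
  then show ?thesis using l by (intro exI[of _ lam\<^sub>0]) auto
next
  case False
  then have s0: "\<sigma> = 0" using s by simp
  then have g': "0 \<le> p" "0 \<le> a\<^sub>1" "0 < a\<^sub>2" and gl: "\<And>t. 0 \<le> t \<Longrightarrow> lam t \<le> lam\<^sub>0 * (a\<^sub>1 + a\<^sub>2 * rpow t p)"
    using g by (auto simp: intensity_growth_def)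
  let ?k = "1 + (p / e) powr p"
  have "lam u \<le> (lam\<^sub>0 * (a\<^sub>1 + a\<^sub>2 * ?k)) * exp ((\<sigma> + e) * u)" if "0 \<le> u" for u
  proof -
    have "1 \<le> exp (e * u)" using that e by simp
    then have "a\<^sub>1 + a\<^sub>2 * rpow u p \<le> a\<^sub>1 * exp (e * u) + a\<^sub>2 * (?k * exp (e * u))"
      using g' rpow_le_exp[OF g'(1) e that] by (intro add_mono mult_left_mono) (auto simp: mult_left_le mult_le_cancel_left1)
    then have "lam\<^sub>0 * (a\<^sub>1 + a\<^sub>2 * rpow u p) \<le> lam\<^sub>0 * (a\<^sub>1 * exp (e * u) + a\<^sub>2 * (?k * exp (e * u)))"
      using l by (intro mult_left_mono) auto
    with gl[OF that] show ?thesis by (simp add: s0 algebra_simps)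
  qed
  moreover have "0 \<le> lam\<^sub>0 * (a\<^sub>1 + a\<^sub>2 * ?k)" using l g' by (intro mult_nonneg_nonneg add_nonneg_nonneg) auto
  ultimately show ?thesis by blast
qed

lemma nn_integral_exp_tail:
  assumes a: "0 < a" shows "(\<integral>\<^sup>+t. ennreal (exp (- a * t)) * indicator {T..} t \<partial>lborel) = ennreal (exp (- a * T) / a)"
proof -
  have "(\<integral>\<^sup>+t. ennreal (exp (- a * t)) * indicator {T..} t \<partial>lborel) = ennreal (0 - (- exp (- a * T) / a))"
  proof (rule nn_integral_FTC_atLeast)
    show "DERIV (\<lambda>t. - exp (- a * t) / a) x :> exp (- a * x)" for x
      using a by (auto intro!: derivative_eq_intros)
    show "((\<lambda>t. - exp (- a * t) / a) \<longlongrightarrow> 0) at_top"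
      using a by real_asymp
  qed auto
  then show ?thesis by simp
qed

section \<open>Mean and covariance integrals of the queue length\<close>

lemma moment_class_facts:
  assumes "G \<in> moment_class M"
  shows moment_G_mono: "mono G" and moment_G_nonneg: "0 \<le> G t" and moment_G_le_1: "G t \<le> 1"
    and moment_G_measurable: "G \<in> borel_measurable borel"
    and moment_1: "(\<integral>\<^sup>+t. of_bool (0 \<le> t) * ennreal (1 - G t) \<partial>lborel) \<le> ennreal M"
    and moment_2: "(\<integral>\<^sup>+t. of_bool (0 \<le> t) * ennreal (2 * t * (1 - G t)) \<partial>lborel) \<le> ennreal M"
proof -
  obtain \<mu> where \<mu>: "real_distribution \<mu>" "G = cdf \<mu>" using assms by (auto simp: moment_class_def)
  interpret real_distribution \<mu> by fact
  show "mono G" unfolding \<mu> by (auto intro: monoI cdf_nondecreasing)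
  then show "G \<in> borel_measurable borel" by (rule borel_measurable_mono)
  show "0 \<le> G t" unfolding \<mu> by (rule cdf_nonneg)
  show "G t \<le> 1" unfolding \<mu> by (rule cdf_bounded_prob)
  have k: "(\<integral>\<^sup>+t\<in>{0..}. ennreal (real k * t ^ (k - 1) * (1 - G t)) \<partial>lborel) \<le> ennreal M" if "k \<in> {1, 2}" for k
    using assms that unfolding moment_class_def by blast
  have ib: "indicator {0..} t = (of_bool (0 \<le> t) :: ennreal)" for t :: real by (simp add: indicator_def)
  show "(\<integral>\<^sup>+t. of_bool (0 \<le> t) * ennreal (1 - G t) \<partial>lborel) \<le> ennreal M"
    using k[of 1] by (simp add: ib mult.commute)
  show "(\<integral>\<^sup>+t. of_bool (0 \<le> t) * ennreal (2 * t * (1 - G t)) \<partial>lborel) \<le> ennreal M"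
    using k[of 2] by (simp add: ib mult.commute)
qed

text \<open>For a service time \<open>S\<close> with distribution function \<open>G\<close> this is the expectation of \<open>S\<close> on the event
\<open>S > v\<close>.\<close>

definition biased_tail :: "(real \<Rightarrow> real) \<Rightarrow> real \<Rightarrow> ennreal" where
  "biased_tail G v = (\<integral>\<^sup>+w. of_bool (0 \<le> w) * ennreal (1 - G (max v w)) \<partial>lborel)"

text \<open>The two moments in the class are the suprema over \<open>v\<close> and the integral over \<open>v\<close> of the truncated
expectation: \<open>E S \<le> M\<close> bounds the former and \<open>E S\<^sup>2 \<le> M\<close> the latter.\<close>

lemma biased_tail_bounds:
  assumes G: "G \<in> moment_class M"
  shows biased_tail_le: "biased_tail G v \<le> ennreal M"
    and biased_tail_integral: "(\<integral>\<^sup>+v. of_bool (0 \<le> v) * biased_tail G v \<partial>lborel) \<le> ennreal M"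
    and biased_tail_measurable: "biased_tail G \<in> borel_measurable borel"
proof -
  note [measurable] = moment_G_measurable[OF G]
  have mono: "1 - G (max v w) \<le> 1 - G w" for v w using moment_G_mono[OF G] by (simp add: monoD)
  have "biased_tail G v \<le> (\<integral>\<^sup>+w. of_bool (0 \<le> w) * ennreal (1 - G w) \<partial>lborel)"
    unfolding biased_tail_def by (intro nn_integral_mono mult_left_mono ennreal_leI mono) auto
  then show "biased_tail G v \<le> ennreal M" using moment_1[OF G] by (rule order_trans)
  have "(\<lambda>v. \<integral>\<^sup>+w. of_bool (0 \<le> w) * ennreal (1 - G (max v w)) \<partial>lborel) \<in> borel_measurable borel"
    by measurable
  then show "biased_tail G \<in> borel_measurable borel" by (simp add: biased_tail_def[abs_def])
  let ?f = "\<lambda>v w. of_bool (0 \<le> w \<and> w \<le> v) * ennreal (1 - G v) :: ennreal"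
  have len: "(\<integral>\<^sup>+w. ?f v w \<partial>lborel) = of_bool (0 \<le> v) * ennreal (v * (1 - G v))" for v
  proof -
    have "(\<integral>\<^sup>+w. ?f v w \<partial>lborel) = (\<integral>\<^sup>+w. ennreal (1 - G v) * indicator {0..v} w \<partial>lborel)"
      by (intro nn_integral_cong) (auto simp: indicator_def)
    also have "\<dots> = ennreal (1 - G v) * emeasure lborel {0..v}" by (rule nn_integral_cmult_indicator) simp
    also have "\<dots> = of_bool (0 \<le> v) * ennreal (v * (1 - G v))"
      using moment_G_le_1[OF G, of v] by (auto simp: ennreal_mult[symmetric] mult.commute)
    finally show ?thesis .
  qed
  have "(\<integral>\<^sup>+v. of_bool (0 \<le> v) * biased_tail G v \<partial>lborel)
      = (\<integral>\<^sup>+v. \<integral>\<^sup>+w. of_bool (0 \<le> v) * (of_bool (0 \<le> w) * ennreal (1 - G (max v w))) \<partial>lborel \<partial>lborel)"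
    unfolding biased_tail_def by (intro nn_integral_cong nn_integral_cmult[symmetric]) measurable
  also have "\<dots> \<le> (\<integral>\<^sup>+v. \<integral>\<^sup>+w. ?f v w + ?f w v \<partial>lborel \<partial>lborel)"
    by (intro nn_integral_mono) (auto simp: max_def)
  also have "\<dots> = (\<integral>\<^sup>+v. (\<integral>\<^sup>+w. ?f v w \<partial>lborel) + (\<integral>\<^sup>+w. ?f w v \<partial>lborel) \<partial>lborel)"
    by (intro nn_integral_cong nn_integral_add) measurable
  also have "\<dots> = (\<integral>\<^sup>+v. \<integral>\<^sup>+w. ?f v w \<partial>lborel \<partial>lborel) + (\<integral>\<^sup>+v. \<integral>\<^sup>+w. ?f w v \<partial>lborel \<partial>lborel)"
    by (rule nn_integral_add) measurable
  also have "(\<integral>\<^sup>+v. \<integral>\<^sup>+w. ?f w v \<partial>lborel \<partial>lborel) = (\<integral>\<^sup>+v. \<integral>\<^sup>+w. ?f v w \<partial>lborel \<partial>lborel)"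
    by (rule lborel_pair.Fubini') measurable
  also have "(\<integral>\<^sup>+v. \<integral>\<^sup>+w. ?f v w \<partial>lborel \<partial>lborel) + (\<integral>\<^sup>+v. \<integral>\<^sup>+w. ?f v w \<partial>lborel \<partial>lborel)
      = (\<integral>\<^sup>+v. of_bool (0 \<le> v) * ennreal (v * (1 - G v)) + of_bool (0 \<le> v) * ennreal (v * (1 - G v)) \<partial>lborel)"
    unfolding len by (rule nn_integral_add[symmetric]) measurable
  also have "\<dots> = (\<integral>\<^sup>+v. of_bool (0 \<le> v) * ennreal (2 * v * (1 - G v)) \<partial>lborel)"
  proof (rule nn_integral_cong)
    fix v :: real
    have "0 \<le> v \<Longrightarrow> 0 \<le> v * (1 - G v)" using moment_G_le_1[OF G, of v] by simp
    then show "of_bool (0 \<le> v) * ennreal (v * (1 - G v)) + of_bool (0 \<le> v) * ennreal (v * (1 - G v))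
        = of_bool (0 \<le> v) * ennreal (2 * v * (1 - G v))"
      by (cases "0 \<le> v") (simp_all add: ennreal_plus[symmetric] del: ennreal_plus)
  qed
  also have "\<dots> \<le> ennreal M" by (rule moment_2[OF G])
  finally show "(\<integral>\<^sup>+v. of_bool (0 \<le> v) * biased_tail G v \<partial>lborel) \<le> ennreal M" .
qed

lemma cov_queue_sym: "cov_queue lam G t s = cov_queue lam G s t"
  by (simp add: cov_queue_def min.commute max.commute)

lemma cov_queue_measurable:
  assumes [measurable]: "lam \<in> borel_measurable borel" "G \<in> borel_measurable borel"
  shows "(\<lambda>x. cov_queue lam G (fst x) (snd x)) \<in> borel_measurable (borel \<Otimes>\<^sub>M borel)"
  unfolding cov_queue_def by measurable

text \<open>Fubini, with the integral over the second time variable carried out first.\<close>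

lemma cov_queue_row:
  assumes [measurable]: "lam \<in> borel_measurable borel" "G \<in> borel_measurable borel"
  shows "(\<integral>\<^sup>+s. cov_queue lam G t s \<partial>lborel)
    = (\<integral>\<^sup>+u. ennreal (lam u) * (of_bool (0 \<le> u \<and> u \<le> t) * biased_tail G (t - u)) \<partial>lborel)"
proof -
  have "(\<integral>\<^sup>+s. cov_queue lam G t s \<partial>lborel) = (\<integral>\<^sup>+u. \<integral>\<^sup>+s. ennreal (lam u) * (of_bool (0 \<le> u \<and> u \<le> min t s) * ennreal (1 - G (max t s - u))) \<partial>lborel \<partial>lborel)"
    unfolding cov_queue_def by (rule lborel_pair.Fubini') measurable
  also have "\<dots> = (\<integral>\<^sup>+u. ennreal (lam u) * (of_bool (0 \<le> u \<and> u \<le> t) * biased_tail G (t - u)) \<partial>lborel)"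
  proof (rule nn_integral_cong)
    fix u
    define f where "f s = ennreal (lam u) * (of_bool (0 \<le> u \<and> u \<le> min t s) * ennreal (1 - G (max t s - u)))" for s
    have [measurable]: "f \<in> borel_measurable borel" unfolding f_def by measurable
    have "(\<integral>\<^sup>+s. f s \<partial>lborel) = ennreal \<bar>1\<bar> * (\<integral>\<^sup>+w. f (u + 1 * w) \<partial>lborel)"
      by (rule nn_integral_real_affine) simp_all
    also have "\<dots> = (\<integral>\<^sup>+w. f (u + w) \<partial>lborel)" by simp
    also have "\<dots> = (\<integral>\<^sup>+w. (ennreal (lam u) * of_bool (0 \<le> u \<and> u \<le> t)) * (of_bool (0 \<le> w) * ennreal (1 - G (max (t - u) w))) \<partial>lborel)"
    proof (rule nn_integral_cong)
      fix w
      have "max t (u + w) - u = max (t - u) w" by (simp add: max_def)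
      then show "f (u + w) = (ennreal (lam u) * of_bool (0 \<le> u \<and> u \<le> t)) * (of_bool (0 \<le> w) * ennreal (1 - G (max (t - u) w)))"
        by (auto simp: f_def)
    qed
    also have "\<dots> = (ennreal (lam u) * of_bool (0 \<le> u \<and> u \<le> t)) * biased_tail G (t - u)"
      unfolding biased_tail_def by (rule nn_integral_cmult) measurable
    finally show "(\<integral>\<^sup>+s. ennreal (lam u) * (of_bool (0 \<le> u \<and> u \<le> min t s) * ennreal (1 - G (max t s - u))) \<partial>lborel)
      = ennreal (lam u) * (of_bool (0 \<le> u \<and> u \<le> t) * biased_tail G (t - u))"
      unfolding f_def[symmetric] by (simp only: mult.assoc)
  qed
  finally show ?thesis .
qed

text \<open>The factor \<open>exp 2\<close> is the price for replacing \<open>t\<close> by \<open>t - x\<^sub>0\<close> in the exponential weight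
\<open>exp (2 t / x\<^sub>0)\<close>.\<close>

definition growth_const :: "real \<Rightarrow> real" where
  "growth_const p = exp 2 * (1 + (p / 2) powr p)"

text \<open>For exponential growth the intensity is integrated exactly and the first moment is used, which
produces the factor \<open>1/\<sigma>\<close> in \<open>\<kappa>\<close>; for polynomial growth the intensity is replaced by its bound at \<open>t\<close>, and the
second moment is used. The weight \<open>exp (2 t / x\<^sub>0)\<close> absorbs \<open>(t / x\<^sub>0)\<^sup>p\<close> with a constant depending on \<open>p\<close>
only.\<close>

lemma cov_queue_row_bound:
  assumes lam [measurable]: "lam \<in> borel_measurable borel" and lam0: "\<And>t. 0 \<le> lam t"
    and g: "intensity_growth lam \<sigma> lam\<^sub>0 p a\<^sub>1 a\<^sub>2" and s: "0 \<le> \<sigma>" and l: "0 < lam\<^sub>0" and p: "0 \<le> p"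
    and G: "G \<in> moment_class M" and M: "0 < M" and x: "0 < x\<^sub>0" and t: "0 \<le> t"
  shows "(\<integral>\<^sup>+s. cov_queue lam G t s \<partial>lborel)
    \<le> ennreal (lam\<^sub>0 * M * growth_const p * varkappa \<sigma> p a\<^sub>1 a\<^sub>2 x\<^sub>0 * exp (2 * (\<sigma> + 1 / x\<^sub>0) * (t - x\<^sub>0)))"
proof -
  note [measurable] = moment_G_measurable[OF G] biased_tail_measurable[OF G]
  let ?k = "1 + (p / 2) powr p"
  have k1: "1 \<le> ?k" by simp
  show ?thesis
  proof (cases "0 < \<sigma>")
    case True
    then have gl: "lam u \<le> lam\<^sub>0 * exp (\<sigma> * u)" if "0 \<le> u" for u
      using g that by (simp add: intensity_growth_def)
    have "(\<integral>\<^sup>+s. cov_queue lam G t s \<partial>lborel)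
        \<le> (\<integral>\<^sup>+u. ennreal (lam\<^sub>0 * M) * (ennreal (exp (\<sigma> * u)) * indicator {0..t} u) \<partial>lborel)"
      unfolding cov_queue_row[OF lam moment_G_measurable[OF G]]
    proof (rule nn_integral_mono)
      fix u
      show "ennreal (lam u) * (of_bool (0 \<le> u \<and> u \<le> t) * biased_tail G (t - u)) \<le> ennreal (lam\<^sub>0 * M) * (ennreal (exp (\<sigma> * u)) * indicator {0..t} u)"
      proof (cases "0 \<le> u \<and> u \<le> t")
        case True
        have "ennreal (lam u) * biased_tail G (t - u) \<le> ennreal (lam\<^sub>0 * exp (\<sigma> * u)) * ennreal M"
          using True by (intro mult_mono ennreal_leI gl biased_tail_le[OF G]) auto
        also have "\<dots> = ennreal (lam\<^sub>0 * M) * ennreal (exp (\<sigma> * u))"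
          using l M by (simp add: ennreal_mult[symmetric] mult_ac)
        finally show ?thesis using True by simp
      qed auto
    qed
    also have "\<dots> = ennreal (lam\<^sub>0 * M) * (\<integral>\<^sup>+u. ennreal (exp (\<sigma> * u)) * indicator {0..t} u \<partial>lborel)"
      by (rule nn_integral_cmult) measurable
    also have "(\<integral>\<^sup>+u. ennreal (exp (\<sigma> * u)) * indicator {0..t} u \<partial>lborel) = ennreal (exp (\<sigma> * t) / \<sigma> - exp (\<sigma> * 0) / \<sigma>)"
      using True t by (intro nn_integral_FTC_Icc) (auto intro!: derivative_eq_intros)
    also have "ennreal (lam\<^sub>0 * M) * \<dots> \<le> ennreal (lam\<^sub>0 * M) * ennreal (exp (\<sigma> * t) / \<sigma>)"
      using True by (intro mult_left_mono ennreal_leI) auto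
    also have "\<dots> = ennreal (lam\<^sub>0 * M * (exp (\<sigma> * t) / \<sigma>))"
      using l M True by (simp add: ennreal_mult[symmetric])
    also have "\<dots> \<le> ennreal (lam\<^sub>0 * M * (growth_const p * varkappa \<sigma> p a\<^sub>1 a\<^sub>2 x\<^sub>0 * exp (2 * (\<sigma> + 1 / x\<^sub>0) * (t - x\<^sub>0))))"
    proof (intro ennreal_leI mult_left_mono)
      have "exp (\<sigma> * t) \<le> exp (2 + 2 * \<sigma> * x\<^sub>0 + 2 * (\<sigma> + 1 / x\<^sub>0) * (t - x\<^sub>0))"
      proof -
        have "2 + 2 * \<sigma> * x\<^sub>0 + 2 * (\<sigma> + 1 / x\<^sub>0) * (t - x\<^sub>0) = 2 * (\<sigma> * t) + 2 * (t / x\<^sub>0)"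
          using x by (simp add: field_simps)
        moreover have "0 \<le> \<sigma> * t" "0 \<le> t / x\<^sub>0" using s t x by auto
        ultimately show ?thesis by simp
      qed
      also have "\<dots> = exp 2 * exp (2 * \<sigma> * x\<^sub>0) * exp (2 * (\<sigma> + 1 / x\<^sub>0) * (t - x\<^sub>0))"
        by (simp only: exp_add)
      also have "\<dots> \<le> ?k * (exp 2 * exp (2 * \<sigma> * x\<^sub>0) * exp (2 * (\<sigma> + 1 / x\<^sub>0) * (t - x\<^sub>0)))"
        by (rule mult_right_mono[OF k1, of "exp 2 * exp (2 * \<sigma> * x\<^sub>0) * exp (2 * (\<sigma> + 1 / x\<^sub>0) * (t - x\<^sub>0))", simplified mult_1]) simp
      finally have "exp (\<sigma> * t) / \<sigma> \<le> ?k * (exp 2 * exp (2 * \<sigma> * x\<^sub>0) * exp (2 * (\<sigma> + 1 / x\<^sub>0) * (t - x\<^sub>0))) / \<sigma>"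
        using True by (intro divide_right_mono) auto
      then show "exp (\<sigma> * t) / \<sigma> \<le> growth_const p * varkappa \<sigma> p a\<^sub>1 a\<^sub>2 x\<^sub>0 * exp (2 * (\<sigma> + 1 / x\<^sub>0) * (t - x\<^sub>0))"
        using True by (simp add: growth_const_def varkappa_def mult_ac)
    qed (use l M in auto)
    finally show ?thesis by (simp only: mult.assoc)
  next
    case False
    then have s0: "\<sigma> = 0" using s by simp
    then have g': "0 \<le> p" "0 \<le> a\<^sub>1" "0 < a\<^sub>2" and gl: "\<And>u. 0 \<le> u \<Longrightarrow> lam u \<le> lam\<^sub>0 * (a\<^sub>1 + a\<^sub>2 * rpow u p)"
      using g by (auto simp: intensity_growth_def)
    let ?w = "a\<^sub>1 + a\<^sub>2 * rpow t p"
    have w: "0 \<le> ?w" using g' by (simp add: rpow_nonneg)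
    have "(\<integral>\<^sup>+s. cov_queue lam G t s \<partial>lborel)
        \<le> (\<integral>\<^sup>+u. ennreal (lam\<^sub>0 * ?w) * (of_bool (0 \<le> t - u) * biased_tail G (t - u)) \<partial>lborel)"
      unfolding cov_queue_row[OF lam moment_G_measurable[OF G]]
    proof (rule nn_integral_mono)
      fix u
      show "ennreal (lam u) * (of_bool (0 \<le> u \<and> u \<le> t) * biased_tail G (t - u)) \<le> ennreal (lam\<^sub>0 * ?w) * (of_bool (0 \<le> t - u) * biased_tail G (t - u))"
      proof (cases "0 \<le> u \<and> u \<le> t")
        case True
        have "lam u \<le> lam\<^sub>0 * (a\<^sub>1 + a\<^sub>2 * rpow u p)" using gl True by blast
        also have "\<dots> \<le> lam\<^sub>0 * ?w"
          using True g' l by (intro mult_left_mono add_left_mono rpow_mono) auto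
        finally have "ennreal (lam u) * biased_tail G (t - u) \<le> ennreal (lam\<^sub>0 * ?w) * biased_tail G (t - u)"
          by (intro mult_right_mono ennreal_leI) auto
        then show ?thesis using True by simp
      qed auto
    qed
    also have "\<dots> = ennreal (lam\<^sub>0 * ?w) * (\<integral>\<^sup>+u. of_bool (0 \<le> t - u) * biased_tail G (t - u) \<partial>lborel)"
      by (rule nn_integral_cmult) measurable
    also have "(\<integral>\<^sup>+u. of_bool (0 \<le> t - u) * biased_tail G (t - u) \<partial>lborel) = (\<integral>\<^sup>+v. of_bool (0 \<le> v) * biased_tail G v \<partial>lborel)"
      using nn_integral_real_affine[of "\<lambda>v. of_bool (0 \<le> v) * biased_tail G v" "-1" t] by simp
    also have "ennreal (lam\<^sub>0 * ?w) * \<dots> \<le> ennreal (lam\<^sub>0 * ?w) * ennreal M"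
      by (intro mult_left_mono biased_tail_integral[OF G]) simp
    also have "\<dots> = ennreal (lam\<^sub>0 * M * ?w)"
      using l w M by (subst ennreal_mult[symmetric]) (auto simp: mult_ac)
    also have "\<dots> \<le> ennreal (lam\<^sub>0 * M * (growth_const p * varkappa \<sigma> p a\<^sub>1 a\<^sub>2 x\<^sub>0 * exp (2 * (\<sigma> + 1 / x\<^sub>0) * (t - x\<^sub>0))))"
    proof (intro ennreal_leI mult_left_mono)
      let ?e = "exp (2 * (t / x\<^sub>0))"
      have e1: "1 \<le> ?e" using t x by simp
      have "rpow t p = rpow x\<^sub>0 p * rpow (t / x\<^sub>0) p"
        using t x by (subst rpow_mult[symmetric]) auto
      also have "\<dots> \<le> rpow x\<^sub>0 p * (?k * ?e)"
        using t x by (intro mult_left_mono rpow_le_exp p rpow_nonneg) auto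
      finally have r: "rpow t p \<le> rpow x\<^sub>0 p * (?k * ?e)" .
      have "1 \<le> ?k * ?e" using mult_mono[OF k1 e1] by simp
      then have "a\<^sub>1 \<le> a\<^sub>1 * (?k * ?e)" using g' by (simp add: mult_le_cancel_left1)
      moreover have "a\<^sub>2 * rpow t p \<le> a\<^sub>2 * (rpow x\<^sub>0 p * (?k * ?e))" using r g' by (intro mult_left_mono) auto
      ultimately have "?w \<le> (a\<^sub>1 + a\<^sub>2 * rpow x\<^sub>0 p) * (?k * ?e)" by (simp add: algebra_simps)
      also have "?e = exp 2 * exp (2 * (\<sigma> + 1 / x\<^sub>0) * (t - x\<^sub>0))"
        using x by (simp add: s0 exp_add[symmetric] field_simps)
      finally show "?w \<le> growth_const p * varkappa \<sigma> p a\<^sub>1 a\<^sub>2 x\<^sub>0 * exp (2 * (\<sigma> + 1 / x\<^sub>0) * (t - x\<^sub>0))"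
        by (simp add: growth_const_def varkappa_def s0 mult_ac)
    qed (use l M in auto)
    finally show ?thesis by (simp only: mult.assoc)
  qed
qed

text \<open>The mean as the Bochner integral of a convolution, the form to which \<open>deconvolution_identity\<close>
applies.\<close>

lemma mean_queue_convolution:
  assumes lam [measurable]: "lam \<in> borel_measurable borel" and lam0: "\<And>t. 0 \<le> lam t" "\<And>t. t < 0 \<Longrightarrow> lam t = 0"
    and G: "G \<in> moment_class M" and M: "0 < M"
    and c: "0 \<le> c" "0 \<le> e" "\<And>u. 0 \<le> u \<Longrightarrow> lam u \<le> c * exp (e * u)"
  defines "S \<equiv> \<lambda>v. if 0 \<le> v then 1 - G v else 0"
  shows "S \<in> borel_measurable borel" and "integrable lborel S"
    and "mean_queue lam G t = ennreal (LINT v|lborel. lam (t - v) * S v)"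
    and "0 \<le> (LINT v|lborel. lam (t - v) * S v)"
    and "t < 0 \<Longrightarrow> (LINT v|lborel. lam (t - v) * S v) = 0"
    and "0 \<le> t \<Longrightarrow> (LINT v|lborel. lam (t - v) * S v) \<le> c * M * exp (e * t)"
proof -
  note [measurable] = moment_G_measurable[OF G]
  show Sm [measurable]: "S \<in> borel_measurable borel" unfolding S_def by measurable
  have S0: "0 \<le> S v" for v using moment_G_le_1[OF G] by (simp add: S_def)
  have Sn: "(\<integral>\<^sup>+v. ennreal (S v) \<partial>lborel) \<le> ennreal M"
  proof -
    have "(\<integral>\<^sup>+v. ennreal (S v) \<partial>lborel) = (\<integral>\<^sup>+t. of_bool (0 \<le> t) * ennreal (1 - G t) \<partial>lborel)"
      by (intro nn_integral_cong) (simp add: S_def)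
    then show ?thesis using moment_1[OF G] by simp
  qed
  show Si: "integrable lborel S"
    using Sn S0 by (intro integrableI_bounded) (auto intro: le_less_trans)
  have SM: "(LINT v|lborel. S v) \<le> M"
    using Sn S0 M Si by (subst (asm) nn_integral_eq_integral) auto
  have bnd: "lam (t - v) * S v \<le> c * exp (e * max t 0) * S v" for v
  proof (cases "0 \<le> v \<and> v \<le> t")
    case True
    have "lam (t - v) \<le> c * exp (e * (t - v))" using True by (intro c) auto
    also have "\<dots> \<le> c * exp (e * max t 0)" using True c by (intro mult_left_mono) (auto intro: mult_left_mono)
    finally show ?thesis by (intro mult_right_mono S0)
  next
    case False
    then have "lam (t - v) * S v = 0" using lam0(2)[of "t - v"] by (auto simp: S_def)
    moreover have "0 \<le> c * exp (e * max t 0) * S v" using c S0 by (intro mult_nonneg_nonneg) auto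
    ultimately show ?thesis by linarith
  qed
  have i: "integrable lborel (\<lambda>v. lam (t - v) * S v)"
  proof (rule Bochner_Integration.integrable_bound)
    show "integrable lborel (\<lambda>v. c * exp (e * max t 0) * S v)" using Si by (rule integrable_mult_right)
    show "AE v in lborel. norm (lam (t - v) * S v) \<le> norm (c * exp (e * max t 0) * S v)"
    proof (rule AE_I2)
      fix v
      have "norm (lam (t - v) * S v) = lam (t - v) * S v" using lam0 S0 by simp
      also have "\<dots> \<le> c * exp (e * max t 0) * S v" by (rule bnd)
      also have "\<dots> \<le> norm \<dots>" by simp
      finally show "norm (lam (t - v) * S v) \<le> norm (c * exp (e * max t 0) * S v)" .
    qed
  qed measurable
  show H0: "0 \<le> (LINT v|lborel. lam (t - v) * S v)"
    by (intro integral_nonneg_AE AE_I2) (simp add: lam0 S0)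
  have "mean_queue lam G t = ennreal \<bar>-1\<bar> * (\<integral>\<^sup>+v. ennreal (lam (t + -1 * v)) * survivors G t (t + -1 * v) \<partial>lborel)"
    unfolding mean_queue_def survivors_def
    by (rule nn_integral_real_affine[where f = "\<lambda>u. ennreal (lam u) * (of_bool (0 \<le> u \<and> u \<le> t) * ennreal (1 - G (t - u)))"]) simp_all
  also have "\<dots> = (\<integral>\<^sup>+v. ennreal (lam (t - v) * S v) \<partial>lborel)"
  proof -
    have "ennreal (lam (t - v)) * survivors G t (t - v) = ennreal (lam (t - v) * S v)" for v
      using lam0(2)[of "t - v"] lam0(1)[of "t - v"] moment_G_le_1[OF G, of v]
      by (cases "t - v < 0") (auto simp: survivors_def S_def ennreal_mult)
    then show ?thesis by simp
  qed
  also have "\<dots> = ennreal (LINT v|lborel. lam (t - v) * S v)"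
    using i by (intro nn_integral_eq_integral) (simp_all add: lam0 S0)
  finally show "mean_queue lam G t = ennreal (LINT v|lborel. lam (t - v) * S v)" .
  show "(LINT v|lborel. lam (t - v) * S v) = 0" if "t < 0"
  proof -
    have "lam (t - v) * S v = 0" for v using that lam0(2)[of "t - v"] by (auto simp: S_def)
    then show ?thesis by (simp only: integral_zero)
  qed
  show "(LINT v|lborel. lam (t - v) * S v) \<le> c * M * exp (e * t)" if t: "0 \<le> t"
  proof -
    have "(LINT v|lborel. lam (t - v) * S v) \<le> (LINT v|lborel. c * exp (e * max t 0) * S v)"
      by (intro Bochner_Integration.integral_mono i bnd integrable_mult_right Si)
    also have "\<dots> = c * exp (e * t) * (LINT v|lborel. S v)" using t by simp
    also have "\<dots> \<le> c * exp (e * t) * M" using SM c by (intro mult_left_mono) auto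
    finally show ?thesis by (simp add: mult_ac)
  qed
qed

section \<open>The mean squared error for a fixed bandwidth\<close>

text \<open>The integral of \<open>b exp (s (t - x)) c exp ((\<sigma> + 1/(2 x)) t)\<close> over \<open>t \<ge> T\<close>, on the line
\<open>s = - (\<sigma> + 1/x)\<close>.\<close>

definition tail_bound :: "real \<Rightarrow> real \<Rightarrow> real \<Rightarrow> real \<Rightarrow> real \<Rightarrow> real" where
  "tail_bound b c \<sigma> x T = b * c * exp ((\<sigma> + 1 / x) * x) * (2 * x * exp (- (1 / (2 * x)) * T))"

text \<open>The first square is the squared bias, from smoothing and from the cut-off at \<open>T\<close>; the second summand
is the variance. The bound does not depend on \<open>s\<close>, because the kernel is moved to the line
\<open>Re z = - \<sigma> - 1/x\<close>. It holds uniformly in \<open>G\<close>, which enters only through its class.\<close>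

lemma (in deconvolution) mse_bound:
  fixes P :: "'w measure" and T x :: real
  assumes S: "Mt_G_infinity_sample P lam G n \<tau> \<sigma>'" and n: "1 \<le> n" and T: "0 \<le> T"
    and a: "arrival_intensity lam \<sigma>" and g: "intensity_growth lam \<sigma> lam\<^sub>0 p a\<^sub>1 a\<^sub>2" and p: "0 \<le> p"
    and x: "0 < x" and M: "0 < M" and GM: "G \<in> moment_class M" and GH: "G \<in> holder_class d \<beta> x A"
    and b: "0 < \<beta>" and A: "0 < A" and m: "strict_floor \<beta> + 1 \<le> m"
    and hd: "h < d" and hx: "(\<sigma> + 1 / x) * h \<le> 1" and s: "s < - \<sigma>"
    and c: "0 \<le> c" "\<And>u. 0 \<le> u \<Longrightarrow> lam u \<le> c * exp ((\<sigma> + 1 / (2 * x)) * u)"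
  shows "(\<integral>\<^sup>+w. ennreal ((cmod (G_estimator (L_kernel K lam s h) n T x (\<lambda>k. queue_length (\<tau> k) (\<sigma>' k)) w - of_real (G x)))\<^sup>2) \<partial>P)
    \<le> ennreal (2 * (C * A * h powr \<beta> + tail_bound (bound_const 1 * h powr (- \<gamma>) * (decay_L1 / h)) (c * M) \<sigma> x T)\<^sup>2
      + 2 * (lam\<^sub>0 * M * growth_const p * varkappa \<sigma> p a\<^sub>1 a\<^sub>2 x / real n * ((bound_const 1)\<^sup>2 * decay_L2 * h powr (- 2 * \<gamma> - 1))))"
proof -
  interpret prob_space P using S by (simp add: Mt_G_infinity_sample_def)
  \<comment> \<open>The distance \<open>1/x\<close> to the abscissa keeps the constants in \<open>cov_queue_row_bound\<close> independent of \<open>x\<close>.\<close>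
  define s' where "s' = - (\<sigma> + 1 / x)"
  have s': "s' < - \<sigma>" using x by (simp add: s'_def)
  have "\<bar>s'\<bar> = \<sigma> + 1 / x" unfolding s'_def abs_minus using pos x by simp
  then have s'h: "\<bar>s'\<bar> * h \<le> 1" using hx by simp
  define L where "L = L_kernel K lam s' h"
  have L: "L_kernel K lam s h = L" unfolding L_def using L_kernel_shift[OF s s'] by (intro ext)
  have Lm [measurable]: "L \<in> borel_measurable borel" unfolding L_def by (rule L_kernel_measurable[OF s'])
  note [measurable] = moment_G_measurable[OF GM]
  define Sv where "Sv v = (if 0 \<le> v then 1 - G v else 0)" for v
  have e0: "0 \<le> \<sigma> + 1 / (2 * x)" using pos x by auto
  note conv = mean_queue_convolution[OF lam_measurable lam_nonneg lam_neg GM M c(1) e0 c(2), folded Sv_def]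
  define H where "H t = (LINT v|lborel. lam (t - v) * Sv v)" for t
  have Sv_eq: "Sv = (\<lambda>v. if 0 \<le> v then 1 - G v else 0)" by (simp add: Sv_def fun_eq_iff)
  have Svm [measurable]: "Sv \<in> borel_measurable borel" and Svi: "integrable lborel Sv"
    using conv(1,2) unfolding Sv_eq by auto
  have H: "mean_queue lam G t = ennreal (H t)" "0 \<le> H t" "t < 0 \<Longrightarrow> H t = 0"
    "0 \<le> t \<Longrightarrow> H t \<le> c * M * exp ((\<sigma> + 1 / (2 * x)) * t)" for t
    using conv(3-6)[of t] unfolding H_def by auto
  have Sv0: "0 \<le> Sv v" "v < 0 \<Longrightarrow> Sv v = 0" for v
    using moment_G_le_1[OF GM, of v] by (auto simp: Sv_def)
  have ident: "integrable lborel (\<lambda>t. L (t - x) * of_real (H t))"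
    "(LINT t|lborel. L (t - x) * of_real (H t)) = of_real (LINT u|lborel. K u * Sv (x + h * u))"
    unfolding L_def H_def
    by (rule deconvolution_identity[OF s' Svm _ _ Svi], simp_all add: Sv0)+
  have Hm [measurable]: "H \<in> borel_measurable borel"
  proof -
    have "(\<lambda>t. LINT v|lborel. lam (t - v) * Sv v) \<in> borel_measurable borel" by measurable
    then show ?thesis by (simp add: H_def[abs_def])
  qed
  define l where "l t = indicator {0..T} t *\<^sub>R L (t - x)" for t
  have lm [measurable]: "l \<in> borel_measurable borel" unfolding l_def by measurable
  have lL: "cmod (l t) \<le> cmod (L (t - x))" for t by (simp add: l_def indicator_def)
  have cov_fin: "cov_queue lam G t u < \<infinity>" for t u
  proof -
    have "cov_queue lam G t u \<le> (\<integral>\<^sup>+v. ennreal (norm (indicator {0..t} v *\<^sub>R lam v)) \<partial>lborel)"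
      unfolding cov_queue_def
    proof (rule nn_integral_mono)
      fix v
      have "ennreal (lam v) * (of_bool (0 \<le> v \<and> v \<le> min t u) * ennreal (1 - G (max t u - v)))
        \<le> ennreal (lam v) * (of_bool (0 \<le> v \<and> v \<le> t) * 1)"
        using moment_G_nonneg[OF GM, of "max t u - v"]
        by (intro mult_left_mono mult_mono) (auto simp: ennreal_le_1)
      then show "ennreal (lam v) * (of_bool (0 \<le> v \<and> v \<le> min t u) * ennreal (1 - G (max t u - v)))
        \<le> ennreal (norm (indicator {0..t} v *\<^sub>R lam v))"
        using lam_nonneg[of v] by (auto simp: indicator_def split: if_splits)
    qed
    also have "\<dots> < \<infinity>"
      using a unfolding arrival_intensity_def set_integrable_def integrable_iff_bounded by blast
    finally show ?thesis .
  qed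
  define D where "D t u = enn2real (cov_queue lam G t u) / real n" for t u
  have D: "ennreal (D t u) = ennreal (1 / real n) * cov_queue lam G t u" for t u
  proof -
    have "D t u = 1 / real n * enn2real (cov_queue lam G t u)" by (simp add: D_def)
    then have "ennreal (D t u) = ennreal (1 / real n) * ennreal (enn2real (cov_queue lam G t u))"
      by (simp only: ennreal_mult' enn2real_nonneg ennreal_mult'')
    also have "ennreal (enn2real (cov_queue lam G t u)) = cov_queue lam G t u"
      using cov_fin[of t u] by (intro ennreal_enn2real) simp
    finally show ?thesis .
  qed
  have D0: "0 \<le> D t u" for t u by (simp add: D_def)
  define Y where "Y t w = (\<Sum>k=1..n. queue_length (\<tau> k) (\<sigma>' k) t w) / real n" for t w
  note mom = sample_moments[OF S n lam_nonneg _ lam_measurable, folded Y_def]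
  have li: "set_integrable lborel {0..b} lam" for b using a by (simp add: arrival_intensity_def)
  note mom = mom[OF li]
  have Ym: "(\<lambda>z. Y (fst z) (snd z)) \<in> borel_measurable (borel \<Otimes>\<^sub>M P)"
    unfolding Y_def by (intro borel_measurable_divide borel_measurable_sum mom(2)) auto
  have Y0: "AE w in P. \<forall>t. 0 \<le> Y t w"
    using mom(1) by eventually_elim (auto simp: Y_def intro!: divide_nonneg_nonneg sum_nonneg)
  have Y1: "(\<integral>\<^sup>+w. ennreal (Y t w) \<partial>P) = ennreal (H t)" for t
    using mom(4)[of t] by (simp add: H)
  have Y2: "(\<integral>\<^sup>+w. ennreal (Y t w * Y u w) \<partial>P) = ennreal (H t * H u + D t u)" for t u
    using mom(5)[of t u] H(2) D0 by (simp add: H(1) D[symmetric] ennreal_mult)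
  have f1: "(\<integral>\<^sup>+t. ennreal (cmod (l t) * H t) \<partial>lborel) < \<infinity>"
  proof -
    have "(\<integral>\<^sup>+t. ennreal (cmod (l t) * H t) \<partial>lborel) \<le> (\<integral>\<^sup>+t. ennreal (norm (L (t - x) * of_real (H t))) \<partial>lborel)"
      using H(2) by (intro nn_integral_mono ennreal_leI) (simp add: norm_mult mult_right_mono lL)
    also have "\<dots> < \<infinity>" using ident(1) by (simp only: integrable_iff_bounded)
    finally show ?thesis .
  qed
  \<comment> \<open>The Schur test leaves the row integrals of \<open>D\<close>; their exponential bound is the weight for which
    \<open>L_kernel_square\<close> applies on the line \<open>s'\<close>.\<close>
  let ?w = "lam\<^sub>0 * M * growth_const p * varkappa \<sigma> p a\<^sub>1 a\<^sub>2 x"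
  have w0: "0 \<le> ?w"
  proof -
    have "0 \<le> varkappa \<sigma> p a\<^sub>1 a\<^sub>2 x"
    proof (cases "0 < \<sigma>")
      case False
      then have "0 \<le> a\<^sub>1" "0 < a\<^sub>2" using g pos by (auto simp: intensity_growth_def)
      then show ?thesis using False rpow_nonneg[of x p] by (simp add: varkappa_def)
    qed (simp add: varkappa_def)
    moreover have "0 \<le> growth_const p" by (simp add: growth_const_def)
    ultimately show ?thesis using pos M by (intro mult_nonneg_nonneg) auto
  qed
  let ?V = "?w / real n * ((bound_const 1)\<^sup>2 * decay_L2 * h powr (- 2 * \<gamma> - 1))"
  have V: "(\<integral>\<^sup>+t. \<integral>\<^sup>+u. ennreal (cmod (l t) * cmod (l u) * D t u) \<partial>lborel \<partial>lborel) \<le> ennreal ?V"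
  proof -
    have "(\<integral>\<^sup>+t. \<integral>\<^sup>+u. ennreal (cmod (l t) * cmod (l u) * D t u) \<partial>lborel \<partial>lborel)
        = (\<integral>\<^sup>+t. \<integral>\<^sup>+u. ennreal (cmod (l t) * cmod (l u)) * (ennreal (1 / real n) * cov_queue lam G t u) \<partial>lborel \<partial>lborel)"
      using D0 by (intro nn_integral_cong) (simp add: ennreal_mult D)
    also have "\<dots> \<le> (\<integral>\<^sup>+t. ennreal ((cmod (l t))\<^sup>2) * (\<integral>\<^sup>+u. ennreal (1 / real n) * cov_queue lam G t u \<partial>lborel) \<partial>lborel)"
    proof (rule schur_symmetric)
      show "(\<lambda>z. ennreal (1 / real n) * cov_queue lam G (fst z) (snd z)) \<in> borel_measurable (borel \<Otimes>\<^sub>M borel)"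
        by (intro borel_measurable_times_ennreal borel_measurable_const cov_queue_measurable lam_measurable moment_G_measurable[OF GM])
      show "ennreal (1 / real n) * cov_queue lam G t u = ennreal (1 / real n) * cov_queue lam G u t" for t u
        by (simp only: cov_queue_sym)
    qed auto
    also have "\<dots> \<le> (\<integral>\<^sup>+t. ennreal (?w / real n) * ennreal ((cmod (L (- x + 1 * t)))\<^sup>2 * exp (- 2 * s' * (- x + 1 * t))) \<partial>lborel)"
    proof (rule nn_integral_mono)
      fix t
      have cm: "cov_queue lam G t \<in> borel_measurable borel"
        using measurable_compose[OF measurable_Pair1' cov_queue_measurable[OF lam_measurable moment_G_measurable[OF GM]], of t] by simp
      have "(\<integral>\<^sup>+u. ennreal (1 / real n) * cov_queue lam G t u \<partial>lborel) = ennreal (1 / real n) * (\<integral>\<^sup>+u. cov_queue lam G t u \<partial>lborel)"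
        using cm by (intro nn_integral_cmult) simp
      moreover have "ennreal ((cmod (l t))\<^sup>2) * (ennreal (1 / real n) * (\<integral>\<^sup>+u. cov_queue lam G t u \<partial>lborel))
          \<le> ennreal (?w / real n) * ennreal ((cmod (L (- x + 1 * t)))\<^sup>2 * exp (- 2 * s' * (- x + 1 * t)))"
      proof (cases "t \<in> {0..T}")
        case True
        have "(\<integral>\<^sup>+u. cov_queue lam G t u \<partial>lborel) \<le> ennreal (?w * exp (2 * (\<sigma> + 1 / x) * (t - x)))"
          using True by (intro cov_queue_row_bound[OF lam_measurable lam_nonneg g _ _ p GM M x]) (use pos in auto)
        then have "ennreal ((cmod (l t))\<^sup>2) * (ennreal (1 / real n) * (\<integral>\<^sup>+u. cov_queue lam G t u \<partial>lborel))
            \<le> ennreal ((cmod (l t))\<^sup>2) * (ennreal (1 / real n) * ennreal (?w * exp (2 * (\<sigma> + 1 / x) * (t - x))))"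
          by (intro mult_left_mono) auto
        also have "\<dots> = ennreal ((cmod (l t))\<^sup>2 * (1 / real n * (?w * exp (2 * (\<sigma> + 1 / x) * (t - x)))))"
          using w0 by (simp add: ennreal_mult[symmetric])
        also have "(cmod (l t))\<^sup>2 * (1 / real n * (?w * exp (2 * (\<sigma> + 1 / x) * (t - x))))
            = ?w / real n * ((cmod (L (- x + 1 * t)))\<^sup>2 * exp (- 2 * s' * (- x + 1 * t)))"
        proof -
          have "l t = L (- x + 1 * t)" using True by (simp add: l_def)
          moreover have "2 * (\<sigma> + 1 / x) * (t - x) = - 2 * s' * (- x + 1 * t)" by (simp add: s'_def)
          ultimately show ?thesis by simp
        qed
        also have "ennreal \<dots> = ennreal (?w / real n) * ennreal ((cmod (L (- x + 1 * t)))\<^sup>2 * exp (- 2 * s' * (- x + 1 * t)))"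
          using w0 by (intro ennreal_mult) auto
        finally show ?thesis .
      next
        case False
        then have "l t = 0" by (simp add: l_def)
        then show ?thesis by simp
      qed
      ultimately show "ennreal ((cmod (l t))\<^sup>2) * (\<integral>\<^sup>+u. ennreal (1 / real n) * cov_queue lam G t u \<partial>lborel)
          \<le> ennreal (?w / real n) * ennreal ((cmod (L (- x + 1 * t)))\<^sup>2 * exp (- 2 * s' * (- x + 1 * t)))" by simp
    qed
    also have "\<dots> = ennreal (?w / real n) * (\<integral>\<^sup>+t. ennreal ((cmod (L (- x + 1 * t)))\<^sup>2 * exp (- 2 * s' * (- x + 1 * t))) \<partial>lborel)"
      by (rule nn_integral_cmult) measurable
    also have "(\<integral>\<^sup>+t. ennreal ((cmod (L (- x + 1 * t)))\<^sup>2 * exp (- 2 * s' * (- x + 1 * t))) \<partial>lborel)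
        = (\<integral>\<^sup>+t. ennreal ((cmod (L t))\<^sup>2 * exp (- 2 * s' * t)) \<partial>lborel)"
      using nn_integral_real_affine[of "\<lambda>t. ennreal ((cmod (L t))\<^sup>2 * exp (- 2 * s' * t))" 1 "- x"] by simp
    also have "ennreal (?w / real n) * \<dots> \<le> ennreal (?w / real n) * ennreal ((bound_const 1)\<^sup>2 * decay_L2 * h powr (- 2 * \<gamma> - 1))"
      unfolding L_def by (intro mult_left_mono L_kernel_square[OF s' s'h]) simp
    also have "\<dots> = ennreal ?V"
      using w0 by (intro ennreal_mult'[symmetric]) auto
    finally show ?thesis .
  qed
  then have f2: "(\<integral>\<^sup>+t. \<integral>\<^sup>+u. ennreal (cmod (l t) * cmod (l u) * D t u) \<partial>lborel \<partial>lborel) < \<infinity>"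
    by (rule le_less_trans) simp
  note ms = mean_square_linear_functional[OF lm Ym Hm Y0 H(2) D0 Y1 Y2 f1 f2]
  \<comment> \<open>The cut-off at \<open>T\<close> costs the integral of \<open>|L(t - x)| H(t)\<close> over \<open>t > T\<close>, where \<open>L\<close> decays faster than
    \<open>H\<close> grows.\<close>
  define bb where "bb = bound_const 1 * h powr (- \<gamma>) * (decay_L1 / h)"
  let ?B = "C * A * h powr \<beta> + tail_bound bb (c * M) \<sigma> x T"
  let ?b = "complex_of_real (1 - G x)"
  have bias: "cmod (?b - (LINT t|lborel. l t * of_real (H t))) \<le> ?B"
  proof -
    let ?LH = "\<lambda>t. L (t - x) * of_real (H t)"
    have il: "integrable lborel (\<lambda>t. l t * of_real (H t))"
      using f1 H(2) by (intro integrableI_bounded) (simp_all add: norm_mult)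
    have full: "cmod ((LINT t|lborel. ?LH t) - ?b) \<le> C * A * h powr \<beta>"
    proof -
      have "(LINT u|lborel. K u * Sv (x + h * u)) = (LINT u|lborel. K u * (1 - G (x + h * u)))"
      proof (intro Bochner_Integration.integral_cong refl)
        fix u show "K u * Sv (x + h * u) = K u * (1 - G (x + h * u))"
        proof (cases "u \<in> {0..1}")
          case True then show ?thesis using h x by (simp add: Sv_def)
        qed (simp add: K_support)
      qed
      then have "(LINT t|lborel. ?LH t) - ?b = of_real ((LINT u|lborel. K u * (1 - G (x + h * u))) - (1 - G x))"
        by (simp only: ident(2) of_real_diff)
      then show ?thesis
        using kernel_bias[OF K GH b _ h hd m moment_G_measurable[OF GM] moment_G_nonneg[OF GM] moment_G_le_1[OF GM]] A
        by (simp only: norm_of_real less_imp_le)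
    qed
    have tail: "cmod ((LINT t|lborel. l t * of_real (H t)) - (LINT t|lborel. ?LH t))
        \<le> tail_bound bb (c * M) \<sigma> x T"
    proof -
      let ?c = "bb * (c * M) * exp ((\<sigma> + 1 / x) * x)"
      have Lb: "cmod (L t) \<le> exp (s' * t) * bb" for t
        unfolding L_def bb_def by (rule L_kernel_pointwise[OF s' s'h])
      have b0: "0 \<le> bb" using order_trans[OF norm_ge_zero Lb[of 0]] by simp
      have c0: "0 \<le> ?c" using b0 c M by (intro mult_nonneg_nonneg) auto
      have "ennreal (cmod ((LINT t|lborel. l t * of_real (H t)) - (LINT t|lborel. ?LH t)))
          = ennreal (cmod (LINT t|lborel. l t * of_real (H t) - ?LH t))"
        by (simp only: Bochner_Integration.integral_diff[OF il ident(1)])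
      also have "\<dots> \<le> (\<integral>\<^sup>+t. ennreal (norm (l t * of_real (H t) - ?LH t)) \<partial>lborel)"
        by (rule integral_norm_bound_ennreal) (rule Bochner_Integration.integrable_diff[OF il ident(1)])
      also have "\<dots> \<le> (\<integral>\<^sup>+t. ennreal ?c * (ennreal (exp (- (1 / (2 * x)) * t)) * indicator {T..} t) \<partial>lborel)"
      proof (rule nn_integral_mono)
        fix t
        show "ennreal (norm (l t * of_real (H t) - ?LH t)) \<le> ennreal ?c * (ennreal (exp (- (1 / (2 * x)) * t)) * indicator {T..} t)"
        proof (cases "t < 0 \<or> t \<in> {0..T}")
          case True
          then have "l t * of_real (H t) - ?LH t = 0" using H(3)[of t] by (auto simp: l_def)
          then show ?thesis by (simp only: norm_zero ennreal_0 zero_le)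
        next
          case False
          then have t: "0 \<le> t" "T \<le> t" "l t = 0" using T by (auto simp: l_def)
          have "norm (l t * of_real (H t) - ?LH t) = cmod (L (t - x)) * H t" using t H(2)[of t] by (simp add: norm_mult)
          also have "\<dots> \<le> (exp (s' * (t - x)) * bb) * (c * M * exp ((\<sigma> + 1 / (2 * x)) * t))"
            using t H b0 by (intro mult_mono Lb) auto
          also have "\<dots> = bb * (c * M) * (exp (s' * (t - x)) * exp ((\<sigma> + 1 / (2 * x)) * t))"
            by (simp only: mult_ac)
          also have "exp (s' * (t - x)) * exp ((\<sigma> + 1 / (2 * x)) * t) = exp ((\<sigma> + 1 / x) * x) * exp (- (1 / (2 * x)) * t)"
          proof -
            have "s' * (t - x) + (\<sigma> + 1 / (2 * x)) * t = (\<sigma> + 1 / x) * x + - (1 / (2 * x)) * t"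
              using x by (simp add: s'_def field_simps)
            then show ?thesis by (simp only: exp_add[symmetric])
          qed
          finally have "norm (l t * of_real (H t) - ?LH t) \<le> ?c * exp (- (1 / (2 * x)) * t)" by (simp only: mult.assoc)
          then have "ennreal (norm (l t * of_real (H t) - ?LH t)) \<le> ennreal (?c * exp (- (1 / (2 * x)) * t))" by (rule ennreal_leI)
          also have "\<dots> = ennreal ?c * ennreal (exp (- (1 / (2 * x)) * t))" using c0 by (intro ennreal_mult) auto
          also have "ennreal (exp (- (1 / (2 * x)) * t)) = ennreal (exp (- (1 / (2 * x)) * t)) * indicator {T..} t"
            using t by simp
          finally show ?thesis .
        qed
      qed
      also have "\<dots> = ennreal ?c * (\<integral>\<^sup>+t. ennreal (exp (- (1 / (2 * x)) * t)) * indicator {T..} t \<partial>lborel)"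
        by (rule nn_integral_cmult) measurable
      also have "(\<integral>\<^sup>+t. ennreal (exp (- (1 / (2 * x)) * t)) * indicator {T..} t \<partial>lborel) = ennreal (exp (- (1 / (2 * x)) * T) / (1 / (2 * x)))"
        using x by (intro nn_integral_exp_tail) simp
      also have "ennreal ?c * \<dots> = ennreal (?c * (exp (- (1 / (2 * x)) * T) / (1 / (2 * x))))"
        using c0 x by (intro ennreal_mult[symmetric]) auto
      also have "?c * (exp (- (1 / (2 * x)) * T) / (1 / (2 * x))) = tail_bound bb (c * M) \<sigma> x T"
        unfolding tail_bound_def by (simp add: mult_ac)
      finally have E: "ennreal (cmod ((LINT t|lborel. l t * of_real (H t)) - (LINT t|lborel. ?LH t)))
          \<le> ennreal (tail_bound bb (c * M) \<sigma> x T)" .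
      have "0 \<le> tail_bound bb (c * M) \<sigma> x T"
        unfolding tail_bound_def using b0 c M x by (intro mult_nonneg_nonneg) auto
      with E show ?thesis by (simp only: ennreal_le_iff)
    qed
    have "cmod (?b - (LINT t|lborel. l t * of_real (H t)))
        = cmod (((LINT t|lborel. ?LH t) - ?b) + ((LINT t|lborel. l t * of_real (H t)) - (LINT t|lborel. ?LH t)))"
      by (subst norm_minus_commute) (simp add: algebra_simps)
    also have "\<dots> \<le> ?B" using full tail by (intro order_trans[OF norm_triangle_ineq] add_mono)
    finally show ?thesis .
  qed
  \<comment> \<open>Almost surely all path integrals converge, and the estimation error is the error of the linear
    functional \<open>l\<close> of the averaged path.\<close>
  have est: "AE w in P. G_estimator (L_kernel K lam s h) n T x (\<lambda>k. queue_length (\<tau> k) (\<sigma>' k)) w - of_real (G x)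
      = ?b - (LINT t|lborel. l t * of_real (Y t w))"
  proof -
    have iXk: "AE w in P. integrable lborel (\<lambda>t. l t * of_real (queue_length (\<tau> k) (\<sigma>' k) t w))" if k: "k \<in> {1..n}" for k
    proof -
      interpret LP: pair_sigma_finite "lborel :: real measure" P ..
      have mk: "(\<lambda>z. queue_length (\<tau> k) (\<sigma>' k) (fst z) (snd z)) \<in> borel_measurable (borel \<Otimes>\<^sub>M P)" by (rule mom(2)[OF k])
      note [measurable] = mk
      have q0: "AE w in P. 0 \<le> queue_length (\<tau> k) (\<sigma>' k) t w" for t
        using mom(1) by eventually_elim (use k in blast)
      have "integrable (lborel \<Otimes>\<^sub>M P) (\<lambda>z. l (fst z) * of_real (queue_length (\<tau> k) (\<sigma>' k) (fst z) (snd z)))"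
      proof (rule integrableI_bounded)
        have "(\<integral>\<^sup>+z. ennreal (norm (l (fst z) * of_real (queue_length (\<tau> k) (\<sigma>' k) (fst z) (snd z)))) \<partial>(lborel \<Otimes>\<^sub>M P))
            = (\<integral>\<^sup>+t. \<integral>\<^sup>+w. ennreal (norm (l t * of_real (queue_length (\<tau> k) (\<sigma>' k) t w))) \<partial>P \<partial>lborel)"
          by (subst nn_integral_fst[symmetric]) simp_all
        also have "\<dots> = (\<integral>\<^sup>+t. ennreal (cmod (l t) * H t) \<partial>lborel)"
        proof (rule nn_integral_cong)
          fix t
          have mt: "queue_length (\<tau> k) (\<sigma>' k) t \<in> borel_measurable P"
            using measurable_compose[OF measurable_Pair1' mk, of t] by simp
          have "(\<integral>\<^sup>+w. ennreal (norm (l t * of_real (queue_length (\<tau> k) (\<sigma>' k) t w))) \<partial>P)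
              = (\<integral>\<^sup>+w. ennreal (cmod (l t)) * ennreal (queue_length (\<tau> k) (\<sigma>' k) t w) \<partial>P)"
            by (rule nn_integral_cong_AE) (use q0[of t] in \<open>eventually_elim, simp add: norm_mult ennreal_mult\<close>)
          also have "\<dots> = ennreal (cmod (l t)) * ennreal (H t)"
            using mt mom(3)[OF k, of t] by (subst nn_integral_cmult) (simp_all add: H(1))
          finally show "(\<integral>\<^sup>+w. ennreal (norm (l t * of_real (queue_length (\<tau> k) (\<sigma>' k) t w))) \<partial>P) = ennreal (cmod (l t) * H t)"
            using H(2)[of t] by (simp add: ennreal_mult)
        qed
        finally show "(\<integral>\<^sup>+z. ennreal (norm (l (fst z) * of_real (queue_length (\<tau> k) (\<sigma>' k) (fst z) (snd z)))) \<partial>(lborel \<Otimes>\<^sub>M P)) < \<infinity>"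
          using f1 by simp
      qed measurable
      then show ?thesis
        using LP.AE_integrable_snd[of "\<lambda>t w. l t * of_real (queue_length (\<tau> k) (\<sigma>' k) t w)"] by (simp add: case_prod_unfold)
    qed
    have "AE w in P. \<forall>k\<in>{1..n}. integrable lborel (\<lambda>t. l t * of_real (queue_length (\<tau> k) (\<sigma>' k) t w))"
      by (rule AE_finite_allI) (use iXk in auto)
    then show ?thesis
    proof eventually_elim
      case (elim w)
      have "(LINT t|lborel. l t * of_real (Y t w))
          = (LINT t|lborel. of_real (1 / real n) * (\<Sum>k=1..n. l t * of_real (queue_length (\<tau> k) (\<sigma>' k) t w)))"
        by (intro Bochner_Integration.integral_cong refl) (simp add: Y_def sum_distrib_left sum_divide_distrib mult_ac)
      also have "\<dots> = of_real (1 / real n) * (\<Sum>k=1..n. LINT t|lborel. l t * of_real (queue_length (\<tau> k) (\<sigma>' k) t w))"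
        using elim by (subst integral_mult_right_zero, subst Bochner_Integration.integral_sum) auto
      also have "\<dots> = of_real (1 / real n) * (\<Sum>k=1..n. LBINT t:{0..T}. L (t - x) * of_real (queue_length (\<tau> k) (\<sigma>' k) t w))"
        unfolding set_lebesgue_integral_def l_def by simp
      finally show ?case unfolding G_estimator_def L by simp
    qed
  qed
  have "(\<integral>\<^sup>+w. ennreal ((cmod (G_estimator (L_kernel K lam s h) n T x (\<lambda>k. queue_length (\<tau> k) (\<sigma>' k)) w - of_real (G x)))\<^sup>2) \<partial>P)
      = (\<integral>\<^sup>+w. ennreal ((cmod (?b - (LINT t|lborel. l t * of_real (Y t w))))\<^sup>2) \<partial>P)"
    by (rule nn_integral_cong_AE) (use est in \<open>eventually_elim, simp only:\<close>)
  also have "\<dots> \<le> 2 * ennreal ((cmod (?b - (LINT t|lborel. l t * of_real (H t))))\<^sup>2)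
        + 2 * (\<integral>\<^sup>+t. \<integral>\<^sup>+u. ennreal (cmod (l t) * cmod (l u) * D t u) \<partial>lborel \<partial>lborel)"
    by (rule ms(2))
  also have "\<dots> \<le> 2 * ennreal (?B\<^sup>2) + 2 * ennreal ?V"
    by (intro add_mono mult_left_mono V ennreal_leI power_mono bias) auto
  also have "\<dots> = ennreal (2 * ?B\<^sup>2 + 2 * ?V)"
  proof -
    have V0: "0 \<le> ?V" using w0 unfolding decay_L2_def by (auto intro!: mult_nonneg_nonneg divide_nonneg_nonneg integral_nonneg_AE)
    have two: "2 * ennreal y = ennreal (2 * y)" for y :: real by (simp add: ennreal_mult')
    show ?thesis unfolding two using V0 by (intro ennreal_plus[symmetric]) (simp_all only: mult_nonneg_nonneg zero_le_power2 zero_le_numeral)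
  qed
  finally show ?thesis unfolding bb_def .
qed

section \<open>The optimal bandwidth\<close>

lemma ennreal_sqrt_le:
  assumes "X \<le> ennreal (y\<^sup>2)" "0 \<le> y" shows "ennreal_sqrt X \<le> ennreal y"
proof -
  have f: "X < \<infinity>" using assms(1) by (rule le_less_trans) simp
  have "enn2real X \<le> y\<^sup>2" using assms by (intro enn2real_leI) auto
  then have "sqrt (enn2real X) \<le> y" using assms(2) by (intro real_le_lsqrt) auto
  then show ?thesis using f by (auto simp: ennreal_sqrt_def intro: ennreal_leI)
qed

lemma varkappa_pos:
  assumes "intensity_growth lam \<sigma> lam\<^sub>0 p a\<^sub>1 a\<^sub>2" "0 \<le> \<sigma>" "0 < x"
  shows "0 < varkappa \<sigma> p a\<^sub>1 a\<^sub>2 x"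
  using assms by (auto simp: varkappa_def intensity_growth_def rpow_def add_nonneg_pos)

lemma h_star_pos:
  assumes "0 < A" "0 < M" "0 < \<kappa>" "0 < lam\<^sub>0" "1 \<le> n"
  shows "0 < h_star \<beta> \<gamma> A M \<kappa> lam\<^sub>0 n"
  using assms by (simp add: h_star_def powr_gt_zero)

text \<open>The two equations that make \<open>h\<^sub>*\<close> balance bias and variance.\<close>

lemma h_star_rate:
  assumes pos: "0 < A" "0 < M" "0 < \<kappa>" "0 < lam\<^sub>0" "1 \<le> n" and b: "0 < \<beta>" "0 \<le> \<gamma>"
  defines "h \<equiv> h_star \<beta> \<gamma> A M \<kappa> lam\<^sub>0 n"
  shows "A * h powr \<beta> = rate \<beta> \<gamma> A M \<kappa> lam\<^sub>0 n"
    and "M * \<kappa> / (lam\<^sub>0 * real n) * h powr (- 2 * \<gamma> - 1) = (A * h powr \<beta>)\<^sup>2"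
proof -
  define \<rho> where "\<rho> = 2 * \<beta> + 2 * \<gamma> + 1"
  have \<rho>: "0 < \<rho>" using b by (simp add: \<rho>_def)
  define X where "X = M * \<kappa> / (lam\<^sub>0 * real n)"
  have X: "0 < X" using pos by (simp add: X_def)
  have "h = (X / A powr 2) powr (1 / \<rho>)"
    using pos by (simp add: h_def h_star_def X_def \<rho>_def mult_ac)
  also have "\<dots> = (X * A powr (- 2)) powr (1 / \<rho>)"
    by (simp only: powr_minus divide_inverse)
  also have "\<dots> = X powr (1 / \<rho>) * A powr (- 2 / \<rho>)"
    using X pos by (subst powr_mult) (auto simp: powr_powr)
  finally have h: "h = X powr (1 / \<rho>) * A powr (- 2 / \<rho>)" .
  have hp: "h powr e = X powr (e / \<rho>) * A powr (- 2 * e / \<rho>)" for e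
    unfolding h using X pos by (subst powr_mult) (auto simp: powr_powr)
  have Ah: "A * h powr \<beta> = A powr (1 + - 2 * \<beta> / \<rho>) * X powr (\<beta> / \<rho>)"
    unfolding hp powr_add using pos by simp
  have "1 + - 2 * \<beta> / \<rho> = (2 * \<gamma> + 1) / \<rho>"
  proof -
    have "1 + - 2 * \<beta> / \<rho> = (\<rho> + - 2 * \<beta>) / \<rho>" using \<rho> by (simp add: field_simps)
    then show ?thesis by (simp add: \<rho>_def)
  qed
  with Ah show "A * h powr \<beta> = rate \<beta> \<gamma> A M \<kappa> lam\<^sub>0 n"
    by (simp add: rate_def X_def \<rho>_def)
  have "(A * h powr \<beta>)\<^sup>2 = A powr 2 * h powr (2 * \<beta>)"
    using pos by (simp add: power_mult_distrib power2_eq_square powr_add[symmetric])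
  also have "\<dots> = (A powr 2 * h powr \<rho>) * h powr (- 2 * \<gamma> - 1)"
  proof -
    have "2 * \<beta> = \<rho> + (- 2 * \<gamma> - 1)" by (simp add: \<rho>_def)
    then show ?thesis by (simp only: powr_add mult.assoc)
  qed
  also have "A powr 2 * h powr \<rho> = X"
  proof -
    have "h powr \<rho> = X * A powr (- 2)" unfolding hp using \<rho> X by simp
    then have "A powr 2 * h powr \<rho> = X * (A powr 2 * A powr (- 2))" by simp
    also have "A powr 2 * A powr (- 2) = 1" using pos by (subst powr_add[symmetric]) simp
    finally show ?thesis by simp
  qed
  finally show "M * \<kappa> / (lam\<^sub>0 * real n) * h powr (- 2 * \<gamma> - 1) = (A * h powr \<beta>)\<^sup>2" by (simp add: X_def)
qed

lemma h_star_tendsto_0: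
  assumes pos: "0 < A" "0 < M" "0 < \<kappa>" "0 < lam\<^sub>0" and b: "0 < \<beta>" "0 \<le> \<gamma>"
  shows "h_star \<beta> \<gamma> A M \<kappa> lam\<^sub>0 \<longlonglongrightarrow> 0"
proof -
  define q e where "q = M * \<kappa> / (A\<^sup>2 * lam\<^sub>0)" and "e = 1 / (2 * \<beta> + 2 * \<gamma> + 1)"
  have q: "0 < q" "0 < e" using pos b by (auto simp: q_def e_def)
  have "(\<lambda>n. (q / real n) powr e) \<longlonglongrightarrow> 0"
    using q by real_asymp
  moreover have "h_star \<beta> \<gamma> A M \<kappa> lam\<^sub>0 = (\<lambda>n. (q / real n) powr e)"
    by (simp add: fun_eq_iff h_star_def q_def e_def)
  ultimately show ?thesis by simp
qed

text \<open>A power of \<open>h\<^sub>*\<close> is \<open>exp\<close> of a multiple of \<open>ln (\<lambda>\<^sub>0 n)\<close>, and this multiple is eventually below \<open>\<delta> T / 2\<close>.\<close>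

lemma exponential_beats_h_star:
  assumes pos: "0 < A" "0 < M" "0 < \<kappa>" "0 < lam\<^sub>0" and b: "0 < \<beta>" "0 \<le> \<gamma>"
    and T: "filterlim T at_top sequentially" "(\<lambda>n. 1 / T n * ln (lam\<^sub>0 * real n)) \<longlonglongrightarrow> 0" and d: "0 < \<delta>"
  shows "(\<lambda>n. h_star \<beta> \<gamma> A M \<kappa> lam\<^sub>0 n powr (- a) * exp (- \<delta> * T n)) \<longlonglongrightarrow> 0"
proof -
  define q e where "q = M * \<kappa> / (A\<^sup>2 * lam\<^sub>0)" and "e = 1 / (2 * \<beta> + 2 * \<gamma> + 1)"
  have q: "0 < q" using pos by (auto simp: q_def)
  have h: "h_star \<beta> \<gamma> A M \<kappa> lam\<^sub>0 n = (q / real n) powr e" for n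
    by (simp add: h_star_def q_def e_def)
  define c where "c = exp (- a * e * (ln q + ln lam\<^sub>0))"
  have hn: "h_star \<beta> \<gamma> A M \<kappa> lam\<^sub>0 n powr (- a) = c * exp (a * e * ln (lam\<^sub>0 * real n))" if n: "1 \<le> n" for n
  proof -
    have "h_star \<beta> \<gamma> A M \<kappa> lam\<^sub>0 n powr (- a) = (q / real n) powr (- a * e)"
      unfolding h by (simp add: powr_powr mult.commute)
    also have "\<dots> = exp (- a * e * ln (q / real n))"
      using q n by (simp add: powr_def)
    also have "ln (q / real n) = (ln q + ln lam\<^sub>0) - ln (lam\<^sub>0 * real n)"
      using q n pos by (simp add: ln_div ln_mult)
    also have "exp (- a * e * \<dots>) = c * exp (a * e * ln (lam\<^sub>0 * real n))"
      unfolding c_def by (simp add: exp_add[symmetric] algebra_simps)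
    finally show ?thesis .
  qed
  have "(\<lambda>n. a * e * (1 / T n * ln (lam\<^sub>0 * real n))) \<longlonglongrightarrow> a * e * 0"
    by (intro tendsto_intros T)
  then have "eventually (\<lambda>n. a * e * (1 / T n * ln (lam\<^sub>0 * real n)) < \<delta> / 2) sequentially"
    using d by (intro order_tendstoD(2)) auto
  moreover have "eventually (\<lambda>n. 0 < T n) sequentially"
    using T(1) by (simp add: filterlim_at_top_dense)
  ultimately have ev: "eventually (\<lambda>n. norm (h_star \<beta> \<gamma> A M \<kappa> lam\<^sub>0 n powr (- a) * exp (- \<delta> * T n)) \<le> c * exp (- (\<delta> / 2) * T n)) sequentially"
    using eventually_ge_at_top[of 1]
  proof eventually_elim
    case (elim n)
    have "a * e * ln (lam\<^sub>0 * real n) = a * e * (1 / T n * ln (lam\<^sub>0 * real n)) * T n" using elim by simp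
    also have "\<dots> \<le> \<delta> / 2 * T n" using elim by (intro mult_right_mono) auto
    finally have "a * e * ln (lam\<^sub>0 * real n) + - \<delta> * T n \<le> - (\<delta> / 2) * T n" by simp
    then have "exp (a * e * ln (lam\<^sub>0 * real n)) * exp (- \<delta> * T n) \<le> exp (- (\<delta> / 2) * T n)"
      unfolding exp_add[symmetric] by (subst exp_le_cancel_iff)
    then have "c * (exp (a * e * ln (lam\<^sub>0 * real n)) * exp (- \<delta> * T n)) \<le> c * exp (- (\<delta> / 2) * T n)"
      by (intro mult_left_mono) (simp_all add: c_def)
    then show ?case unfolding hn[OF elim(3)] by (simp add: c_def)
  qed
  have "((\<lambda>t. exp (- (\<delta> / 2) * t)) \<longlongrightarrow> 0) at_top" using d by real_asymp
  from filterlim_compose[OF this T(1)] have "(\<lambda>n. c * exp (- (\<delta> / 2) * T n)) \<longlonglongrightarrow> 0"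
    by (intro tendsto_mult_right_zero)
  with ev show ?thesis by (rule Lim_null_comparison)
qed

section \<open>The upper bound on the risk\<close>

theorem theorem2:
  fixes \<beta> \<gamma> p k\<^sub>0 C\<^sub>K :: real and K :: "real \<Rightarrow> real" and m r :: nat
  assumes "0 < \<beta>" and "0 \<le> \<gamma>" and "0 \<le> p" and "0 < k\<^sub>0"
    and "0 < m" and "0 < r" and "strict_floor \<beta> + 1 \<le> m" and "\<gamma> + 1 < real r"
    and "admissible_kernel K m r C\<^sub>K"
  shows "\<exists>C\<^sub>1 :: real.
    \<forall>(lam :: real \<Rightarrow> real) (\<sigma>\<^sub>l :: real) (lam\<^sub>0 :: real) (a\<^sub>1 :: real) (a\<^sub>2 :: real)
     (x\<^sub>0 :: real) (A :: real) (d :: real) (M :: real) (s :: real) (T :: nat \<Rightarrow> real)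
     (P :: nat \<Rightarrow> (real \<Rightarrow> real) \<Rightarrow> 'w measure)
     (\<tau> :: nat \<Rightarrow> (real \<Rightarrow> real) \<Rightarrow> nat \<Rightarrow> nat \<Rightarrow> 'w \<Rightarrow> real)
     (\<sigma> :: nat \<Rightarrow> (real \<Rightarrow> real) \<Rightarrow> nat \<Rightarrow> nat \<Rightarrow> 'w \<Rightarrow> real).
      arrival_intensity lam \<sigma>\<^sub>l \<and> 0 < lam\<^sub>0 \<and>
      intensity_growth lam \<sigma>\<^sub>l lam\<^sub>0 p a\<^sub>1 a\<^sub>2 \<and>
      laplace_lower_bound lam \<sigma>\<^sub>l lam\<^sub>0 k\<^sub>0 \<gamma> \<and>
      0 < x\<^sub>0 \<and> 0 < A \<and> 0 < d \<and> 0 < M \<and>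
      s < - \<sigma>\<^sub>l \<and>
      filterlim T at_top sequentially \<and>
      (\<lambda>n. 1 / T n * ln (lam\<^sub>0 * real n)) \<longlonglongrightarrow> 0 \<and>
      (\<forall>n. \<forall>G\<in>smooth_moment_class d \<beta> x\<^sub>0 A M.
         Mt_G_infinity_sample (P n G) lam G n (\<tau> n G) (\<sigma> n G))
      \<longrightarrow>
      (let \<kappa> = varkappa \<sigma>\<^sub>l p a\<^sub>1 a\<^sub>2 x\<^sub>0;
           est = (\<lambda>n G. G_estimator (L_kernel K lam s (h_star \<beta> \<gamma> A M \<kappa> lam\<^sub>0 n)) n (T n) x\<^sub>0
                    (\<lambda>k. queue_length (\<tau> n G k) (\<sigma> n G k)))
       in limsup (\<lambda>n. ennreal (inverse (rate \<beta> \<gamma> A M \<kappa> lam\<^sub>0 n)) *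
                      risk (P n) (est n) x\<^sub>0 (smooth_moment_class d \<beta> x\<^sub>0 A M))
            \<le> ennreal C\<^sub>1)"
proof -
  note b = \<open>0 < \<beta>\<close> \<open>0 \<le> \<gamma>\<close> and K = \<open>admissible_kernel K m r C\<^sub>K\<close>
  define c\<^sub>K where "c\<^sub>K = 2 powr (r / 2) * C\<^sub>K * exp 1 * (1 + 1\<^sup>2) powr (\<gamma> / 2)"
  define l1 where "l1 = (LINT v|lborel. (1 + v\<^sup>2) powr (- (real r - \<gamma>) / 2))"
  define l2 where "l2 = (LINT v|lborel. (1 + v\<^sup>2) powr (- (2 * (real r - \<gamma>)) / 2))"
  define v where "v = growth_const p * (c\<^sub>K / k\<^sub>0)\<^sup>2 * l2"
  have CK: "0 \<le> C\<^sub>K" by (rule kernel_C_nonneg[OF K])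
  have "0 \<le> l2" unfolding l2_def by (intro integral_nonneg_AE AE_I2) simp
  then have v: "0 \<le> v" by (simp add: v_def growth_const_def)
  \<comment> \<open>The squared bias is at most \<open>((C\<^sub>K + 1) \<phi>)\<^sup>2\<close>, where the summand \<open>1\<close> absorbs the cut-off at \<open>T\<close>; the
    variance is at most \<open>v \<phi>\<^sup>2\<close>.\<close>
  define C\<^sub>1 where "C\<^sub>1 = sqrt (2 * (C\<^sub>K + 1)\<^sup>2 + 2 * v)"
  have C1: "0 \<le> C\<^sub>1" "C\<^sub>1\<^sup>2 = 2 * (C\<^sub>K + 1)\<^sup>2 + 2 * v" using v by (simp_all add: C\<^sub>1_def)
  show ?thesis
  proof (intro exI[of _ C\<^sub>1] allI impI, elim conjE)
    fix lam :: "real \<Rightarrow> real" and \<sigma>\<^sub>l lam\<^sub>0 a\<^sub>1 a\<^sub>2 x A d M s :: real and T :: "nat \<Rightarrow> real"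
      and P :: "nat \<Rightarrow> (real \<Rightarrow> real) \<Rightarrow> 'w measure"
      and \<tau> \<sigma> :: "nat \<Rightarrow> (real \<Rightarrow> real) \<Rightarrow> nat \<Rightarrow> nat \<Rightarrow> 'w \<Rightarrow> real"
    assume ai: "arrival_intensity lam \<sigma>\<^sub>l" and l0: "0 < lam\<^sub>0" and ig: "intensity_growth lam \<sigma>\<^sub>l lam\<^sub>0 p a\<^sub>1 a\<^sub>2"
      and low: "laplace_lower_bound lam \<sigma>\<^sub>l lam\<^sub>0 k\<^sub>0 \<gamma>"
      and x: "0 < x" and A: "0 < A" and d: "0 < d" and M: "0 < M" and s: "s < - \<sigma>\<^sub>l"
      and T: "filterlim T at_top sequentially" "(\<lambda>n. 1 / T n * ln (lam\<^sub>0 * real n)) \<longlonglongrightarrow> 0"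
      and S: "\<forall>n. \<forall>G\<in>smooth_moment_class d \<beta> x A M. Mt_G_infinity_sample (P n G) lam G n (\<tau> n G) (\<sigma> n G)"
    have s0: "0 \<le> \<sigma>\<^sub>l" using ai by (simp add: arrival_intensity_def)
    define \<kappa> where "\<kappa> = varkappa \<sigma>\<^sub>l p a\<^sub>1 a\<^sub>2 x"
    have \<kappa>: "0 < \<kappa>" unfolding \<kappa>_def by (rule varkappa_pos[OF ig s0 x])
    define h where "h = h_star \<beta> \<gamma> A M \<kappa> lam\<^sub>0"
    define \<phi> where "\<phi> = rate \<beta> \<gamma> A M \<kappa> lam\<^sub>0"
    define est where "est = (\<lambda>n G. G_estimator (L_kernel K lam s (h n)) n (T n) x (\<lambda>k. queue_length (\<tau> n G k) (\<sigma> n G k)))"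
    note par = A M \<kappa> l0
    have hn: "0 < h n" "A * h n powr \<beta> = \<phi> n" "M * \<kappa> / (lam\<^sub>0 * real n) * h n powr (- 2 * \<gamma> - 1) = (\<phi> n)\<^sup>2"
      if "1 \<le> n" for n
      using h_star_pos[OF par that, of \<beta> \<gamma>] h_star_rate[OF par that b] by (simp_all add: h_def \<phi>_def)
    have \<phi>: "0 < \<phi> n" if "1 \<le> n" for n
      unfolding hn(2)[OF that, symmetric] using A hn(1)[OF that] by simp
    have h0: "h \<longlonglongrightarrow> 0" unfolding h_def by (rule h_star_tendsto_0[OF par b])
    \<comment> \<open>The excess \<open>1/(2 x)\<close> is half of the excess decay \<open>1/x\<close> of the kernel, so the cut-off still decays
      exponentially in \<open>T\<close>.\<close>
    obtain c where c: "0 \<le> c" "\<And>u. 0 \<le> u \<Longrightarrow> lam u \<le> c * exp ((\<sigma>\<^sub>l + 1 / (2 * x)) * u)"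
      using intensity_exp_bound[OF ig _ s0 l0, of "1 / (2 * x)"] x by auto
    define tail where "tail n = tail_bound (c\<^sub>K / (lam\<^sub>0 * k\<^sub>0) * h n powr (- \<gamma>) * (l1 / h n)) (c * M) \<sigma>\<^sub>l x (T n)" for n
    define t0 where "t0 = c\<^sub>K / (lam\<^sub>0 * k\<^sub>0) * l1 * (c * M) * exp ((\<sigma>\<^sub>l + 1 / x) * x) * (2 * x)"
    have "(\<lambda>n. t0 * (h n powr (- (\<gamma> + 1 + \<beta>)) * exp (- (1 / (2 * x)) * T n))) \<longlonglongrightarrow> t0 * 0"
      unfolding h_def using x by (intro tendsto_mult tendsto_const exponential_beats_h_star[OF par b T]) simp
    then have "eventually (\<lambda>n. t0 * (h n powr (- (\<gamma> + 1 + \<beta>)) * exp (- (1 / (2 * x)) * T n)) < A) sequentially"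
      using A by (intro order_tendstoD(2)) auto
    moreover have "eventually (\<lambda>n. h n < d) sequentially"
      using h0 d by (rule order_tendstoD(2))
    moreover have "eventually (\<lambda>n. h n < 1 / (\<sigma>\<^sub>l + 1 / x)) sequentially"
      using h0 s0 x by (intro order_tendstoD(2)[OF h0]) (simp add: add_nonneg_pos)
    moreover have "eventually (\<lambda>n. 0 \<le> T n) sequentially"
      using T(1) by (simp add: filterlim_at_top)
    ultimately have ev: "eventually (\<lambda>n. ennreal (inverse (\<phi> n)) * risk (P n) (est n) x (smooth_moment_class d \<beta> x A M) \<le> ennreal C\<^sub>1) sequentially"
      using eventually_ge_at_top[of 1]
    proof eventually_elim
      case (elim n)
      note n = \<open>1 \<le> n\<close>
      have hx: "(\<sigma>\<^sub>l + 1 / x) * h n \<le> 1"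
      proof -
        have "0 < \<sigma>\<^sub>l + 1 / x" using s0 x by (simp add: add_nonneg_pos)
        then show ?thesis using elim(3) by (simp add: pos_less_divide_eq mult.commute less_imp_le)
      qed
      interpret deconvolution K m r C\<^sub>K lam \<sigma>\<^sub>l lam\<^sub>0 k\<^sub>0 \<gamma> "h n"
      proof
        show "\<gamma> + 1 < real r" by fact
        show "0 < h n" by (rule hn(1)[OF n])
        show "lam \<in> borel_measurable borel" by (rule arrival_intensity_measurable[OF ai])
        show "0 \<le> lam t" for t using ai by (simp add: arrival_intensity_def)
        show "lam t = 0" if "t < 0" for t using ai that by (simp add: arrival_intensity_def)
        show "integrable lborel (\<lambda>t. exp (- c * t) * lam t)" if "\<sigma>\<^sub>l < c" for c
          by (rule arrival_intensity_laplace[OF ai that])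
      qed (use K low l0 \<open>0 < k\<^sub>0\<close> b s0 in auto)
      have const: "bound_const 1 = c\<^sub>K / (lam\<^sub>0 * k\<^sub>0)" unfolding bound_const_def c\<^sub>K_def ..
      have L12: "decay_L1 = l1" "decay_L2 = l2" by (simp_all add: decay_L1_def decay_L2_def l1_def l2_def)
      have tail0: "0 \<le> tail n"
      proof -
        have "0 \<le> l1" unfolding l1_def by (intro integral_nonneg_AE AE_I2) simp
        then show ?thesis unfolding tail_def tail_bound_def using bound_const_nonneg[of 1] hn(1)[OF n] c M x
          by (simp add: const[symmetric])
      qed
      have tail: "tail n \<le> \<phi> n"
      proof -
        have "h n powr (- \<gamma>) / h n = h n powr (- (\<gamma> + 1 + \<beta>)) * h n powr \<beta>"
        proof -
          have "h n powr (- \<gamma>) / h n = h n powr (- \<gamma> - 1)" using hn(1)[OF n] by (simp add: powr_diff)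
          also have "- \<gamma> - 1 = - (\<gamma> + 1 + \<beta>) + \<beta>" by simp
          finally show ?thesis by (simp only: powr_add)
        qed
        moreover have "tail n = t0 * (h n powr (- \<gamma>) / h n * exp (- (1 / (2 * x)) * T n))"
          by (simp add: tail_def tail_bound_def t0_def mult_ac)
        ultimately have "tail n = (t0 * (h n powr (- (\<gamma> + 1 + \<beta>)) * exp (- (1 / (2 * x)) * T n))) * h n powr \<beta>"
          by (simp only: mult_ac)
        also have "\<dots> \<le> A * h n powr \<beta>" using elim(1) by (intro mult_right_mono) auto
        finally show ?thesis by (simp only: hn(2)[OF n])
      qed
      have "risk (P n) (est n) x (smooth_moment_class d \<beta> x A M) \<le> ennreal (C\<^sub>1 * \<phi> n)"
        unfolding risk_def
      proof (rule SUP_least)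
        fix G assume G: "G \<in> smooth_moment_class d \<beta> x A M"
        then have GM: "G \<in> moment_class M" and GH: "G \<in> holder_class d \<beta> x A" by (auto simp: smooth_moment_class_def)
        let ?X = "\<integral>\<^sup>+w. ennreal ((cmod (est n G w - of_real (G x)))\<^sup>2) \<partial>P n G"
        have "?X \<le> ennreal (2 * (C\<^sub>K * A * h n powr \<beta> + tail n)\<^sup>2
            + 2 * (lam\<^sub>0 * M * growth_const p * \<kappa> / real n * ((c\<^sub>K / (lam\<^sub>0 * k\<^sub>0))\<^sup>2 * l2 * h n powr (- 2 * \<gamma> - 1))))"
          using mse_bound[OF S[rule_format, OF G] n elim(4) ai ig \<open>0 \<le> p\<close> x M GM GH b(1) A
            \<open>strict_floor \<beta> + 1 \<le> m\<close> elim(2) hx s c]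
          by (simp only: est_def tail_def \<kappa>_def const L12)
        also have "\<dots> \<le> ennreal ((C\<^sub>1 * \<phi> n)\<^sup>2)"
        proof (rule ennreal_leI)
          have "lam\<^sub>0 * M * growth_const p * \<kappa> / real n * ((c\<^sub>K / (lam\<^sub>0 * k\<^sub>0))\<^sup>2 * l2 * h n powr (- 2 * \<gamma> - 1))
              = v * (M * \<kappa> / (lam\<^sub>0 * real n) * h n powr (- 2 * \<gamma> - 1))"
            using l0 by (simp add: v_def power2_eq_square mult_ac)
          also have "\<dots> = v * (\<phi> n)\<^sup>2" by (simp only: hn(3)[OF n])
          finally have V: "lam\<^sub>0 * M * growth_const p * \<kappa> / real n * ((c\<^sub>K / (lam\<^sub>0 * k\<^sub>0))\<^sup>2 * l2 * h n powr (- 2 * \<gamma> - 1))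
              = v * (\<phi> n)\<^sup>2" .
          have CA: "C\<^sub>K * A * h n powr \<beta> = C\<^sub>K * \<phi> n" by (simp only: mult.assoc hn(2)[OF n])
          have "C\<^sub>K * A * h n powr \<beta> + tail n \<le> (C\<^sub>K + 1) * \<phi> n"
            unfolding CA distrib_right using tail by simp
          moreover have "0 \<le> C\<^sub>K * A * h n powr \<beta> + tail n" using CK A tail0 by simp
          ultimately have "(C\<^sub>K * A * h n powr \<beta> + tail n)\<^sup>2 \<le> ((C\<^sub>K + 1) * \<phi> n)\<^sup>2" by (rule power_mono)
          then show "2 * (C\<^sub>K * A * h n powr \<beta> + tail n)\<^sup>2
            + 2 * (lam\<^sub>0 * M * growth_const p * \<kappa> / real n * ((c\<^sub>K / (lam\<^sub>0 * k\<^sub>0))\<^sup>2 * l2 * h n powr (- 2 * \<gamma> - 1)))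
            \<le> (C\<^sub>1 * \<phi> n)\<^sup>2"
            unfolding V power_mult_distrib C1(2) by (simp add: distrib_right)
        qed
        finally show "ennreal_sqrt ?X \<le> ennreal (C\<^sub>1 * \<phi> n)"
          using C1(1) \<phi>[OF n] by (intro ennreal_sqrt_le) auto
      qed
      then have "ennreal (inverse (\<phi> n)) * risk (P n) (est n) x (smooth_moment_class d \<beta> x A M)
          \<le> ennreal (inverse (\<phi> n)) * ennreal (C\<^sub>1 * \<phi> n)" by (rule mult_left_mono) simp
      also have "\<dots> = ennreal C\<^sub>1"
        using \<phi>[OF n] C1(1) by (simp add: ennreal_mult[symmetric])
      finally show ?case .
    qed
    have "limsup (\<lambda>n. ennreal (inverse (\<phi> n)) * risk (P n) (est n) x (smooth_moment_class d \<beta> x A M)) \<le> ennreal C\<^sub>1"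
      by (rule Limsup_bounded[OF ev])
    then show "let \<kappa> = varkappa \<sigma>\<^sub>l p a\<^sub>1 a\<^sub>2 x;
           est = (\<lambda>n G. G_estimator (L_kernel K lam s (h_star \<beta> \<gamma> A M \<kappa> lam\<^sub>0 n)) n (T n) x
                    (\<lambda>k. queue_length (\<tau> n G k) (\<sigma> n G k)))
       in limsup (\<lambda>n. ennreal (inverse (rate \<beta> \<gamma> A M \<kappa> lam\<^sub>0 n)) *
                      risk (P n) (est n) x (smooth_moment_class d \<beta> x A M))
            \<le> ennreal C\<^sub>1"
      unfolding Let_def est_def h_def \<phi>_def \<kappa>_def .
  qed
qed

end
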